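(* Let $\hbar>0$. For all points $v\in\mathbb{D}_n$, the evaluation functional $\delta_v\colon\widehat{\mathcal{A}}_\hbar(\mathbb{D}_n)\to\mathbb{C}$ is positive, i.e. $\delta_v(\overline{a}\star_{\mathbb{D}_n}a)\ge0$ for all $a\in\widehat{\mathcal{A}}_\hbar(\mathbb{D}_n)$.
   Context: Fix $n\ge1$. On $\mathbb{C}^{n+1}$ with coordinates $z^0,\dots,z^n$ let $\mathsf{g}=\mathrm{diag}(-1,1,\dots,1)$, $y(z)=|z^0|^2-|z^1|^2-\dots-|z^n|^2$, $C_{n+1}^+=\{z: y(z)>0\}$, $\mathbb{D}_n=\{v\in\mathbb{C}^n:|v|^2<1\}$, and $\pi\colon C_{n+1}^+\to\mathbb{D}_n$, $\pi(z)=(z^1/z^0,\dots,z^n/z^0)$. An index triple is $(P,Q,\alpha)$ with $P,Q\in\mathbb{N}_0^n$, $\alpha\in\mathbb{N}_0$, $|P|,|Q|\le\alpha$. Put $\mathsf{e}_{P,Q,\alpha}(z)=(z^0)^{\alpha-|P|}z^P(\bar z^0)^{\alpha-|Q|}\bar z^Q$ where $z^P=(z^1)^{P_1}\cdots(z^n)^{P_n}$; these form a basis of the $\mathrm{U}(1)$-invariant polynomials in $z,\bar z$. For $\hbar\ne0$ the Wick product of polynomials is $f\star g=\sum_{r\ge0}\frac{(2\hbar)^r}{r!}\sum_{i_1,\dots,i_r,j_1,\dots,j_r=0}^n\mathsf{g}^{i_1j_1}\cdots\mathsf{g}^{i_rj_r}\frac{\partial^rf}{\partial z^{i_1}\cdots\partial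 z^{i_r}}\frac{\partial^rg}{\partial\bar z^{j_1}\cdots\partial\bar z^{j_r}}$; it preserves $\mathrm{U}(1)$-invariant polynomials. With $(x)_r=x(x+1)\cdots(x+r-1)$, let $S$ be the (injective) linear map from $\mathrm{U}(1)$-invariant polynomials to $C^\infty(C_{n+1}^+)$ with $S\mathsf{e}_{P,Q,\alpha}=(2\hbar)^\alpha\big(\tfrac{y}{2\hbar}\big)_\alpha\frac{\mathsf{e}_{P,Q,\alpha}}{y^\alpha}$, and $\mathsf{f}_{P,Q,\alpha}=\frac{1}{P!(\alpha-|P|)!Q!(\alpha-|Q|)!}\big(\frac{y}{2\hbar}\big)_\alpha\frac{\mathsf{e}_{P,Q,\alpha}}{y^\alpha}$. $\mathcal{A}_\hbar(C_{n+1}^+)$ is the span of the (linearly independent) $\mathsf{f}_{P,Q,\alpha}$, with product $a\,\tilde\star\,b=S(S^{-1}a\star S^{-1}b)$. $\mathcal{A}_\hbar(C_{n+1}^+)$ carries the locally convex topology of the seminorms $\sup_{(P,Q,\alpha)}|a_{P,Q,\alpha}|/(\alpha!)^\epsilon$, $0<\epsilon<1$, for $a=\sum a_{P,Q,\alpha}\mathsf{f}_{P,Q,\alpha}$. The product and all evaluations $\delta_w(a)=a(w)$, $w\in C_{n+1}^+$, are continuous, and the completion $\widehat{\mathcal{A}}_\hbar(C_{n+1}^+)$ is a Fréchet algebra of functions on $C_{n+1}^+$, consisting of all $\sum a_{P,Q,\alpha}\mathsf{f}_{P,Q,\alpha}$ for which all these seminorms are finite. For $\hbar>0$, $\mathcal{J}_{y=1}=\bigcap_{y(w)=1}\ker\delta_w$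 is a closed two-sided $^*$-ideal, and $\widehat{\mathcal{A}}_\hbar(\mathbb{D}_n)=\widehat{\mathcal{A}}_\hbar(C_{n+1}^+)/\mathcal{J}_{y=1}$ with quotient topology, induced product $\star_{\mathbb{D}_n}$, and pointwise complex conjugation as continuous $^*$-involution; its elements are functions on $\mathbb{D}_n$ via $\delta_v([a])=[a](v)=a(w)$ for any $w$ with $\pi(w)=v$, $y(w)=1$. *)

theory Defs
  imports "HOL-Analysis.Analysis" "HOL-Algebra.QuotRing"
begin

text \<open>
  The number n is the cardinality of the finite type \<open>'n\<close>, so it is positive.
  Points of the (n+1)-dimensional complex space are vectors indexed by \<open>'n option\<close>:
  the coordinate with index 0 is \<open>z $ None\<close>, the remaining n coordinates are \<open>z $ Some i\<close>.

  A function on the open cone C+ is represented by its extension by 0 to the whole space,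
  so that equality of such functions is equality on C+. The deformation parameter is \<open>h\<close>.
\<close>

type_synonym 'n pt = "complex ^ ('n option)"
type_synonym 'n fn = "complex ^ ('n option) \<Rightarrow> complex"
type_synonym 'n triple = "('n \<Rightarrow> nat) \<times> ('n \<Rightarrow> nat) \<times> nat"

section \<open>The cone and the disc\<close>

definition yfun :: "'n::finite pt \<Rightarrow> real" where
  "yfun z = (cmod (z $ None))\<^sup>2 - (\<Sum>i\<in>UNIV. (cmod (z $ Some i))\<^sup>2)"

definition cone :: "'n::finite pt set" where
  "cone = {z. yfun z > 0}"

definition disc :: "(complex ^ 'n::finite) set" where
  "disc = {v. (norm v)\<^sup>2 < 1}"

definition proj :: "'n::finite pt \<Rightarrow> complex ^ 'n" where
  "proj z = (\<chi> i. z $ Some i / z $ None)"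

section \<open>U(1)-invariant polynomials and the Wick product\<close>

definition mdeg :: "('n::finite \<Rightarrow> nat) \<Rightarrow> nat" where
  "mdeg P = (\<Sum>i\<in>UNIV. P i)"

definition mfact :: "('n::finite \<Rightarrow> nat) \<Rightarrow> nat" where
  "mfact P = (\<Prod>i\<in>UNIV. fact (P i))"

definition mpow :: "'n::finite pt \<Rightarrow> ('n \<Rightarrow> nat) \<Rightarrow> complex" where
  "mpow z P = (\<Prod>i\<in>UNIV. (z $ Some i) ^ P i)"

definition triples :: "'n::finite triple set" where
  "triples = {(P, Q, \<alpha>). mdeg P \<le> \<alpha> \<and> mdeg Q \<le> \<alpha>}"

fun e_mon :: "'n::finite triple \<Rightarrow> 'n fn" where
  "e_mon (P, Q, \<alpha>) z =
     (z $ None) ^ (\<alpha> - mdeg P) * mpow z P * (cnj (z $ None)) ^ (\<alpha> - mdeg Q) * cnj (mpow z Q)"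

definition fin_coeffs :: "('n::finite triple \<Rightarrow> complex) set" where
  "fin_coeffs = {c. finite {T. c T \<noteq> 0} \<and> (\<forall>T. T \<notin> triples \<longrightarrow> c T = 0)}"

definition e_comb :: "('n::finite triple \<Rightarrow> complex) \<Rightarrow> 'n fn" where
  "e_comb c = (\<lambda>z. \<Sum>T | c T \<noteq> 0. c T * e_mon T z)"

text \<open>The monomials \<open>e_mon T\<close> form a basis of the U(1)-invariant polynomials, which are
  therefore taken to be their span.\<close>

definition U1_polys :: "'n::finite fn set" where
  "U1_polys = e_comb ` fin_coeffs"

definition e_coeffs :: "'n::finite fn \<Rightarrow> 'n triple \<Rightarrow> complex" where
  "e_coeffs p = (THE c. c \<in> fin_coeffs \<and> p = e_comb c)"

definition d_z :: "'n::finite option \<Rightarrow> 'n fn \<Rightarrow> 'n fn" where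
  "d_z i f = (\<lambda>z. (frechet_derivative f (at z) (axis i 1)
                   - \<i> * frechet_derivative f (at z) (axis i \<i>)) / 2)"

definition d_zbar :: "'n::finite option \<Rightarrow> 'n fn \<Rightarrow> 'n fn" where
  "d_zbar i f = (\<lambda>z. (frechet_derivative f (at z) (axis i 1)
                   + \<i> * frechet_derivative f (at z) (axis i \<i>)) / 2)"

definition metric :: "'n option \<Rightarrow> 'n option \<Rightarrow> complex" where
  "metric i j = (if i = j then (if i = None then -1 else 1) else 0)"

text \<open>The lists \<open>is\<close> and \<open>js\<close> run over the index tuples of length r. On polynomials the outer
  series has only finitely many nonzero terms.\<close>

definition wick :: "real \<Rightarrow> 'n::finite fn \<Rightarrow> 'n fn \<Rightarrow> 'n fn" where
  "wick h f g = (\<lambda>z. \<Sum>r. of_real ((2 * h) ^ r / fact r) *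
     (\<Sum>is | length is = r. \<Sum>js | length js = r.
        (\<Prod>k<r. metric (is ! k) (js ! k)) * foldr d_z is f z * foldr d_zbar js g z))"

section \<open>The algebra on the cone\<close>

fun S_mon :: "real \<Rightarrow> 'n::finite triple \<Rightarrow> 'n fn" where
  "S_mon h (P, Q, \<alpha>) z = (if z \<in> cone
     then of_real ((2 * h) ^ \<alpha> * pochhammer (yfun z / (2 * h)) \<alpha>)
            * e_mon (P, Q, \<alpha>) z / of_real (yfun z ^ \<alpha>)
     else 0)"

definition S_map :: "real \<Rightarrow> 'n::finite fn \<Rightarrow> 'n fn" where
  "S_map h p = (\<lambda>z. \<Sum>T | e_coeffs p T \<noteq> 0. e_coeffs p T * S_mon h T z)"

fun f_mon :: "real \<Rightarrow> 'n::finite triple \<Rightarrow> 'n fn" where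
  "f_mon h (P, Q, \<alpha>) z = (if z \<in> cone
     then of_real (1 / (of_nat (mfact P) * fact (\<alpha> - mdeg P) * of_nat (mfact Q) * fact (\<alpha> - mdeg Q))
                    * pochhammer (yfun z / (2 * h)) \<alpha>)
            * e_mon (P, Q, \<alpha>) z / of_real (yfun z ^ \<alpha>)
     else 0)"

definition f_comb :: "real \<Rightarrow> ('n::finite triple \<Rightarrow> complex) \<Rightarrow> 'n fn" where
  "f_comb h c = (\<lambda>z. \<Sum>\<^sub>\<infinity>T\<in>triples. c T * f_mon h T z)"

definition alg_C :: "real \<Rightarrow> 'n::finite fn set" where
  "alg_C h = f_comb h ` fin_coeffs"

definition prod_C :: "real \<Rightarrow> 'n::finite fn \<Rightarrow> 'n fn \<Rightarrow> 'n fn" where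
  "prod_C h a b = S_map h (wick h (the_inv_into U1_polys (S_map h) a)
                                  (the_inv_into U1_polys (S_map h) b))"

section \<open>The completion\<close>

fun weighted :: "real \<Rightarrow> ('n::finite triple \<Rightarrow> complex) \<Rightarrow> 'n triple \<Rightarrow> real" where
  "weighted \<epsilon> c (P, Q, \<alpha>) = cmod (c (P, Q, \<alpha>)) / (fact \<alpha>) powr \<epsilon>"

definition hat_coeffs :: "('n::finite triple \<Rightarrow> complex) set" where
  "hat_coeffs = {c. (\<forall>T. T \<notin> triples \<longrightarrow> c T = 0) \<and>
                    (\<forall>\<epsilon>. 0 < \<epsilon> \<and> \<epsilon> < 1 \<longrightarrow> bdd_above (weighted \<epsilon> c ` triples))}"

definition hat_C :: "real \<Rightarrow> 'n::finite fn set" where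
  "hat_C h = f_comb h ` hat_coeffs"

definition f_coeffs :: "real \<Rightarrow> 'n::finite fn \<Rightarrow> 'n triple \<Rightarrow> complex" where
  "f_coeffs h a = (THE c. c \<in> hat_coeffs \<and> a = f_comb h c)"

definition seminorm_C :: "real \<Rightarrow> real \<Rightarrow> 'n::finite fn \<Rightarrow> real" where
  "seminorm_C h \<epsilon> a = (SUP T\<in>triples. weighted \<epsilon> (f_coeffs h a) T)"

definition tendsto_C :: "real \<Rightarrow> (nat \<Rightarrow> 'n::finite fn) \<Rightarrow> 'n fn \<Rightarrow> bool" where
  "tendsto_C h X a \<longleftrightarrow>
     (\<forall>\<epsilon>. 0 < \<epsilon> \<and> \<epsilon> < 1 \<longrightarrow> (\<lambda>k. seminorm_C h \<epsilon> (\<lambda>z. X k z - a z)) \<longlonglongrightarrow> 0)"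

text \<open>The continuous extension of \<open>prod_C\<close> to the completion. The seminorms decrease in
  \<open>\<epsilon>\<close>, so countably many of them define the topology and sequences suffice.\<close>

definition hat_prod :: "real \<Rightarrow> 'n::finite fn \<Rightarrow> 'n fn \<Rightarrow> 'n fn" where
  "hat_prod h a b = (THE c. c \<in> hat_C h \<and>
     (\<forall>X Y. (\<forall>k. X k \<in> alg_C h) \<and> (\<forall>k. Y k \<in> alg_C h) \<and> tendsto_C h X a \<and> tendsto_C h Y b
        \<longrightarrow> tendsto_C h (\<lambda>k. prod_C h (X k) (Y k)) c))"

definition hat_C_ring :: "real \<Rightarrow> ('n::finite fn) ring" where
  "hat_C_ring h = \<lparr>carrier = hat_C h,
                   mult = hat_prod h,
                   one = (\<lambda>z. if z \<in> cone then 1 else 0),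
                   zero = (\<lambda>z. 0),
                   add = (\<lambda>a b z. a z + b z)\<rparr>"

section \<open>The quotient on the disc\<close>

definition van_ideal :: "real \<Rightarrow> 'n::finite fn set" where
  "van_ideal h = {a \<in> hat_C h. \<forall>w. yfun w = 1 \<longrightarrow> a w = 0}"

definition hat_D_ring :: "real \<Rightarrow> ('n::finite fn set) ring" where
  "hat_D_ring h = hat_C_ring h Quot van_ideal h"

definition conj_D :: "'n::finite fn set \<Rightarrow> 'n fn set" where
  "conj_D A = (\<lambda>a z. cnj (a z)) ` A"

text \<open>The common value at v of all representatives of a coset.\<close>

definition eval_D :: "complex ^ 'n::finite \<Rightarrow> 'n fn set \<Rightarrow> complex" where
  "eval_D v A = (THE x. \<forall>a\<in>A. \<forall>w. proj w = v \<and> yfun w = 1 \<longrightarrow> a w = x)"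

end

theory Submission
  imports Defs "HOL-Complex_Analysis.Conformal_Mappings"
begin

text \<open>
  Write an element of the completed algebra as \<open>\<Sum> a(K, L) f(K, L)\<close>, where \<open>K\<close> and \<open>L\<close> are
  multi-indices of equal degree in all n+1 coordinates. In these coefficients the product no longer
  contains the deformation parameter: its structure constants are signed products of binomial
  coefficients, divided by \<open>r!\<close> for \<open>r\<close> contractions (\<open>star\<close>). An entry of order \<open>g\<close> involves only
  coefficients of orders \<open>\<alpha>, \<beta> \<le> g\<close> with \<open>\<alpha> + \<beta> = g + r\<close>, so \<open>\<alpha>! \<beta>! \<le> g! r!\<close>, and the formal
  product is defined and continuous on the whole completion (\<open>star_bnd\<close>, \<open>aconv_star\<close>). Since an
  element is determined as a function by its coefficients (\<open>eval_series_eq_0_imp\<close>), the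
  product of the completion is this formal product (\<open>hat_prod_fA\<close>).

  Fix a point \<open>w\<close> with \<open>y(w) = 1\<close> and put \<open>t = 1 / (2 h)\<close>. Complete \<open>w\<close>, which is a negative unit
  vector of the indefinite Hermitian form, to a pseudo-orthonormal frame by spacelike vectors
  \<open>u\<^sub>1, \<dots>, u\<^sub>n\<close>. In this frame the contractions along \<open>w\<close> are multiplications by numbers, by
  Euler's identity, and the alternating sum over their number is evaluated by an identity of
  Vandermonde type (\<open>pochhammer_vandermonde\<close>). All signs disappear and, for polynomials,
  \<open>(a \<star> b)(w) = \<Sum>\<^sub>s 1 / (s! (t)\<^sub>s) \<Sum>\<^sub>k A\<^sub>k(a) cnj (A\<^sub>k(b\<^sup>*))\<close>, where \<open>k\<close> runs over the words of length
  \<open>s\<close> in the spacelike vectors and \<open>A\<^sub>k(a)\<close> is a derivative of the polarisation of \<open>a\<close>: the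
  conjugate variable is held fixed at the conjugate of \<open>w\<close>, and the remaining holomorphic function
  is differentiated along \<open>k\<close> at \<open>w\<close> (\<open>eval_star_trunc\<close>). For \<open>a = b\<^sup>*\<close> this is a sum of nonnegative terms, and positivity passes to
  the limit (\<open>eval_star_nonneg\<close>).

  A class on the disc is a coset, so the value of the product must also not change when a
  representative is changed by a function vanishing on \<open>y = 1\<close>. The polarisation of such a
  function at \<open>w\<close> vanishes on the complex affine space \<open>w + w\<^sup>\<bottom>\<close> (\<open>eval_series_tangent\<close>), along which the vectors of \<open>k\<close> point;
  hence all its \<open>A\<^sub>k\<close> vanish (\<open>amp_sums_0\<close>), and so does its product with any element at
  \<open>w\<close> (\<open>null_star_eq_0\<close>).
\<close>

section \<open>Multi-indices\<close>

definition graded :: "nat \<Rightarrow> ('i::finite \<Rightarrow> nat) set" where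
  "graded g = {K. mdeg K = g}"

definition degbox :: "nat \<Rightarrow> ('i::finite \<Rightarrow> nat) set" where
  "degbox N = {K. mdeg K \<le> N}"

definition below :: "('i::finite \<Rightarrow> nat) \<Rightarrow> ('i \<Rightarrow> nat) set" where
  "below K = {R. \<forall>i. R i \<le> K i}"

definition mbinom :: "('i::finite \<Rightarrow> nat) \<Rightarrow> ('i \<Rightarrow> nat) \<Rightarrow> nat" where
  "mbinom K R = (\<Prod>i\<in>UNIV. K i choose R i)"

abbreviation inc :: "('i \<Rightarrow> nat) \<Rightarrow> 'i \<Rightarrow> ('i \<Rightarrow> nat)" where
  "inc K i \<equiv> K(i := Suc (K i))"

abbreviation addl :: "('i \<Rightarrow> nat) \<Rightarrow> 'i list \<Rightarrow> ('i \<Rightarrow> nat)" where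
  "addl K is \<equiv> (\<lambda>i. K i + count_list is i)"

lemma mdeg_component_le: "K i \<le> mdeg K"
  unfolding mdeg_def by (rule member_le_sum) auto

lemma mdeg_eq_0_iff: "mdeg K = 0 \<longleftrightarrow> K = (\<lambda>_. 0)"
  by (auto simp: mdeg_def fun_eq_iff)

lemma mdeg_add: "mdeg (\<lambda>i. K i + R i) = mdeg K + mdeg R"
  by (simp add: mdeg_def sum.distrib)

lemma mdeg_inc [simp]: "mdeg (inc K i) = Suc (mdeg K)"
proof -
  have "mdeg (inc K i) = (\<Sum>j\<in>UNIV. K j + (if j = i then 1 else 0))"
    unfolding mdeg_def by (rule sum.cong) auto
  then show ?thesis by (simp add: sum.distrib mdeg_def)
qed

lemma sum_count_list_UNIV: "(\<Sum>i\<in>(UNIV :: 'i::finite set). count_list is i) = length is"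
proof (induction "is")
  case (Cons a "is")
  have "(\<Sum>i\<in>UNIV. count_list (a # is) i) = (\<Sum>i\<in>UNIV. count_list is i + (if a = i then 1 else 0))"
    by (rule sum.cong) auto
  with Cons show ?case by (simp add: sum.distrib)
qed simp

lemma mdeg_addl [simp]: "mdeg (addl K is) = mdeg K + length is"
  by (simp add: mdeg_add[unfolded mdeg_def] mdeg_def sum_count_list_UNIV sum.distrib)

lemma mdeg_diff: "R \<in> below K \<Longrightarrow> mdeg (K - R) = mdeg K - mdeg R"
  unfolding mdeg_def below_def by (simp add: sum_subtractf_nat)

lemma mdeg_mono: "R \<in> below K \<Longrightarrow> mdeg R \<le> mdeg K"
  unfolding mdeg_def below_def by (auto intro: sum_mono)

lemma below_PiE: "below K = PiE UNIV (\<lambda>i. {..K i})"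
  by (auto simp: below_def PiE_def)

lemma finite_below [simp]: "finite (below K)"
  unfolding below_PiE by (auto intro: finite_PiE)

lemma box_subset_PiE: "degbox N \<subseteq> PiE UNIV (\<lambda>_. {..N})"
  using mdeg_component_le by (fastforce simp: degbox_def PiE_def intro: order_trans)

lemma finite_box [simp]: "finite (degbox N)"
  by (rule finite_subset[OF box_subset_PiE]) (auto intro: finite_PiE)

lemma finite_mdeg_le [simp]: "finite {K. mdeg K \<le> N}"
  using finite_box[of N] by (simp add: degbox_def)

lemma mdeg_zero [simp]: "mdeg (\<lambda>_. 0) = 0"
  by (simp add: mdeg_def)

lemma graded_subset_box: "g \<le> N \<Longrightarrow> graded g \<subseteq> degbox N"
  by (auto simp: graded_def degbox_def)

lemma finite_graded [simp]: "finite (graded g)"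
  using finite_subset[OF graded_subset_box[OF order_refl]] by simp

lemma finite_lists_length [simp]: "finite {is :: 'i::finite list. length is = r}"
  using finite_lists_length_eq[of "UNIV :: 'i set" r] by simp

lemma card_lists_length: "card {is :: 'i::finite list. length is = r} = CARD('i) ^ r"
  using card_lists_length_eq[of "UNIV :: 'i set" r] by simp

lemma lists_length_Suc: "{is. length is = Suc r} = (\<lambda>(i, is). i # is) ` (UNIV \<times> {is. length is = r})"
  by (auto simp: length_Suc_conv image_iff)

lemma sum_lists_Suc:
  "(\<Sum>is | length is = Suc r. f is) = (\<Sum>i\<in>(UNIV :: 'i::finite set). \<Sum>is | length is = r. f (i # is))"
  unfolding lists_length_Suc
  by (subst sum.reindex) (auto simp: inj_on_def sum.cartesian_product intro!: sum.cong)

lemma sum_rotate: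
  "(\<Sum>a\<in>A. \<Sum>b\<in>B. \<Sum>c\<in>C. f a b c) = (\<Sum>c\<in>C. \<Sum>a\<in>A. \<Sum>b\<in>B. f a b c)"
  by (subst sum.swap[of _ C B], subst sum.swap[of _ C A]) (rule refl)

subsection \<open>Growth of factorials\<close>

text \<open>The \<open>g\<close>-th power of this base bounds both the number of multi-indices of degree \<open>g\<close> and their
  multinomial coefficients. Geometric factors of any size are harmless, since every positive
  power of a factorial outgrows them.\<close>
definition facbase :: "'i::finite itself \<Rightarrow> real" where
  "facbase _ = 2 ^ CARD('i)"

lemma facbase_ge_1: "facbase TYPE('i::finite) \<ge> 1"
  by (simp add: facbase_def)

lemma card_graded_le: "real (card (graded g :: ('i::finite \<Rightarrow> nat) set)) \<le> facbase TYPE('i) ^ g"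
proof -
  have "card (graded g :: ('i \<Rightarrow> nat) set) \<le> card (PiE (UNIV :: 'i set) (\<lambda>_. {..g}))"
    using order_trans[OF graded_subset_box[OF order_refl] box_subset_PiE]
    by (intro card_mono finite_PiE) auto
  also have "\<dots> = Suc g ^ CARD('i)" by (simp add: card_PiE)
  finally have "real (card (graded g :: ('i \<Rightarrow> nat) set)) \<le> real (Suc g) ^ CARD('i)"
    by (metis of_nat_le_iff of_nat_power)
  also have "\<dots> \<le> (2 ^ g) ^ CARD('i)"
    by (rule power_mono) (metis Suc_leI less_exp numeral_power_eq_of_nat_cancel_iff of_nat_le_iff, simp)
  finally show ?thesis by (simp add: facbase_def power_mult[symmetric] mult.commute)
qed

lemma fact_mdeg_le_mfact:
  "(fact (mdeg K) :: real) \<le> facbase TYPE('i) ^ mdeg K * real (mfact (K :: 'i::finite \<Rightarrow> nat))"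
proof -
  have "(fact (\<Sum>i\<in>S. K i) :: real) \<le> (2 ^ card S) ^ (\<Sum>i\<in>S. K i) * (\<Prod>i\<in>S. fact (K i))"
    if "finite S" for S :: "'i set"
    using that
  proof (induction S rule: finite_induct)
    case (insert i S)
    let ?a = "K i" and ?b = "\<Sum>i\<in>S. K i"
    have "real ((?a + ?b) choose ?a) \<le> 2 ^ (?a + ?b)"
      by (metis binomial_le_pow2 numeral_power_eq_of_nat_cancel_iff of_nat_le_iff)
    then have "(fact (?a + ?b) :: real) \<le> 2 ^ (?a + ?b) * (fact ?a * fact ?b)"
      by (simp add: binomial_fact field_simps)
    also have "\<dots> \<le> 2 ^ (?a + ?b) * (fact ?a * ((2 ^ card S) ^ ?b * (\<Prod>i\<in>S. fact (K i))))"
      using insert.IH by (intro mult_left_mono) auto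
    also have "\<dots> \<le> 2 ^ (?a + ?b) * (fact ?a * ((2 ^ card S) ^ (?a + ?b) * (\<Prod>i\<in>S. fact (K i))))"
      by (intro mult_left_mono mult_right_mono power_increasing) (auto simp: prod_nonneg)
    also have "\<dots> = (2 ^ card (insert i S)) ^ (\<Sum>i\<in>insert i S. K i) * (\<Prod>i\<in>insert i S. fact (K i))"
      using insert by (simp add: power_mult_distrib algebra_simps)
    finally show ?case using insert by simp
  qed auto
  from this[of UNIV] show ?thesis
    by (simp add: mdeg_def mfact_def facbase_def)
qed

lemma sum_mbinom: "(\<Sum>R\<in>below K. real (mbinom K R)) = 2 ^ mdeg K"
proof -
  have "(\<Sum>R\<in>below K. real (mbinom K R)) = (\<Sum>R\<in>PiE UNIV (\<lambda>i. {..K i}). \<Prod>i\<in>UNIV. real (K i choose R i))"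
    by (simp add: below_PiE mbinom_def)
  also have "\<dots> = (\<Prod>i\<in>UNIV. \<Sum>r\<le>K i. real (K i choose r))"
    by (subst prod_sum_PiE) auto
  also have "\<dots> = (\<Prod>i\<in>UNIV. 2 ^ K i)"
  proof (rule prod.cong)
    fix i show "(\<Sum>r\<le>K i. real (K i choose r)) = 2 ^ K i"
      by (metis choose_row_sum of_nat_numeral of_nat_power of_nat_sum)
  qed simp
  also have "\<dots> = 2 ^ mdeg K" by (simp add: mdeg_def power_sum)
  finally show ?thesis .
qed

text \<open>For \<open>L = M powr (1 / e)\<close> this is the \<open>e\<close>-th power of \<open>L ^ g \<le> exp L * g!\<close>, which holds because
  \<open>L ^ g / g!\<close> is a single term of the exponential series.\<close>
lemma power_le_fact_powr:
  assumes "e > 0" "M \<ge> (0::real)"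
  shows "\<exists>C>0. \<forall>g. M ^ g \<le> C * fact g powr e"
proof (cases "M = 0")
  case True
  have "M ^ g \<le> 1 * fact g powr e" for g
  proof -
    have "M ^ g \<le> 1" using True by (cases g) auto
    also have "1 \<le> (fact g :: real) powr e"
      using assms by (simp add: ge_one_powr_ge_zero fact_ge_1)
    finally show ?thesis by simp
  qed
  then show ?thesis by (intro exI[of _ 1]) auto
next
  case False
  define L where "L = M powr (1 / e)"
  have L: "L > 0" using False assms by (simp add: L_def)
  have *: "M ^ g \<le> exp (e * L) * fact g powr e" for g
  proof -
    have "L ^ g / fact g \<le> exp L"
    proof -
      have "(\<lambda>n. L ^ n / fact n) sums exp L" using exp_converges[of L] by (simp add: divide_inverse mult.commute)
      then show ?thesis using L sum_le_suminf[of "\<lambda>n. L ^ n / fact n" "{g}"]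
        by (auto simp: sums_iff)
    qed
    then have le: "L ^ g \<le> exp L * fact g" by (simp add: field_simps)
    have "M ^ g = (L ^ g) powr e"
      using False assms by (simp add: L_def powr_powr powr_realpow[symmetric] powr_power) 
    also have "\<dots> \<le> (exp L * fact g) powr e"
      using le L assms by (intro powr_mono2) auto
    also have "\<dots> = exp (e * L) * fact g powr e"
      by (simp add: powr_mult powr_def[of "exp L"])
    finally show ?thesis .
  qed
  then show ?thesis by (intro exI[of _ "exp (e * L)"]) auto
qed

lemma summable_power_div_fact_powr:
  assumes "e > 0" "M \<ge> (0::real)"
  shows "summable (\<lambda>g. M ^ g / fact g powr e)"
proof -
  obtain C where C: "C > 0" "\<And>g. (2 * M) ^ g \<le> C * fact g powr e"
    using power_le_fact_powr[of e "2 * M"] assms by auto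
  show ?thesis
  proof (rule summable_comparison_test')
    show "summable (\<lambda>g. C * (1/2) ^ g)" by (intro summable_mult summable_geometric) auto
    show "norm (M ^ g / fact g powr e) \<le> C * (1/2) ^ g" if "g \<ge> 0" for g
      using C(2)[of g] assms by (simp add: field_simps power_mult_distrib)
  qed
qed

text \<open>As \<open>\<beta> \<le> g\<close> forces \<open>r \<le> \<alpha>\<close>, the quotient \<open>g! / \<alpha>!\<close> dominates \<open>\<beta>! / r!\<close>, which has the same
  number of factors.\<close>
lemma fact_mult_fact_le:
  assumes "\<alpha> + \<beta> = g + r" "\<alpha> \<le> g" "\<beta> \<le> g"
  shows "(fact \<alpha> * fact \<beta> :: real) \<le> fact g * fact r"
proof -
  have "(fact a * fact (r + k) :: real) \<le> fact (a + k) * fact r" if "r \<le> a" for a k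
  proof (induction k)
    case (Suc k)
    have "(fact a * fact (r + Suc k) :: real) = real (r + Suc k) * (fact a * fact (r + k))" by simp
    also have "\<dots> \<le> real (a + Suc k) * (fact (a + k) * fact r)"
      using that by (intro mult_mono[OF _ Suc.IH]) auto
    finally show ?case by (simp add: algebra_simps)
  qed simp
  from this[of \<alpha> "g - \<alpha>"] assms show ?thesis
    by (smt (verit) Nat.add_diff_assoc2 add.commute add_diff_cancel_left' le_add_diff_inverse nat_add_left_cancel_le)
qed

lemma norm_pochhammer_le: "norm (pochhammer (t::'a::{real_normed_field}) g) \<le> fact g * (1 + norm t) ^ g"
proof (induction g)
  case (Suc g)
  have "norm (t + of_nat g) \<le> real (Suc g) * (1 + norm t)"
    by (rule order_trans[OF norm_triangle_ineq]) (simp add: algebra_simps)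
  then have "norm (pochhammer t (Suc g)) \<le> (fact g * (1 + norm t) ^ g) * (real (Suc g) * (1 + norm t))"
    unfolding pochhammer_Suc norm_mult using Suc by (intro mult_mono) auto
  then show ?case by (simp add: algebra_simps)
qed simp

section \<open>Coefficient arrays and the formal product\<close>

text \<open>Coefficient arrays, indexed by a multi-index for \<open>z\<close> and one for its conjugate.\<close>
type_synonym 'i arr = "('i \<Rightarrow> nat) \<Rightarrow> ('i \<Rightarrow> nat) \<Rightarrow> complex"

text \<open>Divided powers: with them differentiation is a mere shift of coefficients, and multiplication is
  binomial convolution.\<close>
definition dpow :: "complex ^ 'i::finite \<Rightarrow> ('i \<Rightarrow> nat) \<Rightarrow> complex" where
  "dpow z K = (\<Prod>i\<in>UNIV. (z $ i) ^ K i / fact (K i))"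

text \<open>The homogeneous part of bidegree \<open>(g, g)\<close>, with an independent variable \<open>\<zeta>\<close> in place of the
  conjugate of \<open>z\<close>, so that it is a polynomial on the complexification.\<close>
definition hpart :: "nat \<Rightarrow> 'i::finite arr \<Rightarrow> complex ^ 'i \<Rightarrow> complex ^ 'i \<Rightarrow> complex" where
  "hpart g a z \<zeta> = (\<Sum>K\<in>graded g. \<Sum>L\<in>graded g. a K L * dpow z K * dpow \<zeta> L)"

definition eqdeg :: "'i::finite arr \<Rightarrow> bool" where
  "eqdeg a \<longleftrightarrow> (\<forall>K L. mdeg K \<noteq> mdeg L \<longrightarrow> a K L = 0)"

definition bnd :: "real \<Rightarrow> real \<Rightarrow> 'i::finite arr \<Rightarrow> bool" where
  "bnd e B a \<longleftrightarrow> (\<forall>K L. norm (a K L) \<le> B * fact (mdeg K) powr e)"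

text \<open>The completion and its convergent sequences on the level of coefficients. A bound
  at order \<open>g\<close> by a multiple of \<open>(g!)\<^sup>e\<close> is the statement that the seminorm of index \<open>e\<close> is finite.\<close>
definition hat :: "'i::finite arr set" where
  "hat = {a. eqdeg a \<and> (\<forall>e. 0 < e \<and> e < 1 \<longrightarrow> (\<exists>B. bnd e B a))}"

definition aconv :: "(nat \<Rightarrow> 'i::finite arr) \<Rightarrow> 'i arr \<Rightarrow> bool" where
  "aconv X a \<longleftrightarrow> (\<forall>e. 0 < e \<and> e < 1 \<longrightarrow>
     (\<forall>\<delta>>0. \<forall>\<^sub>F k in sequentially. bnd e \<delta> (\<lambda>K L. X k K L - a K L)))"

text \<open>Binomial convolution gives the coefficients of a product in divided powers.\<close>
definition bconv :: "'i::finite arr \<Rightarrow> 'i arr \<Rightarrow> 'i arr" where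
  "bconv c d K L = (\<Sum>R\<in>below K. \<Sum>Q\<in>below L.
     of_nat (mbinom K R) * of_nat (mbinom L Q) * (c (K - R) Q * d R (L - Q)))"

text \<open>The inverse metric is diagonal, so only equal index words \<open>is\<close> and \<open>js\<close> contribute to the
  contraction, and this is their weight.\<close>
definition sgnl :: "'n option list \<Rightarrow> complex" where
  "sgnl is = (\<Prod>i\<leftarrow>is. metric i i)"

definition shl :: "'i list \<Rightarrow> 'i arr \<Rightarrow> 'i arr" where
  "shl is c K L = c (addl K is) L"

definition shr :: "'i list \<Rightarrow> 'i arr \<Rightarrow> 'i arr" where
  "shr is c K L = c K (addl L is)"

text \<open>The term with \<open>r\<close> contractions shifts the left factor by an index word in the variable \<open>z\<close>, the right
  factor by the same word in the conjugate variable, and multiplies. For arrays supported on pairs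
  of equal degree, contractions of order above the degree of the entry contribute 0, so that the
  finite sum is the full one.\<close>
definition star :: "'n::finite option arr \<Rightarrow> 'n option arr \<Rightarrow> 'n option arr" where
  "star c d K L = (\<Sum>r\<le>mdeg L. 1 / fact r *
     (\<Sum>is | length is = r. sgnl is * bconv (shl is c) (shr is d) K L))"

lemma norm_sgnl: "norm (sgnl is) = 1"
  by (induction "is") (auto simp: sgnl_def metric_def norm_mult)

lemma norm_dpow_le:
  assumes "\<And>i. norm (z $ i) \<le> R"
  shows "norm (dpow z K) \<le> (facbase TYPE('i) * R) ^ mdeg (K :: 'i::finite \<Rightarrow> nat) / fact (mdeg K)"
proof -
  have R: "R \<ge> 0" using assms[of undefined] norm_ge_zero order_trans by blast
  have "norm (dpow z K) = (\<Prod>i\<in>UNIV. norm (z $ i) ^ K i / fact (K i))"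
    by (simp add: dpow_def prod_norm[symmetric] norm_divide norm_power)
  also have "\<dots> \<le> (\<Prod>i\<in>UNIV. R ^ K i / fact (K i))"
    using assms by (intro prod_mono) (auto intro!: divide_right_mono power_mono)
  also have "\<dots> = R ^ mdeg K / mfact K"
    by (simp add: prod_dividef mdeg_def mfact_def power_sum)
  also have "\<dots> \<le> (facbase TYPE('i) * R) ^ mdeg K / fact (mdeg K)"
  proof -
    have "R ^ mdeg K * fact (mdeg K) \<le> R ^ mdeg K * (facbase TYPE('i) ^ mdeg K * real (mfact K))"
      using R by (intro mult_left_mono fact_mdeg_le_mfact) auto
    moreover have "mfact K > 0" by (simp add: mfact_def prod_pos)
    ultimately show ?thesis by (simp add: field_simps power_mult_distrib)
  qed
  finally show ?thesis .
qed

lemma bnd_nonneg: "bnd e B a \<Longrightarrow> B \<ge> 0"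
proof -
  assume "bnd e B a"
  then have "norm (a (\<lambda>_. 0) (\<lambda>_. 0)) \<le> B * fact (mdeg (\<lambda>_::'a. 0)) powr e"
    unfolding bnd_def by blast
  then have "norm (a (\<lambda>_. 0) (\<lambda>_. 0)) \<le> B" by (simp add: mdeg_def)
  then show "B \<ge> 0" using norm_ge_zero order_trans by blast
qed

text \<open>The factorials come from the two divided powers, the fourth power of the base from two
  applications of \<open>norm_dpow_le\<close> and from counting the two multi-indices.\<close>
lemma norm_hpart_le:
  fixes a :: "'i::finite arr"
  assumes "bnd e B a" "\<And>i. norm (z $ i) \<le> R" "\<And>i. norm (\<zeta> $ i) \<le> R'"
  shows "norm (hpart g a z \<zeta>) \<le> B * (facbase TYPE('i) ^ 4 * R * R') ^ g * fact g powr e / (fact g)\<^sup>2"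
proof -
  let ?Q = "facbase TYPE('i)"
  have R: "R \<ge> 0" "R' \<ge> 0" using assms(2,3)[of undefined] norm_ge_zero order_trans by blast+
  have Q: "?Q \<ge> 0" using facbase_ge_1[where ?'i='i] by simp
  have B: "B \<ge> 0" using assms(1) bnd_nonneg by auto
  define T where "T = B * fact g powr e * ((?Q * R) ^ g / fact g) * ((?Q * R') ^ g / fact g)"
  have T: "T \<ge> 0" using B R Q by (auto simp: T_def)
  have "norm (a K L * dpow z K * dpow \<zeta> L) \<le> T" if "K \<in> graded g" "L \<in> graded g" for K L
    unfolding T_def norm_mult
    using that assms(1) norm_dpow_le[of z R K, OF assms(2)] norm_dpow_le[of \<zeta> R' L, OF assms(3)] B R Q
    by (intro mult_mono) (auto simp: bnd_def graded_def)
  then have "norm (hpart g a z \<zeta>) \<le> (\<Sum>K\<in>(graded g :: ('i \<Rightarrow> nat) set). \<Sum>L\<in>(graded g :: ('i \<Rightarrow> nat) set). T)"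
    unfolding hpart_def by (intro sum_norm_le) 
  also have "\<dots> = real (card (graded g :: ('i \<Rightarrow> nat) set)) * (real (card (graded g :: ('i \<Rightarrow> nat) set)) * T)"
    by simp
  also have "\<dots> \<le> ?Q ^ g * (?Q ^ g * T)"
    using T Q by (intro mult_mono card_graded_le mult_right_mono) auto
  also have "\<dots> = B * (?Q ^ 4 * R * R') ^ g * fact g powr e / (fact g)\<^sup>2"
    by (simp add: T_def power_mult_distrib power2_eq_square power4_eq_xxxx) 
  finally show ?thesis .
qed

lemma bnd_mono: "bnd e B a \<Longrightarrow> B \<le> B' \<Longrightarrow> bnd e B' a"
  unfolding bnd_def by (meson mult_right_mono order_trans powr_ge_zero)

lemma bnd_add: "bnd e A a \<Longrightarrow> bnd e B b \<Longrightarrow> bnd e (A + B) (\<lambda>K L. a K L + b K L)"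
  unfolding bnd_def by (auto simp: distrib_right intro!: norm_triangle_mono)

lemma bnd_diff: "bnd e A a \<Longrightarrow> bnd e B b \<Longrightarrow> bnd e (A + B) (\<lambda>K L. a K L - b K L)"
  unfolding bnd_def by (auto simp: distrib_right intro!: order_trans[OF norm_triangle_ineq4] add_mono)

text \<open>Degree bookkeeping for the terms of the product that can be nonzero.\<close>
lemma eqdeg_term_zero:
  assumes "eqdeg c" "eqdeg d" "R \<in> below K" "Q \<in> below L"
    and nz: "c (addl (K - R) is) Q * d R (addl (L - Q) is) \<noteq> 0"
  shows "mdeg Q + mdeg R = mdeg K + length is" "mdeg K = mdeg L"
    "mdeg Q = mdeg (addl (K - R) is)"
proof -
  have "mdeg (addl (K - R) is) = mdeg Q" "mdeg R = mdeg (addl (L - Q) is)"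
    using nz assms(1,2) unfolding eqdeg_def by (metis mult_eq_0_iff)+
  moreover have "mdeg (\<lambda>i. K i - R i) = mdeg K - mdeg R" "mdeg (\<lambda>i. L i - Q i) = mdeg L - mdeg Q"
    using assms mdeg_diff by (auto simp: fun_diff_def)
  ultimately show "mdeg Q + mdeg R = mdeg K + length is" "mdeg K = mdeg L" 
    "mdeg Q = mdeg (addl (K - R) is)"
    using mdeg_mono[OF assms(3)] mdeg_mono[OF assms(4)] by auto
qed

lemma bconv_shift_eq_0:
  assumes "eqdeg c" "eqdeg d" "mdeg K \<noteq> mdeg L \<or> length is > mdeg L"
  shows "bconv (shl is c) (shr is d) K L = 0"
  unfolding bconv_def
proof (intro sum.neutral ballI)
  fix R Q assume RQ: "R \<in> below K" "Q \<in> below L"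
  have "c (addl (K - R) is) Q * d R (addl (L - Q) is) = 0"
  proof (rule ccontr)
    assume "\<not> ?thesis"
    note * = eqdeg_term_zero[OF assms(1,2) RQ this]
    show False using * assms(3) mdeg_mono[OF RQ(1)] mdeg_mono[OF RQ(2)] by auto
  qed
  then show "of_nat (mbinom K R) * of_nat (mbinom L Q) * (shl is c (K - R) Q * shr is d R (L - Q)) = 0"
    by (simp add: shl_def shr_def)
qed

lemma star_eqdeg: "eqdeg c \<Longrightarrow> eqdeg d \<Longrightarrow> eqdeg (star c d)"
  unfolding eqdeg_def[of "star c d"] star_def using bconv_shift_eq_0 by force

lemma star_eq_sum_upto:
  assumes "eqdeg c" "eqdeg d" "mdeg L \<le> M"
  shows "star c d K L = (\<Sum>r\<le>M. 1 / fact r *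
     (\<Sum>is | length is = r. sgnl is * bconv (shl is c) (shr is d) K L))"
  unfolding star_def
proof (rule sum.mono_neutral_left)
  show "\<forall>r\<in>{..M} - {..mdeg L}. 1 / fact r *
     (\<Sum>is | length is = r. sgnl is * bconv (shl is c) (shr is d) K L) = 0"
    using bconv_shift_eq_0[OF assms(1,2)] by auto
qed (use assms in auto)

text \<open>The orders \<open>\<alpha>\<close> and \<open>\<beta>\<close> of the two coefficients that meet in an entry of order \<open>g\<close> of the
  product, with \<open>r\<close> contractions, satisfy \<open>\<alpha> + \<beta> = g + r\<close> and \<open>\<alpha>, \<beta> \<le> g\<close>; hence
  \<open>\<alpha>! \<beta>! \<le> g! r!\<close>, and the factor \<open>1 / r!\<close> of the contraction absorbs \<open>r!\<close>.\<close>
lemma norm_bconv_shift_le: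
  assumes "eqdeg c" "eqdeg d" "bnd e A c" "bnd e B d" "0 < e" "e < 1"
  shows "norm (bconv (shl is c) (shr is d) K L) \<le>
    A * B * fact (mdeg L) powr e * fact (length is) * (2 ^ mdeg K * 2 ^ mdeg L)"
proof -
  have AB: "A \<ge> 0" "B \<ge> 0" using assms bnd_nonneg by auto
  define T where "T = A * B * fact (mdeg L) powr e * fact (length is)"
  have T: "T \<ge> 0" using AB by (simp add: T_def)
  have bound: "norm (c (addl (K - R) is) Q * d R (addl (L - Q) is)) \<le> T" 
    if RQ: "R \<in> below K" "Q \<in> below L" for R Q
  proof (cases "c (addl (K - R) is) Q * d R (addl (L - Q) is) = 0")
    case False
    note * = eqdeg_term_zero[OF assms(1,2) RQ False]
    have "norm (c (addl (K - R) is) Q * d R (addl (L - Q) is))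
        \<le> (A * fact (mdeg Q) powr e) * (B * fact (mdeg R) powr e)"
      unfolding norm_mult using AB assms(3,4) *(3)
      by (intro mult_mono) (auto simp: bnd_def, metis mdeg_addl)
    also have "\<dots> = A * B * (fact (mdeg Q) * fact (mdeg R)) powr e"
      by (simp add: powr_mult)
    also have "\<dots> \<le> A * B * (fact (mdeg L) * fact (length is)) powr e"
      using AB assms(5) * mdeg_mono[OF RQ(1)] mdeg_mono[OF RQ(2)]
      by (intro mult_left_mono powr_mono2 fact_mult_fact_le) auto
    also have "\<dots> = A * B * fact (mdeg L) powr e * fact (length is) powr e"
      by (simp add: powr_mult)
    also have "\<dots> \<le> A * B * fact (mdeg L) powr e * fact (length is) powr 1"
      using AB assms(6) by (intro mult_left_mono powr_mono) (auto simp: fact_ge_1)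
    finally show ?thesis by (simp add: T_def)
  qed (use T in auto)
  have "norm (bconv (shl is c) (shr is d) K L) \<le>
     (\<Sum>R\<in>below K. \<Sum>Q\<in>below L. real (mbinom K R) * real (mbinom L Q) * T)"
    unfolding bconv_def shl_def shr_def
    by (intro sum_norm_le) (use bound in \<open>auto simp: norm_mult intro!: mult_left_mono\<close>)
  also have "\<dots> = T * ((\<Sum>R\<in>below K. real (mbinom K R)) * (\<Sum>Q\<in>below L. real (mbinom L Q)))"
    unfolding sum_product by (simp add: sum_distrib_left mult_ac)
  also have "\<dots> = T * (2 ^ mdeg K * 2 ^ mdeg L)" by (simp only: sum_mbinom)
  finally show ?thesis by (simp add: T_def)
qed

lemma norm_star_le:
  fixes c d :: "'n::finite option arr"
  assumes "eqdeg c" "eqdeg d" "bnd e A c" "bnd e B d" "0 < e" "e < 1" 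
  shows "norm (star c d K L) \<le> A * B * (8 * CARD('n option)) ^ mdeg K * fact (mdeg K) powr e"
proof (cases "mdeg K = mdeg L")
  case True
  let ?g = "mdeg K" and ?N = "CARD('n option)"
  have AB: "A \<ge> 0" "B \<ge> 0" using assms bnd_nonneg by auto
  have g: "mdeg L = ?g" using True by simp
  define T where "T = A * B * fact ?g powr e * 4 ^ ?g"
  have T: "T \<ge> 0" using AB by (simp add: T_def)
  have "norm (1 / fact r * (\<Sum>is | length is = r. sgnl is * bconv (shl is c) (shr is d) K L))
      \<le> real ?N ^ ?g * T" if "r \<le> ?g" for r
  proof -
    have "norm (\<Sum>is | length is = r. sgnl is * bconv (shl is c) (shr is d) K L) 
       \<le> (\<Sum>is :: 'n option list | length is = r. T * fact r)"
    proof (rule sum_norm_le)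
      fix "is" :: "'n option list" assume "is \<in> {is. length is = r}"
      then show "norm (sgnl is * bconv (shl is c) (shr is d) K L) \<le> T * fact r"
        using norm_bconv_shift_le[OF assms, of "is" K L] g
        by (simp add: norm_mult norm_sgnl T_def power_mult_distrib[symmetric] mult_ac)
    qed
    also have "\<dots> = real ?N ^ r * (T * fact r)" 
      by (simp only: sum_constant card_lists_length of_nat_power)
    finally have "norm (1 / fact r * (\<Sum>is | length is = r. sgnl is * bconv (shl is c) (shr is d) K L))
      \<le> real ?N ^ r * T"
      by (simp add: norm_mult norm_divide field_simps)
    also have "\<dots> \<le> real ?N ^ ?g * T"
      using that T by (intro mult_right_mono power_increasing) (auto simp: card_option)
    finally show ?thesis .
  qed
  then have "norm (star c d K L) \<le> (\<Sum>r\<le>?g. real ?N ^ ?g * T)"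
    unfolding star_def g by (intro sum_norm_le) auto
  also have "\<dots> = real (Suc ?g) * (real ?N ^ ?g * T)" by simp
  also have "\<dots> \<le> 2 ^ ?g * (real ?N ^ ?g * T)"
    using T by (intro mult_right_mono) (auto, metis Suc_leI less_exp numeral_power_eq_of_nat_cancel_iff of_nat_Suc of_nat_le_iff)
  also have "\<dots> = A * B * (8 * ?N) ^ ?g * fact ?g powr e"
  proof -
    have "(8::real) ^ ?g = 2 ^ ?g * 4 ^ ?g" by (simp flip: power_mult_distrib)
    then show ?thesis by (simp only: T_def power_mult_distrib mult_ac of_nat_mult of_nat_power of_nat_numeral)
  qed
  finally show ?thesis by simp
next
  case False
  have "A \<ge> 0" "B \<ge> 0" using assms bnd_nonneg by auto
  with False show ?thesis using star_eqdeg[OF assms(1,2)] by (auto simp: eqdeg_def)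
qed

text \<open>Half of the exponent \<open>e\<close> serves the bounds of the factors; the other half absorbs the geometric
  factor of \<open>norm_star_le\<close>.\<close>
lemma star_bnd:
  assumes "0 < e" "e < 1"
  shows "\<exists>M\<ge>0. \<forall>(c :: 'n::finite option arr) d A B. eqdeg c \<longrightarrow> eqdeg d \<longrightarrow> bnd (e/2) A c \<longrightarrow> bnd (e/2) B d \<longrightarrow>
     bnd e (M * A * B) (star c d)"
proof -
  obtain M where M: "M > 0" "\<And>g. (8 * real CARD('n option)) ^ g \<le> M * fact g powr (e/2)"
    using power_le_fact_powr[of "e/2" "8 * real CARD('n option)"] assms by auto
  have "bnd e (M * A * B) (star c d)" if "eqdeg c" "eqdeg d" "bnd (e/2) A c" "bnd (e/2) B d" 
    for c d :: "'n option arr" and A B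
    unfolding bnd_def
  proof (intro allI)
    fix K L
    have AB: "A \<ge> 0" "B \<ge> 0" using that bnd_nonneg by auto
    have "norm (star c d K L) \<le> A * B * (8 * real CARD('n option)) ^ mdeg K * fact (mdeg K) powr (e/2)"
      using norm_star_le[OF that, of K L] assms by simp
    also have "\<dots> \<le> A * B * (M * fact (mdeg K) powr (e/2)) * fact (mdeg K) powr (e/2)"
      using AB M by (intro mult_left_mono mult_right_mono) auto
    also have "\<dots> = M * A * B * fact (mdeg K) powr e"
      by (simp add: powr_add[symmetric])
    finally show "norm (star c d K L) \<le> M * A * B * fact (mdeg K) powr e" .
  qed
  with M(1) show ?thesis by (intro exI[of _ M]) auto
qed

lemma hatD: "a \<in> hat \<Longrightarrow> eqdeg a" "a \<in> hat \<Longrightarrow> 0 < e \<Longrightarrow> e < 1 \<Longrightarrow> \<exists>B. bnd e B a"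
  by (auto simp: hat_def)

lemma hat_add: "a \<in> hat \<Longrightarrow> b \<in> hat \<Longrightarrow> (\<lambda>K L. a K L + b K L) \<in> hat"
  unfolding hat_def by (simp add: eqdeg_def) (use bnd_add in blast)

lemma hat_diff: "a \<in> hat \<Longrightarrow> b \<in> hat \<Longrightarrow> (\<lambda>K L. a K L - b K L) \<in> hat"
  unfolding hat_def by (simp add: eqdeg_def) (use bnd_diff in blast)

lemma star_hat:
  assumes "c \<in> hat" "d \<in> hat"
  shows "star c d \<in> hat"
proof -
  have "\<exists>B. bnd e B (star c d)" if e: "0 < e" "e < 1" for e
  proof -
    obtain A where "bnd (e/2) A c" using hatD(2)[OF assms(1), of "e/2"] e by auto
    moreover obtain B where "bnd (e/2) B d" using hatD(2)[OF assms(2), of "e/2"] e by auto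
    ultimately show ?thesis using star_bnd[OF e] hatD(1) assms by metis
  qed
  then show ?thesis using star_eqdeg hatD(1) assms by (auto simp: hat_def)
qed

lemma shl_lin: "shl is (\<lambda>K L. a K L + x * b K L) = (\<lambda>K L. shl is a K L + x * shl is b K L)"
  by (simp add: shl_def fun_eq_iff)

lemma shr_lin: "shr is (\<lambda>K L. a K L + x * b K L) = (\<lambda>K L. shr is a K L + x * shr is b K L)"
  by (simp add: shr_def fun_eq_iff)

lemma bconv_lin_left:
  "bconv (\<lambda>K L. a K L + x * b K L) d K L = bconv a d K L + x * bconv b d K L"
  by (simp add: bconv_def sum_distrib_left algebra_simps flip: sum.distrib)

lemma bconv_lin_right:
  "bconv d (\<lambda>K L. a K L + x * b K L) K L = bconv d a K L + x * bconv d b K L"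
  by (simp add: bconv_def sum_distrib_left algebra_simps flip: sum.distrib)

lemma star_lin_left:
  "star (\<lambda>K L. a K L + x * b K L) d K L = star a d K L + x * star b d K L"
  by (simp add: star_def shl_lin bconv_lin_left sum_distrib_left sum_distrib_right algebra_simps flip: sum.distrib)

lemma star_lin_right:
  "star d (\<lambda>K L. a K L + x * b K L) K L = star d a K L + x * star d b K L"
  by (simp add: star_def shr_lin bconv_lin_right sum_distrib_left sum_distrib_right algebra_simps flip: sum.distrib)

lemma star_diff_left: "star (\<lambda>K L. a K L - b K L) d K L = star a d K L - star b d K L"
  using star_lin_left[of a "-1" b d K L] by simp

lemma star_diff_right: "star d (\<lambda>K L. a K L - b K L) K L = star d a K L - star d b K L"
  using star_lin_right[of d a "-1" b K L] by simp

lemma star_zero_left: "star (\<lambda>K L. 0) d K L = 0"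
  using star_diff_left[of d d d K L] by simp

lemma star_zero_right: "star d (\<lambda>K L. 0) K L = 0"
  using star_diff_right[of d d d K L] by simp

lemma star_sum_left: "finite S \<Longrightarrow> star (\<lambda>K L. \<Sum>j\<in>S. a j K L) d K L = (\<Sum>j\<in>S. star (a j) d K L)"
proof (induction S rule: finite_induct)
  case (insert j S)
  then show ?case using star_lin_left[of "a j" 1 "\<lambda>K L. \<Sum>j\<in>S. a j K L" d K L] by simp
qed (simp add: star_zero_left)

lemma star_sum_right: "finite S \<Longrightarrow> star d (\<lambda>K L. \<Sum>j\<in>S. a j K L) K L = (\<Sum>j\<in>S. star d (a j) K L)"
proof (induction S rule: finite_induct)
  case (insert j S)
  then show ?case using star_lin_right[of d "a j" 1 "\<lambda>K L. \<Sum>j\<in>S. a j K L" K L] by simp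
qed (simp add: star_zero_right)

text \<open>Bilinearity writes the difference of products as a sum of two products with one small factor; the
  constant \<open>\<eta>\<close> is chosen so that their bounds add up to at most \<open>\<delta>\<close>.\<close>
lemma aconv_star:
  fixes c d :: "'n::finite option arr"
  assumes c: "c \<in> hat" "\<And>k. X k \<in> hat" "aconv X c" and d: "d \<in> hat" "\<And>k. Y k \<in> hat" "aconv Y d"
  shows "aconv (\<lambda>k. star (X k) (Y k)) (star c d)"
  unfolding aconv_def
proof (intro allI impI)
  fix e \<delta> :: real assume e: "0 < e \<and> e < 1" and \<delta>: "\<delta> > 0"
  obtain M where M: "M \<ge> 0" and st: "\<And>(c :: 'n option arr) d A B. eqdeg c \<Longrightarrow> eqdeg d \<Longrightarrow>
     bnd (e/2) A c \<Longrightarrow> bnd (e/2) B d \<Longrightarrow> bnd e (M * A * B) (star c d)"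
    using star_bnd[of e] e by metis
  obtain A where A: "bnd (e/2) A c" using hatD(2)[OF c(1), of "e/2"] e by auto
  obtain B where B: "bnd (e/2) B d" using hatD(2)[OF d(1), of "e/2"] e by auto
  have AB: "A \<ge> 0" "B \<ge> 0" using A B bnd_nonneg by auto
  define \<eta> where "\<eta> = min 1 (\<delta> / ((M + 1) * (A + B + 1)))"
  have \<eta>: "\<eta> > 0" "\<eta> \<le> 1" using M AB \<delta> by (auto simp: \<eta>_def)
  have le: "M * \<eta> * (B + 1) + M * A * \<eta> \<le> \<delta>"
  proof -
    have "\<eta> * ((M + 1) * (A + B + 1)) \<le> \<delta>"
    proof -
      have "\<eta> \<le> \<delta> / ((M + 1) * (A + B + 1))" by (simp add: \<eta>_def)
      moreover have "(M + 1) * (A + B + 1) > 0" using M AB by (intro mult_pos_pos) auto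
      ultimately show ?thesis by (simp add: pos_le_divide_eq)
    qed
    moreover have "M * \<eta> * (B + 1) + M * A * \<eta> = \<eta> * (M * (A + B + 1))" by (simp add: algebra_simps)
    moreover have "\<eta> * (M * (A + B + 1)) \<le> \<eta> * ((M + 1) * (A + B + 1))"
      using \<eta> M AB by (intro mult_left_mono mult_right_mono) auto
    ultimately show ?thesis by linarith
  qed
  have "\<forall>\<^sub>F k in sequentially. bnd (e/2) \<eta> (\<lambda>K L. X k K L - c K L)"
    "\<forall>\<^sub>F k in sequentially. bnd (e/2) \<eta> (\<lambda>K L. Y k K L - d K L)"
    using c(3) d(3) e \<eta> by (auto simp: aconv_def)
  then show "\<forall>\<^sub>F k in sequentially. bnd e \<delta> (\<lambda>K L. star (X k) (Y k) K L - star c d K L)"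
  proof eventually_elim
    case (elim k)
    have "bnd (e/2) (\<eta> + B) (\<lambda>K L. (Y k K L - d K L) + d K L)" by (rule bnd_add[OF elim(2) B])
    then have Y: "bnd (e/2) (B + 1) (Y k)" using \<eta> by (auto intro: bnd_mono)
    have eq: "eqdeg (\<lambda>K L. X k K L - c K L)" "eqdeg (\<lambda>K L. Y k K L - d K L)" "eqdeg c" "eqdeg (Y k)"
      using hat_diff c d hatD(1) by blast+
    have 1: "bnd e (M * \<eta> * (B + 1)) (star (\<lambda>K L. X k K L - c K L) (Y k))"
      by (rule st[OF eq(1,4) elim(1) Y])
    have 2: "bnd e (M * A * \<eta>) (star c (\<lambda>K L. Y k K L - d K L))"
      by (rule st[OF eq(3,2) A elim(2)])
    show ?case
      using bnd_mono[OF bnd_add[OF 1 2] le] by (simp add: star_diff_left star_diff_right)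
  qed
qed

section \<open>Polynomials and their Wirtinger derivatives\<close>

definition cnjv :: "complex ^ 'i::finite \<Rightarrow> complex ^ 'i" where
  "cnjv z = (\<chi> i. cnj (z $ i))"

definition supp_box :: "nat \<Rightarrow> 'i::finite arr \<Rightarrow> bool" where
  "supp_box N c \<longleftrightarrow> (\<forall>K L. mdeg K > N \<or> mdeg L > N \<longrightarrow> c K L = 0)"

text \<open>Finite arrays are those supported in a box of degree \<open>N\<close>. Summing over the box, instead of over the
  support, makes the value linear in the array.\<close>
definition poly_of :: "nat \<Rightarrow> 'i::finite arr \<Rightarrow> complex ^ 'i \<Rightarrow> complex" where
  "poly_of N c z = (\<Sum>K\<in>degbox N. \<Sum>L\<in>degbox N. c K L * dpow z K * dpow (cnjv z) L)"

text \<open>The partial derivative of a divided power in direction \<open>i\<close>.\<close>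
definition dpow' :: "complex ^ 'i::finite \<Rightarrow> ('i \<Rightarrow> nat) \<Rightarrow> 'i \<Rightarrow> complex" where
  "dpow' z K i = (if K i = 0 then 0 else dpow z (K(i := K i - 1)))"

lemma dpow_cnjv: "dpow (cnjv z) L = cnj (dpow z L)"
  by (simp add: dpow_def cnjv_def)

lemma dpow_split: "dpow z K = (z $ i) ^ K i / fact (K i) * (\<Prod>j\<in>UNIV - {i}. (z $ j) ^ K j / fact (K j))"
  unfolding dpow_def by (subst prod.remove[of UNIV i]) auto

lemma dpow'_eq:
  "dpow' z K i = of_nat (K i) * (z $ i) ^ (K i - 1) / fact (K i) * (\<Prod>j\<in>UNIV - {i}. (z $ j) ^ K j / fact (K j))"
proof (cases "K i")
  case (Suc k)
  have "dpow' z K i = (z $ i) ^ k / fact k * (\<Prod>j\<in>UNIV - {i}. (z $ j) ^ (K(i := k)) j / fact ((K(i := k)) j))"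
    using Suc by (simp add: dpow'_def dpow_split[of z "K(i := k)" i])
  also have "(\<Prod>j\<in>UNIV - {i}. (z $ j) ^ (K(i := k)) j / fact ((K(i := k)) j)) = (\<Prod>j\<in>UNIV - {i}. (z $ j) ^ K j / fact (K j))"
    by (rule prod.cong) auto
  finally show ?thesis using Suc by (simp add: field_simps del: of_nat_Suc)
qed (simp add: dpow'_def)

lemma has_derivative_dpow:
  "((\<lambda>z. dpow z K) has_derivative (\<lambda>v. \<Sum>i\<in>UNIV. v $ i * dpow' z K i)) (at z)"
proof -
  have "((\<lambda>z. z $ i ^ K i / fact (K i)) has_derivative
     (\<lambda>v. v $ i * (of_nat (K i) * (z $ i) ^ (K i - 1) / fact (K i)))) (at z)" for i
    by (auto intro!: derivative_eq_intros bounded_linear_imp_has_derivative[OF bounded_linear_vec_nth] simp: fun_eq_iff)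
  from has_derivative_prod[where I = UNIV, OF this]
  show ?thesis unfolding dpow_def dpow'_eq by (simp add: mult_ac)
qed

text \<open>Reindexing turns the derivative of the monomials into a shift of the coefficients.\<close>
lemma sum_dpow'_shift:
  assumes "\<And>K. mdeg K > N \<Longrightarrow> c K = 0"
  shows "(\<Sum>K\<in>degbox N. c K * dpow' z K i) = (\<Sum>K\<in>degbox N. c (inc K i) * dpow z K)"
proof -
  have "(\<Sum>K\<in>degbox N. c K * dpow' z K i) = (\<Sum>K\<in>{K\<in>degbox N. K i \<noteq> 0}. c K * dpow' z K i)"
    by (rule sum.mono_neutral_right) (auto simp: dpow'_def)
  also have "\<dots> = (\<Sum>K\<in>{K. inc K i \<in> degbox N}. c (inc K i) * dpow z K)"
  proof (rule sum.reindex_bij_witness[of _ "\<lambda>K. inc K i" "\<lambda>K. K(i := K i - 1)"])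
    fix K assume "K \<in> {K \<in> degbox N. K i \<noteq> 0}"
    then have "inc (K(i := K i - 1)) i = K" by auto
    with \<open>K \<in> _\<close> show "inc (K(i := K i - 1)) i = K" "K(i := K i - 1) \<in> {K. inc K i \<in> degbox N}"
      "c (inc (K(i := K i - 1)) i) * dpow z (K(i := K i - 1)) = c K * dpow' z K i"
      by (auto simp: dpow'_def)
  qed auto
  also have "\<dots> = (\<Sum>K\<in>degbox N. c (inc K i) * dpow z K)"
  proof (rule sum.mono_neutral_left)
    show "{K. inc K i \<in> degbox N} \<subseteq> degbox N" by (auto simp: degbox_def)
    show "\<forall>K\<in>degbox N - {K. inc K i \<in> degbox N}. c (inc K i) * dpow z K = 0"
      using assms by (auto simp: degbox_def)
  qed simp
  finally show ?thesis .
qed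

text \<open>A real-linear map splits uniquely into a complex-linear and an antilinear part, and the two Wirtinger
  derivatives read off the respective coefficients.\<close>
lemma wirtinger:
  assumes "(f has_derivative (\<lambda>v. \<Sum>i\<in>UNIV. v $ i * a i + cnj (v $ i) * b i)) (at z)"
  shows "d_z i f z = a i" "d_zbar i f z = b i"
proof -
  have fd: "frechet_derivative f (at z) = (\<lambda>v. \<Sum>i\<in>UNIV. v $ i * a i + cnj (v $ i) * b i)"
    using frechet_derivative_at[OF assms] by simp
  have ax: "frechet_derivative f (at z) (axis i x) = x * a i + cnj x * b i" for x
  proof -
    have "frechet_derivative f (at z) (axis i x) = (\<Sum>j\<in>UNIV. if j = i then x * a i + cnj x * b i else 0)"
      unfolding fd by (rule sum.cong) (auto simp: axis_def)
    then show ?thesis by simp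
  qed
  show "d_z i f z = a i" "d_zbar i f z = b i"
    unfolding d_z_def d_zbar_def ax by (simp_all add: algebra_simps)
qed

lemma has_derivative_poly_of:
  "(poly_of N c has_derivative (\<lambda>v. \<Sum>i\<in>UNIV.
      v $ i * (\<Sum>L\<in>degbox N. (\<Sum>K\<in>degbox N. c K L * dpow' z K i) * dpow (cnjv z) L) +
      cnj (v $ i) * (\<Sum>K\<in>degbox N. (\<Sum>L\<in>degbox N. c K L * dpow' (cnjv z) L i) * dpow z K))) (at z)"
proof -
  let ?B = "degbox N" and ?w = "cnjv z"
  have 1: "((\<lambda>z. dpow (cnjv z) L) has_derivative (\<lambda>v. \<Sum>i\<in>UNIV. cnj (v $ i) * dpow' ?w L i)) (at z)" for L
  proof -
    have "((\<lambda>z. cnj (dpow z L)) has_derivative (\<lambda>v. cnj (\<Sum>i\<in>UNIV. v $ i * dpow' z L i))) (at z)"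
      by (rule bounded_linear.has_derivative[OF bounded_linear_cnj has_derivative_dpow])
    moreover have "cnj (dpow' z L i) = dpow' ?w L i" for i
      by (simp add: dpow'_def dpow_cnjv)
    ultimately show ?thesis by (simp add: dpow_cnjv)
  qed
  have "(poly_of N c has_derivative (\<lambda>v. \<Sum>K\<in>?B. \<Sum>L\<in>?B.
      (c K L * dpow z K) * (\<Sum>i\<in>UNIV. cnj (v $ i) * dpow' ?w L i) +
      (c K L * (\<Sum>i\<in>UNIV. v $ i * dpow' z K i)) * dpow ?w L)) (at z)"
    unfolding poly_of_def[abs_def]
    by (intro has_derivative_sum has_derivative_mult has_derivative_mult_right has_derivative_dpow 1)
  moreover have "(\<Sum>K\<in>?B. \<Sum>L\<in>?B. (c K L * dpow z K) * (\<Sum>i\<in>UNIV. cnj (v $ i) * dpow' ?w L i)) =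
      (\<Sum>i\<in>UNIV. cnj (v $ i) * (\<Sum>K\<in>?B. (\<Sum>L\<in>?B. c K L * dpow' ?w L i) * dpow z K))" for v
    unfolding sum_distrib_left sum_distrib_right by (subst sum_rotate) (simp only: mult_ac)
  moreover have "(\<Sum>K\<in>?B. \<Sum>L\<in>?B. (c K L * (\<Sum>i\<in>UNIV. v $ i * dpow' z K i)) * dpow ?w L) =
      (\<Sum>i\<in>UNIV. v $ i * (\<Sum>L\<in>?B. (\<Sum>K\<in>?B. c K L * dpow' z K i) * dpow ?w L))" for v
    unfolding sum_distrib_left sum_distrib_right
    by (subst sum.swap, subst sum_rotate) (simp only: mult_ac)
  ultimately show ?thesis by (simp add: sum.distrib add.commute)
qed

lemma d_z_poly_of:
  assumes "supp_box N c"
  shows "d_z i (poly_of N c) z = poly_of N (\<lambda>K L. c (inc K i) L) z"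
proof -
  have "d_z i (poly_of N c) z = (\<Sum>L\<in>degbox N. (\<Sum>K\<in>degbox N. c K L * dpow' z K i) * dpow (cnjv z) L)"
    by (rule wirtinger(1)[OF has_derivative_poly_of])
  also have "\<dots> = (\<Sum>L\<in>degbox N. (\<Sum>K\<in>degbox N. c (inc K i) L * dpow z K) * dpow (cnjv z) L)"
    using assms by (intro sum.cong refl arg_cong2[where f = "(*)"] sum_dpow'_shift) (auto simp: supp_box_def)
  also have "\<dots> = poly_of N (\<lambda>K L. c (inc K i) L) z"
    unfolding poly_of_def by (subst sum.swap) (simp add: sum_distrib_right)
  finally show ?thesis .
qed

lemma d_zbar_poly_of:
  assumes "supp_box N c"
  shows "d_zbar i (poly_of N c) z = poly_of N (\<lambda>K L. c K (inc L i)) z"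
proof -
  have "d_zbar i (poly_of N c) z = (\<Sum>K\<in>degbox N. (\<Sum>L\<in>degbox N. c K L * dpow' (cnjv z) L i) * dpow z K)"
    by (rule wirtinger(2)[OF has_derivative_poly_of])
  also have "\<dots> = (\<Sum>K\<in>degbox N. (\<Sum>L\<in>degbox N. c K (inc L i) * dpow (cnjv z) L) * dpow z K)"
    using assms by (intro sum.cong refl arg_cong2[where f = "(*)"] sum_dpow'_shift) (auto simp: supp_box_def)
  also have "\<dots> = poly_of N (\<lambda>K L. c K (inc L i)) z"
    unfolding poly_of_def by (simp add: sum_distrib_left sum_distrib_right mult_ac)
  finally show ?thesis .
qed

lemma supp_box_shl: "supp_box N c \<Longrightarrow> supp_box N (shl is c)"
  by (simp add: supp_box_def shl_def)

lemma supp_box_shr: "supp_box N c \<Longrightarrow> supp_box N (shr is c)"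
  by (simp add: supp_box_def shr_def)

lemma shl_Cons: "(\<lambda>K L. shl is c (inc K i) L) = shl (i # is) c"
  by (intro ext) (auto simp: shl_def fun_upd_def intro!: arg_cong[where f = "\<lambda>x. c x _"])

lemma shr_Cons: "(\<lambda>K L. shr is c K (inc L i)) = shr (i # is) c"
  by (intro ext) (auto simp: shr_def fun_upd_def intro!: arg_cong[where f = "\<lambda>x. c _ x"])

lemma foldr_d_z_poly_of: "supp_box N c \<Longrightarrow> foldr d_z is (poly_of N c) = poly_of N (shl is c)"
proof (induction "is")
  case (Cons i "is")
  then show ?case
    using d_z_poly_of[OF supp_box_shl[OF Cons.prems], of i "is"] by (auto simp: shl_Cons)
qed (simp add: shl_def fun_eq_iff poly_of_def)

lemma foldr_d_zbar_poly_of: "supp_box N c \<Longrightarrow> foldr d_zbar is (poly_of N c) = poly_of N (shr is c)"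
proof (induction "is")
  case (Cons i "is")
  then show ?case
    using d_zbar_poly_of[OF supp_box_shr[OF Cons.prems], of i "is"] by (auto simp: shr_Cons)
qed (simp add: shr_def fun_eq_iff poly_of_def)

lemma d_z_open_zero:
  assumes "open S" "z \<in> S" "\<And>x. x \<in> S \<Longrightarrow> f x = 0"
  shows "d_z i f z = 0" "d_zbar i f z = 0"
proof -
  have "(f has_derivative (\<lambda>v. 0)) (at z)"
    by (rule has_derivative_transform_within_open[OF has_derivative_const assms(1,2)]) (use assms in auto)
  then show "d_z i f z = 0" "d_zbar i f z = 0"
    using wirtinger[of f "\<lambda>_. 0" "\<lambda>_. 0" z i] by auto
qed

text \<open>A polynomial that vanishes on an open set has vanishing derivatives there; by induction
  on the degree these have zero coefficients, and only the constant term remains.\<close>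
lemma poly_of_eq_0_imp:
  fixes c :: "'n::finite option arr"
  assumes "open S" "z0 \<in> S"
  shows "(\<And>K L. mdeg K + mdeg L > n \<Longrightarrow> c K L = 0) \<Longrightarrow> n \<le> N \<Longrightarrow>
    (\<And>z. z \<in> S \<Longrightarrow> poly_of N c z = 0) \<Longrightarrow> c K L = (0 :: complex)"
proof (induction n arbitrary: c K L)
  case (0 c)
  have *: "c K L = 0" if "K \<noteq> (\<lambda>_. 0) \<or> L \<noteq> (\<lambda>_. 0)" for K L
    using that 0(1)[of K L] by (auto simp flip: mdeg_eq_0_iff)
  have "poly_of N c z0 = (\<Sum>K\<in>{\<lambda>_. 0}. \<Sum>L\<in>{\<lambda>_. 0}. c K L * dpow z0 K * dpow (cnjv z0) L)"
    unfolding poly_of_def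
    by (subst sum.mono_neutral_right[of "degbox N" "{\<lambda>_. 0}"];
        (subst sum.mono_neutral_right[of "degbox N" "{\<lambda>_. 0}"])?) (auto simp: * degbox_def)
  then have "c (\<lambda>_. 0) (\<lambda>_. 0) = 0" using 0(3)[OF assms(2)] by (simp add: dpow_def)
  with * show ?case by metis
next
  case (Suc n c)
  have supp: "supp_box N c" using Suc.prems(1,2) by (auto simp: supp_box_def)
  have 1: "c (inc K i) L = 0" for i K L
  proof (rule Suc.IH[of "\<lambda>K L. c (inc K i) L"])
    show "poly_of N (\<lambda>K L. c (inc K i) L) z = 0" if "z \<in> S" for z
      using d_z_open_zero(1)[of S z "poly_of N c" i] assms(1) that Suc.prems(3) by (simp add: d_z_poly_of[OF supp])
    show "c (inc K i) L = 0" if "n < mdeg K + mdeg L" for K L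
      by (rule Suc.prems(1)) (use that mdeg_inc[of K i] in linarith)
  qed (use Suc.prems in auto)
  have 2: "c K (inc L i) = 0" for i K L
  proof (rule Suc.IH[of "\<lambda>K L. c K (inc L i)"])
    show "poly_of N (\<lambda>K L. c K (inc L i)) z = 0" if "z \<in> S" for z
      using d_z_open_zero(2)[of S z "poly_of N c" i] assms(1) that Suc.prems(3) by (simp add: d_zbar_poly_of[OF supp])
    show "c K (inc L i) = 0" if "n < mdeg K + mdeg L" for K L
      by (rule Suc.prems(1)) (use that mdeg_inc[of L i] in linarith)
  qed (use Suc.prems in auto)
  have inc: "\<exists>K' i. K = inc K' i" if "K \<noteq> (\<lambda>_. 0)" for K :: "'n option \<Rightarrow> nat"
  proof -
    have "\<exists>i. K i \<noteq> 0" using that by (auto simp: fun_eq_iff)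
    then obtain i where "K i \<noteq> 0" ..
    then have "K = inc (K(i := K i - 1)) i" by auto
    then show ?thesis by blast
  qed
  have *: "c K L = 0" if "K \<noteq> (\<lambda>_. 0) \<or> L \<noteq> (\<lambda>_. 0)" for K L
    using that inc 1 2 by metis
  have "poly_of N c z0 = (\<Sum>K\<in>{\<lambda>_. 0}. \<Sum>L\<in>{\<lambda>_. 0}. c K L * dpow z0 K * dpow (cnjv z0) L)"
    unfolding poly_of_def
    by (subst sum.mono_neutral_right[of "degbox N" "{\<lambda>_. 0}"];
        (subst sum.mono_neutral_right[of "degbox N" "{\<lambda>_. 0}"])?) (auto simp: * degbox_def)
  then have "c (\<lambda>_. 0) (\<lambda>_. 0) = 0" using Suc.prems(3)[OF assms(2)] by (simp add: dpow_def)
  with * show ?case by metis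
qed

lemma dpow_mult_binom:
  assumes "R \<in> below K"
  shows "dpow z (K - R) * dpow z R = of_nat (mbinom K R) * dpow z K"
proof -
  have "z $ i ^ (K i - R i) / fact (K i - R i) * (z $ i ^ R i / fact (R i)) =
    of_nat (K i choose R i) * (z $ i ^ K i / fact (K i))" for i
  proof -
    have le: "R i \<le> K i" using assms by (simp add: below_def)
    then have "z $ i ^ K i = z $ i ^ (K i - R i) * z $ i ^ R i" by (simp flip: power_add)
    with le show ?thesis by (simp add: binomial_fact)
  qed
  then show ?thesis
    by (simp add: dpow_def mbinom_def prod.distrib[symmetric] of_nat_prod)
qed

lemma sum_box_product:
  assumes "\<And>K. mdeg K > N \<Longrightarrow> f K = (0::complex)" "\<And>K. mdeg K > N \<Longrightarrow> g K = 0" "2 * N \<le> M"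
  shows "(\<Sum>K\<in>degbox N. f K) * (\<Sum>R\<in>degbox N. g R) = (\<Sum>K\<in>degbox M. \<Sum>R\<in>below K. f (K - R) * g R)"
proof -
  have "(\<Sum>K\<in>degbox M. \<Sum>R\<in>below K. f (K - R) * g R) = (\<Sum>(K,R)\<in>Sigma (degbox M) below. f (K - R) * g R)"
    by (simp add: sum.Sigma)
  also have "\<dots> = (\<Sum>(K,R)\<in>{(K,R). (\<lambda>i. K i + R i) \<in> degbox M}. f K * g R)"
    by (rule sum.reindex_bij_witness[of _ "\<lambda>(K,R). (\<lambda>i. K i + R i, R)" "\<lambda>(K,R). (K - R, R)"])
       (auto simp: below_def fun_eq_iff)
  also have "\<dots> = (\<Sum>(K,R)\<in>degbox N \<times> degbox N. f K * g R)"
  proof (rule sum.mono_neutral_right)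
    show "finite {(K, R). (\<lambda>i. K i + R i) \<in> degbox M}"
      by (rule finite_subset[of _ "degbox M \<times> degbox M"]) (auto simp: degbox_def mdeg_add)
    show "degbox N \<times> degbox N \<subseteq> {(K, R). (\<lambda>i. K i + R i) \<in> degbox M}"
      using assms(3) by (auto simp: degbox_def mdeg_add)
    show "\<forall>x\<in>{(K, R). (\<lambda>i. K i + R i) \<in> degbox M} - degbox N \<times> degbox N. (case x of (K, R) \<Rightarrow> f K * g R) = 0"
      using assms(1,2) by (auto simp: degbox_def) (metis not_le)+
  qed
  finally show ?thesis by (simp add: sum_product sum.cartesian_product)
qed

lemma poly_of_mult:
  assumes "supp_box N c" "supp_box N d" "2 * N \<le> M"
  shows "poly_of N c z * poly_of N d z = poly_of M (bconv c d) z"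
proof -
  let ?w = "cnjv z"
  have inner: "(\<Sum>L\<in>degbox N. c K L * dpow ?w L) * (\<Sum>L\<in>degbox N. d R L * dpow ?w L) =
     (\<Sum>L\<in>degbox M. \<Sum>Q\<in>below L. (c K Q * d R (L - Q)) * of_nat (mbinom L Q) * dpow ?w L)" for K R
  proof -
    have "(\<Sum>L\<in>degbox N. d R L * dpow ?w L) * (\<Sum>L\<in>degbox N. c K L * dpow ?w L) =
      (\<Sum>L\<in>degbox M. \<Sum>Q\<in>below L. (d R (L - Q) * dpow ?w (L - Q)) * (c K Q * dpow ?w Q))"
      using assms by (intro sum_box_product) (auto simp: supp_box_def)
    also have "\<dots> = (\<Sum>L\<in>degbox M. \<Sum>Q\<in>below L. (c K Q * d R (L - Q)) * of_nat (mbinom L Q) * dpow ?w L)"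
      by (intro sum.cong refl) (simp add: mult_ac flip: dpow_mult_binom)
    finally show ?thesis by (simp add: mult.commute)
  qed
  have aux: "(a * F) * (b * G) = (a * b) * (F * G)" for a b F G :: complex by simp
  have "poly_of N c z * poly_of N d z =
    (\<Sum>K\<in>degbox N. dpow z K * (\<Sum>L\<in>degbox N. c K L * dpow ?w L)) * (\<Sum>K\<in>degbox N. dpow z K * (\<Sum>L\<in>degbox N. d K L * dpow ?w L))"
    by (simp add: poly_of_def sum_distrib_left mult_ac)
  also have "\<dots> = (\<Sum>K\<in>degbox M. \<Sum>R\<in>below K. (dpow z (K - R) * (\<Sum>L\<in>degbox N. c (K - R) L * dpow ?w L)) *
     (dpow z R * (\<Sum>L\<in>degbox N. d R L * dpow ?w L)))"
    using assms by (intro sum_box_product) (auto simp: supp_box_def)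
  also have "\<dots> = (\<Sum>K\<in>degbox M. \<Sum>R\<in>below K. (of_nat (mbinom K R) * dpow z K) *
     (\<Sum>L\<in>degbox M. \<Sum>Q\<in>below L. (c (K - R) Q * d R (L - Q)) * of_nat (mbinom L Q) * dpow ?w L))"
  proof (intro sum.cong refl)
    fix K R :: "'a \<Rightarrow> nat" assume "R \<in> below K"
    note * = dpow_mult_binom[OF this, of z]
    show "(dpow z (K - R) * (\<Sum>L\<in>degbox N. c (K - R) L * dpow ?w L)) * (dpow z R * (\<Sum>L\<in>degbox N. d R L * dpow ?w L)) =
      (of_nat (mbinom K R) * dpow z K) *
       (\<Sum>L\<in>degbox M. \<Sum>Q\<in>below L. (c (K - R) Q * d R (L - Q)) * of_nat (mbinom L Q) * dpow ?w L)"
      unfolding inner[symmetric] by (rule trans[OF aux]) (simp only: *)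
  qed
  also have "\<dots> = (\<Sum>K\<in>degbox M. \<Sum>L\<in>degbox M. \<Sum>R\<in>below K. \<Sum>Q\<in>below L. (of_nat (mbinom K R) * dpow z K) *
     ((c (K - R) Q * d R (L - Q)) * of_nat (mbinom L Q) * dpow ?w L))"
    unfolding sum_distrib_left by (intro sum.cong refl sum.swap)
  also have "\<dots> = poly_of M (bconv c d) z"
    unfolding poly_of_def bconv_def sum_distrib_right by (intro sum.cong refl) (simp add: mult_ac)
  finally show ?thesis .
qed

lemma poly_of_sum: "poly_of N (\<lambda>K L. \<Sum>j\<in>S. c j K L) z = (\<Sum>j\<in>S. poly_of N (c j) z)"
  unfolding poly_of_def sum_distrib_right by (rule sum_rotate)

lemma poly_of_mult_const: "poly_of N (\<lambda>K L. x * c K L) z = x * poly_of N c z"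
  by (simp add: poly_of_def sum_distrib_left mult_ac)

lemma poly_of_mono_box:
  assumes "supp_box N c" "N \<le> M"
  shows "poly_of M c z = poly_of N c z"
proof -
  have "poly_of M c z = (\<Sum>K\<in>degbox N. \<Sum>L\<in>degbox M. c K L * dpow z K * dpow (cnjv z) L)"
    unfolding poly_of_def using assms
    by (intro sum.mono_neutral_right) (auto simp: degbox_def supp_box_def)
  also have "\<dots> = (\<Sum>K\<in>degbox N. \<Sum>L\<in>degbox N. c K L * dpow z K * dpow (cnjv z) L)"
    using assms by (intro sum.cong refl sum.mono_neutral_right) (auto simp: degbox_def supp_box_def)
  finally show ?thesis by (simp add: poly_of_def)
qed

section \<open>Index triples as pairs of multi-indices\<close>

text \<open>The exponent of the coordinate with index 0 is the one that completes the degree to \<open>\<alpha>\<close>.\<close>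
definition lift :: "('n::finite \<Rightarrow> nat) \<Rightarrow> nat \<Rightarrow> ('n option \<Rightarrow> nat)" where
  "lift P \<alpha> = case_option (\<alpha> - mdeg P) P"

definition tri :: "('n::finite option \<Rightarrow> nat) \<Rightarrow> ('n option \<Rightarrow> nat) \<Rightarrow> 'n triple" where
  "tri K L = (K \<circ> Some, L \<circ> Some, mdeg K)"

definition arr :: "('n::finite triple \<Rightarrow> complex) \<Rightarrow> 'n option arr" where
  "arr c K L = (if mdeg K = mdeg L then c (tri K L) else 0)"

definition unarr :: "'n::finite option arr \<Rightarrow> 'n triple \<Rightarrow> complex" where
  "unarr a = (\<lambda>(P, Q, \<alpha>). if (P, Q, \<alpha>) \<in> triples then a (lift P \<alpha>) (lift Q \<alpha>) else 0)"

abbreviation eqpairs :: "(('n::finite option \<Rightarrow> nat) \<times> ('n option \<Rightarrow> nat)) set" where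
  "eqpairs \<equiv> {(K, L). mdeg K = mdeg L}"

lemma sum_option: "(\<Sum>i\<in>UNIV. f i) = f None + (\<Sum>i\<in>(UNIV :: 'n::finite set). f (Some i))"
  by (simp add: UNIV_option_conv sum.reindex)

lemma prod_option: "(\<Prod>i\<in>UNIV. f i) = f None * (\<Prod>i\<in>(UNIV :: 'n::finite set). f (Some i))"
  by (simp add: UNIV_option_conv prod.reindex)

lemma mdeg_option: "mdeg K = K None + mdeg (K \<circ> Some)"
  by (simp add: mdeg_def sum_option)

lemma mdeg_lift: "mdeg P \<le> \<alpha> \<Longrightarrow> mdeg (lift P \<alpha>) = \<alpha>"
  unfolding mdeg_option[of "lift P \<alpha>"] by (simp add: lift_def comp_def)

lemma lift_Some: "lift P \<alpha> \<circ> Some = P"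
  by (auto simp: lift_def)

lemma lift_comp: "lift (K \<circ> Some) (mdeg K) = K"
  by (auto simp: lift_def mdeg_option[of K] fun_eq_iff split: option.splits)

lemma tri_in_triples: "mdeg K = mdeg L \<Longrightarrow> tri K L \<in> triples"
  using mdeg_option[of K] mdeg_option[of L] by (simp add: tri_def triples_def)

lemma tri_lift: "(P, Q, \<alpha>) \<in> triples \<Longrightarrow> tri (lift P \<alpha>) (lift Q \<alpha>) = (P, Q, \<alpha>)"
  by (simp add: tri_def triples_def lift_Some mdeg_lift)

lemma triples_E:
  assumes "T \<in> triples"
  obtains K L where "mdeg K = mdeg L" "T = tri K L"
proof -
  obtain P Q \<alpha> where T: "T = (P, Q, \<alpha>)" by (cases T)
  then show ?thesis
    using assms tri_lift[of P Q \<alpha>] mdeg_lift[of P \<alpha>] mdeg_lift[of Q \<alpha>]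
    by (intro that[of "lift P \<alpha>" "lift Q \<alpha>"]) (auto simp: triples_def)
qed

text \<open>Triples and pairs of multi-indices of equal degree are two descriptions of the same index set;
  this allows to treat all n+1 coordinates alike.\<close>
lemma bij_tri:
  "bij_betw (\<lambda>(K, L). tri K L) (eqpairs :: (('n::finite option \<Rightarrow> nat) \<times> ('n option \<Rightarrow> nat)) set) triples"
proof (rule bij_betw_byWitness[where f' = "\<lambda>(P, Q, \<alpha>). (lift P \<alpha>, lift Q \<alpha>)"])
  have "(\<lambda>(P, Q, \<alpha>). (lift P \<alpha>, lift Q \<alpha>)) (tri K L) = (K, L)"
    if "mdeg K = mdeg L" for K L :: "'n option \<Rightarrow> nat"
    using lift_comp[of K] lift_comp[of L] that by (simp add: tri_def)
  then show "\<forall>x\<in>eqpairs. (\<lambda>(P, Q, \<alpha>). (lift P \<alpha>, lift Q \<alpha>)) ((\<lambda>(K, L). tri K L) x) = (x :: ('n option \<Rightarrow> nat) \<times> ('n option \<Rightarrow> nat))"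
    by auto
  show "\<forall>T\<in>triples. (case case T of (P, Q, \<alpha>) \<Rightarrow> (lift P \<alpha>, lift Q \<alpha>) of (K, L) \<Rightarrow> tri K L) = T"
    by (auto simp: tri_lift)
  show "(\<lambda>(K, L). tri K L) ` eqpairs \<subseteq> triples" using tri_in_triples by auto
  show "(\<lambda>(P, Q, \<alpha>). (lift P \<alpha>, lift Q \<alpha>)) ` triples \<subseteq> eqpairs"
    by (auto simp: triples_def mdeg_lift)
qed

lemma eqdeg_arr: "eqdeg (arr c)"
  by (simp add: eqdeg_def arr_def)

lemma arr_unarr: "eqdeg a \<Longrightarrow> arr (unarr a) = a"
proof (intro ext)
  fix K L assume a: "eqdeg a"
  show "arr (unarr a) K L = a K L"
  proof (cases "mdeg K = mdeg L")
    case True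
    then have "unarr a (tri K L) = a K L"
      using tri_in_triples[OF True] lift_comp[of K] lift_comp[of L] by (simp add: tri_def unarr_def)
    with True show ?thesis by (simp add: arr_def)
  qed (use a in \<open>auto simp: eqdeg_def arr_def\<close>)
qed

lemma unarr_arr: "(\<And>T. T \<notin> triples \<Longrightarrow> c T = 0) \<Longrightarrow> unarr (arr c) = c"
  by (auto simp: unarr_def arr_def fun_eq_iff tri_lift) (auto simp: triples_def mdeg_lift)

lemma unarr_off: "T \<notin> triples \<Longrightarrow> unarr a T = 0"
  by (cases T) (simp add: unarr_def)

lemma weighted_tri:
  "weighted e c (tri K L) = cmod (c (tri K L)) / fact (mdeg K) powr e"
  by (simp add: tri_def)

text \<open>This translates the seminorms of the completion into bounds for arrays.\<close>
lemma weighted_le_iff_bnd: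
  assumes "\<And>T. T \<notin> triples \<Longrightarrow> c T = 0" "B \<ge> 0"
  shows "(\<forall>T\<in>triples. weighted e c T \<le> B) \<longleftrightarrow> bnd e B (arr c)"
proof -
  have "(\<forall>T\<in>triples. weighted e c T \<le> B) \<longleftrightarrow> (\<forall>K L. mdeg K = mdeg L \<longrightarrow> weighted e c (tri K L) \<le> B)"
  proof -
    show ?thesis using tri_in_triples triples_E by metis
  qed
  also have "\<dots> \<longleftrightarrow> bnd e B (arr c)"
    using assms(2) by (auto simp: bnd_def arr_def weighted_tri divide_le_eq)
  finally show ?thesis .
qed

lemma arr_hat_iff:
  assumes "\<And>T. T \<notin> triples \<Longrightarrow> c T = 0"
  shows "c \<in> hat_coeffs \<longleftrightarrow> arr c \<in> hat"
proof -
  have "bdd_above (weighted e c ` triples) \<longleftrightarrow> (\<exists>B. bnd e B (arr c))" for e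
  proof
    assume "bdd_above (weighted e c ` triples)"
    then obtain B where B: "\<forall>T\<in>triples. weighted e c T \<le> B" by (auto simp: bdd_above_def)
    then have "\<forall>T\<in>triples. weighted e c T \<le> max B 0" by fastforce
    then show "\<exists>B. bnd e B (arr c)" using weighted_le_iff_bnd[of c "max B 0" e] assms by auto
  next
    assume "\<exists>B. bnd e B (arr c)"
    then obtain B where B: "bnd e B (arr c)" ..
    then have "\<forall>T\<in>triples. weighted e c T \<le> B"
      using weighted_le_iff_bnd[of c B e] assms bnd_nonneg[OF B] by auto
    then show "bdd_above (weighted e c ` triples)" by (auto simp: bdd_above_def)
  qed
  then show ?thesis using assms by (auto simp: hat_coeffs_def hat_def eqdeg_arr)
qed

lemma unarr_hat: "a \<in> hat \<Longrightarrow> unarr a \<in> hat_coeffs"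
  using arr_hat_iff[of "unarr a"] unarr_off[of _ a] arr_unarr[of a] hatD(1)[of a] by simp

lemma arr_hat: "c \<in> hat_coeffs \<Longrightarrow> arr c \<in> hat"
  using arr_hat_iff[of c] by (auto simp: hat_coeffs_def)

lemma sum_triples:
  assumes "c \<in> fin_coeffs" "supp_box N (arr c)"
  shows "(\<Sum>T | c T \<noteq> 0. c T * F T) = (\<Sum>K\<in>degbox N. \<Sum>L\<in>degbox N. arr c K L * F (tri K L))"
proof -
  let ?E = "{(K, L) \<in> eqpairs. c (tri K L) \<noteq> 0}"
  have "bij_betw (\<lambda>(K, L). tri K L) ?E {T. c T \<noteq> 0}"
  proof (rule bij_betw_subset[OF bij_tri])
    show "(\<lambda>(K, L). tri K L) ` ?E = {T. c T \<noteq> 0}"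
    proof
      show "{T. c T \<noteq> 0} \<subseteq> (\<lambda>(K, L). tri K L) ` ?E"
      proof
        fix T assume T: "T \<in> {T. c T \<noteq> 0}"
        then have "T \<in> triples" using assms(1) unfolding fin_coeffs_def by blast
        then obtain K L where "mdeg K = mdeg L" "T = tri K L" 
          by (rule triples_E)
        then show "T \<in> (\<lambda>(K, L). tri K L) ` ?E" using T by (intro image_eqI[of _ _ "(K, L)"]) auto
      qed
    qed auto
  qed auto
  then have "(\<Sum>T | c T \<noteq> 0. c T * F T) = (\<Sum>x\<in>?E. (case x of (K, L) \<Rightarrow> c (tri K L) * F (tri K L)))"
    by (subst sum.reindex_bij_betw[symmetric]) (auto simp: case_prod_unfold)
  also have "\<dots> = (\<Sum>x\<in>degbox N \<times> degbox N. (case x of (K, L) \<Rightarrow> arr c K L * F (tri K L)))"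
  proof (rule sum.mono_neutral_cong_left)
    show "?E \<subseteq> degbox N \<times> degbox N"
      using assms(2) by (auto simp: supp_box_def arr_def degbox_def) (metis not_le)+
  qed (auto simp: arr_def split: if_splits)
  finally show ?thesis by (simp add: sum.cartesian_product)
qed

lemma fin_coeffs_supp:
  assumes "c \<in> fin_coeffs"
  shows "\<exists>N. supp_box N (arr c)"
proof -
  have fin: "finite {T. c T \<noteq> 0}" using assms by (auto simp: fin_coeffs_def)
  define N where "N = Max (insert 0 ((\<lambda>(P, Q, \<alpha>). \<alpha>) ` {T. c T \<noteq> 0}))"
  have "mdeg K \<le> N" if "arr c K L \<noteq> 0" for K L
  proof -
    have "c (tri K L) \<noteq> 0" using that by (auto simp: arr_def split: if_splits)
    then have "mdeg K \<in> insert 0 ((\<lambda>(P, Q, \<alpha>). \<alpha>) ` {T. c T \<noteq> 0})" by (force simp: tri_def)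
    then show ?thesis unfolding N_def using fin by (intro Max_ge) auto
  qed
  then have "supp_box N (arr c)"
    unfolding supp_box_def using eqdeg_arr[of c] by (metis eqdeg_def not_le)
  then show ?thesis ..
qed

lemma supp_box_mono: "supp_box N a \<Longrightarrow> N \<le> M \<Longrightarrow> supp_box M a"
  by (auto simp: supp_box_def)

lemma fin_coeffs_unarr:
  assumes "supp_box N a"
  shows "unarr a \<in> fin_coeffs"
proof -
  have "{T. unarr a T \<noteq> 0} \<subseteq> (\<lambda>(K, L). tri K L) ` (degbox N \<times> degbox N)"
  proof
    fix T assume T: "T \<in> {T. unarr a T \<noteq> 0}"
    obtain P Q \<alpha> where [simp]: "T = (P, Q, \<alpha>)" by (cases T)
    have "T \<in> triples" "a (lift P \<alpha>) (lift Q \<alpha>) \<noteq> 0"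
      using T by (auto simp: unarr_def split: if_splits)
    moreover from this have "lift P \<alpha> \<in> degbox N" "lift Q \<alpha> \<in> degbox N"
      using assms by (auto simp: supp_box_def degbox_def) (metis not_le)+
    ultimately show "T \<in> (\<lambda>(K, L). tri K L) ` (degbox N \<times> degbox N)"
      by (force simp: tri_lift)
  qed
  then have "finite {T. unarr a T \<noteq> 0}" by (rule finite_subset) auto
  then show ?thesis using unarr_off by (auto simp: fin_coeffs_def)
qed

section \<open>The monomials in divided powers\<close>

lemma mfact_pos: "mfact K > 0"
  by (simp add: mfact_def prod_pos)

lemma mfact_option: "mfact K = fact (K None) * mfact (K \<circ> Some)"
  by (simp add: mfact_def prod_option)

lemma mfact_dpow: "of_nat (mfact K) * dpow z K = z $ None ^ K None * mpow z (K \<circ> Some)"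
proof -
  have "of_nat (mfact K) * dpow z K = (\<Prod>i\<in>UNIV. z $ i ^ K i)"
    by (simp add: mfact_def dpow_def of_nat_prod prod.distrib[symmetric])
  then show ?thesis by (simp add: prod_option mpow_def)
qed

lemma e_mon_tri:
  assumes "mdeg K = mdeg L"
  shows "e_mon (tri K L) z = of_nat (mfact K) * of_nat (mfact L) * (dpow z K * dpow (cnjv z) L)"
proof -
  have "mdeg K - mdeg (K \<circ> Some) = K None" "mdeg L - mdeg (L \<circ> Some) = L None"
    using mdeg_option[of K] mdeg_option[of L] by auto
  then have "e_mon (tri K L) z = (of_nat (mfact K) * dpow z K) * cnj (of_nat (mfact L) * dpow z L)"
    using assms by (simp add: tri_def mfact_dpow)
  then show ?thesis by (simp add: dpow_cnjv)
qed

lemma f_mon_tri: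
  assumes "mdeg K = mdeg L" "z \<in> cone"
  shows "f_mon h (tri K L) z = of_real (pochhammer (yfun z / (2 * h)) (mdeg K) / yfun z ^ mdeg K)
     * (dpow z K * dpow (cnjv z) L)"
proof -
  have K: "mdeg K - mdeg (K \<circ> Some) = K None" "mdeg L - mdeg (L \<circ> Some) = L None"
    using mdeg_option[of K] mdeg_option[of L] by auto
  have "f_mon h (tri K L) z = of_real (1 / (of_nat (mfact K) * of_nat (mfact L))
      * pochhammer (yfun z / (2 * h)) (mdeg K)) * e_mon (tri K L) z / of_real (yfun z ^ mdeg K)"
    using assms K by (simp add: tri_def mfact_option[of K] mfact_option[of L] mult_ac)
  then show ?thesis
    unfolding e_mon_tri[OF assms(1)] using mfact_pos[of K] mfact_pos[of L] by (simp add: field_simps)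
qed

lemma S_mon_tri:
  assumes "mdeg K = mdeg L" 
  shows "S_mon h (tri K L) z = of_real ((2 * h) ^ mdeg K) * of_nat (mfact K) * of_nat (mfact L) * f_mon h (tri K L) z"
proof (cases "z \<in> cone")
  case True
  have "S_mon h (tri K L) z = of_real ((2 * h) ^ mdeg K * pochhammer (yfun z / (2 * h)) (mdeg K))
     * e_mon (tri K L) z / of_real (yfun z ^ mdeg K)"
    using True by (simp add: tri_def)
  then show ?thesis
    unfolding e_mon_tri[OF assms(1)] f_mon_tri[OF assms True] by (simp add: field_simps)
qed (simp add: tri_def)

lemma e_comb_poly_of:
  assumes "c \<in> fin_coeffs" "supp_box N (arr c)"
  shows "e_comb c = poly_of N (\<lambda>K L. arr c K L * of_nat (mfact K) * of_nat (mfact L))"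
proof
  fix z
  have "e_comb c z = (\<Sum>K\<in>degbox N. \<Sum>L\<in>degbox N. arr c K L * e_mon (tri K L) z)"
    unfolding e_comb_def by (rule sum_triples[OF assms])
  also have "\<dots> = poly_of N (\<lambda>K L. arr c K L * of_nat (mfact K) * of_nat (mfact L)) z"
    unfolding poly_of_def
  proof (intro sum.cong refl)
    fix K L show "arr c K L * e_mon (tri K L) z =
      arr c K L * of_nat (mfact K) * of_nat (mfact L) * dpow z K * dpow (cnjv z) L"
      by (cases "mdeg K = mdeg L") (auto simp: e_mon_tri arr_def)
  qed
  finally show "e_comb c z = poly_of N (\<lambda>K L. arr c K L * of_nat (mfact K) * of_nat (mfact L)) z" .
qed

lemma arr_inject:
  assumes "\<And>T. T \<notin> triples \<Longrightarrow> c T = 0" "\<And>T. T \<notin> triples \<Longrightarrow> d T = 0" "arr c = arr d"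
  shows "c = d"
  using unarr_arr[of c] unarr_arr[of d] assms by metis

lemma e_comb_inject:
  assumes "c \<in> fin_coeffs" "d \<in> fin_coeffs" "e_comb c = e_comb d"
  shows "c = d"
proof -
  obtain N1 N2 where "supp_box N1 (arr c)" "supp_box N2 (arr d)"
    using fin_coeffs_supp assms by blast
  then obtain N where N: "supp_box N (arr c)" "supp_box N (arr d)"
    using supp_box_mono[of _ _ "max N1 N2"] by (metis max.cobounded1 max.cobounded2)
  have "(arr c K L - arr d K L) * of_nat (mfact K) * of_nat (mfact L) = 0" for K L
  proof (rule poly_of_eq_0_imp[of UNIV 0 "2 * N" "\<lambda>K L. (arr c K L - arr d K L) * of_nat (mfact K) * of_nat (mfact L)" "2 * N"])
    fix z
    have s: "supp_box N (\<lambda>K L. arr c K L * of_nat (mfact K) * of_nat (mfact L))"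
      "supp_box N (\<lambda>K L. arr d K L * of_nat (mfact K) * of_nat (mfact L))"
      using N by (auto simp: supp_box_def)
    have "poly_of (2 * N) (\<lambda>K L. (arr c K L - arr d K L) * of_nat (mfact K) * of_nat (mfact L)) z = 
       e_comb c z - e_comb d z"
      unfolding e_comb_poly_of[OF assms(1) N(1)] e_comb_poly_of[OF assms(2) N(2)]
      using poly_of_mono_box[OF s(1), of "2 * N" z] poly_of_mono_box[OF s(2), of "2 * N" z]
      by (simp add: poly_of_def left_diff_distrib sum_subtractf)
    then show "poly_of (2 * N) (\<lambda>K L. (arr c K L - arr d K L) * of_nat (mfact K) * of_nat (mfact L)) z = 0"
      using assms(3) by simp
  next
    fix K L :: "'a option \<Rightarrow> nat" assume "2 * N < mdeg K + mdeg L"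
    then have "mdeg K > N \<or> mdeg L > N" by linarith
    then show "(arr c K L - arr d K L) * of_nat (mfact K) * of_nat (mfact L) = 0"
      using N unfolding supp_box_def by (metis diff_self mult_zero_left)
  qed auto
  then have "arr c K L = arr d K L" for K L
    using mfact_pos[of K] mfact_pos[of L] by (metis eq_iff_diff_eq_0 less_irrefl mult_eq_0_iff of_nat_eq_0_iff)
  then have "arr c = arr d" by blast
  then show ?thesis using arr_inject[of c d] assms by (auto simp: fin_coeffs_def)
qed

lemma e_coeffs_e_comb: "c \<in> fin_coeffs \<Longrightarrow> e_coeffs (e_comb c) = c"
  unfolding e_coeffs_def using e_comb_inject by blast

section \<open>The deformed monomials as a series in the degree\<close>

lemma hpart_poly_of: "hpart g a z (cnjv z) = poly_of g (\<lambda>K L. if mdeg K = g \<and> mdeg L = g then a K L else 0) z"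
proof -
  have "poly_of g (\<lambda>K L. if mdeg K = g \<and> mdeg L = g then a K L else 0) z =
     (\<Sum>K\<in>graded g. \<Sum>L\<in>degbox g. (if mdeg K = g \<and> mdeg L = g then a K L else 0) * dpow z K * dpow (cnjv z) L)"
    unfolding poly_of_def by (rule sum.mono_neutral_right) (auto simp: graded_def degbox_def)
  also have "\<dots> = (\<Sum>K\<in>graded g. \<Sum>L\<in>graded g. (if mdeg K = g \<and> mdeg L = g then a K L else 0) * dpow z K * dpow (cnjv z) L)"
    by (intro sum.cong refl sum.mono_neutral_right) (auto simp: graded_def degbox_def)
  finally show ?thesis by (simp add: hpart_def graded_def)
qed

lemma norm_component_le_norm: "norm (z $ i) \<le> norm (z :: complex ^ 'i::finite)"
  by (rule Finite_Cartesian_Product.norm_nth_le)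

lemma dpow_cmod: "dpow (\<chi> i. of_real (cmod (z $ i))) K = of_real (cmod (dpow z K))"
  by (simp add: dpow_def prod_norm[symmetric] norm_divide norm_power)

lemma sum_norm_hpart_le:
  assumes "bnd e B a"
  shows "(\<Sum>(K, L)\<in>graded g \<times> graded g. norm (a K L * dpow z K * dpow \<zeta> L))
     \<le> B * (facbase TYPE('i::finite) ^ 4 * norm (z :: complex ^ 'i) * norm \<zeta>) ^ g * fact g powr e / (fact g)\<^sup>2"
proof -
  define a' where "a' = (\<lambda>K L. complex_of_real (norm (a K L)))"
  let ?z = "(\<chi> i. of_real (cmod (z $ i))) :: complex ^ 'i" and ?\<zeta> = "(\<chi> i. of_real (cmod (\<zeta> $ i))) :: complex ^ 'i"
  have "hpart g a' ?z ?\<zeta> = of_real (\<Sum>(K, L)\<in>graded g \<times> graded g. norm (a K L * dpow z K * dpow \<zeta> L))"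
    unfolding hpart_def a'_def dpow_cmod by (simp add: norm_mult sum.cartesian_product case_prod_unfold)
  then have "(\<Sum>(K, L)\<in>graded g \<times> graded g. norm (a K L * dpow z K * dpow \<zeta> L)) = norm (hpart g a' ?z ?\<zeta>)"
    by (simp only: norm_of_real) (simp add: sum_nonneg case_prod_unfold)
  also have "\<dots> \<le> B * (facbase TYPE('i::finite) ^ 4 * norm z * norm \<zeta>) ^ g * fact g powr e / (fact g)\<^sup>2"
    using assms by (intro norm_hpart_le) (auto simp: bnd_def a'_def norm_component_le_norm)
  finally show ?thesis .
qed

lemma half_powr: "(fact g :: real) powr (1/2) / (fact g)\<^sup>2 * fact g = 1 / fact g powr (1/2)"
  by (simp add: field_simps power2_eq_square flip: powr_add) 

lemma norm_hpart_pochhammer_le: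
  assumes "bnd (1/2) B a" "norm (z :: complex ^ 'i::finite) \<le> R" "norm \<zeta> \<le> R'" "norm t \<le> D"
  shows "norm (pochhammer t g * hpart g a z \<zeta>) \<le> B * ((1 + D) * (facbase TYPE('i) ^ 4 * R * R')) ^ g / fact g powr (1/2)"
proof -
  have "norm (z $ i) \<le> R" "norm (\<zeta> $ i) \<le> R'" for i
    using assms norm_component_le_norm order_trans by blast+
  from norm_hpart_le[OF assms(1) this]
  have h: "norm (hpart g a z \<zeta>) \<le> B * (facbase TYPE('i) ^ 4 * R * R') ^ g * fact g powr (1/2) / (fact g)\<^sup>2" .
  have p: "norm (pochhammer t g) \<le> fact g * (1 + D) ^ g"
    by (rule order_trans[OF norm_pochhammer_le]) (use assms(4) in \<open>auto intro!: mult_left_mono power_mono\<close>)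
  have "D \<ge> 0" using assms(4) norm_ge_zero order_trans by blast
  then have "norm (pochhammer t g * hpart g a z \<zeta>) \<le> (fact g * (1 + D) ^ g) *
     (B * (facbase TYPE('i) ^ 4 * R * R') ^ g * fact g powr (1/2) / (fact g)\<^sup>2)"
    unfolding norm_mult by (intro mult_mono p h) auto
  also have "\<dots> = B * ((1 + D) * (facbase TYPE('i) ^ 4 * R * R')) ^ g * (fact g powr (1/2) / (fact g)\<^sup>2 * fact g)"
    by (simp add: power_mult_distrib mult_ac)
  finally show ?thesis unfolding half_powr by simp
qed

lemma summable_majorant: "M \<ge> 0 \<Longrightarrow> summable (\<lambda>g. B * M ^ g / fact g powr (1/2) :: real)"
  using summable_mult[OF summable_power_div_fact_powr[of "1/2" M], of B] by simp

text \<open>The value at \<open>z\<close> of the element with coefficients \<open>a\<close> has this form with \<open>x = y / (2 h)\<close> and \<open>\<zeta>\<close> the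
  conjugate of \<open>z\<close> divided by \<open>y\<close>; the general form extends it to independent complex arguments.\<close>
definition eval_series :: "complex \<Rightarrow> 'i::finite arr \<Rightarrow> complex ^ 'i \<Rightarrow> complex ^ 'i \<Rightarrow> complex" where
  "eval_series x a z \<zeta> = (\<Sum>g. pochhammer x g * hpart g a z \<zeta>)"

lemma summable_eval_series:
  assumes "a \<in> hat"
  shows "summable (\<lambda>g. norm (pochhammer x g * hpart g a z \<zeta>))"
proof -
  obtain B where B: "bnd (1/2) B a" using hatD(2)[OF assms, of "1/2"] by auto
  show ?thesis
  proof (rule summable_comparison_test'[OF summable_majorant])
    show "norm (norm (pochhammer x g * hpart g a z \<zeta>)) \<le> B * ((1 + norm x) * (facbase TYPE('a) ^ 4 * norm z * norm \<zeta>)) ^ g / fact g powr (1/2)"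
      for g using norm_hpart_pochhammer_le[OF B order_refl order_refl order_refl, of x g z \<zeta>] by simp
  qed (use facbase_ge_1[where ?'i='a] in auto)
qed

lemma eval_series_sums:
  "a \<in> hat \<Longrightarrow> (\<lambda>g. pochhammer x g * hpart g a z \<zeta>) sums eval_series x a z \<zeta>"
  unfolding eval_series_def by (rule summable_sums[OF summable_norm_cancel[OF summable_eval_series]])

text \<open>The factor \<open>M\<close> does not depend on the array; this is the continuity of the evaluation.\<close>
lemma norm_eval_series_le:
  "\<exists>M. \<forall>B a. a \<in> hat \<longrightarrow> bnd (1/2) B a \<longrightarrow> norm (eval_series x a z \<zeta>) \<le> M * B"
proof -
  let ?h = "\<lambda>g. ((1 + norm x) * (facbase TYPE('a) ^ 4 * norm z * norm \<zeta>)) ^ g / fact g powr (1/2)"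
  have "norm (eval_series x a z \<zeta>) \<le> B * suminf ?h" if a: "a \<in> hat" "bnd (1/2) B a" for B a
  proof -
    have sh: "summable ?h" 
      using facbase_ge_1[where ?'i='a] by (intro summable_power_div_fact_powr) auto
    have "norm (eval_series x a z \<zeta>) \<le> (\<Sum>g. norm (pochhammer x g * hpart g a z \<zeta>))"
      unfolding eval_series_def by (rule summable_norm[OF summable_eval_series[OF a(1)]])
    also have "\<dots> \<le> (\<Sum>g. B * ?h g)"
      using norm_hpart_pochhammer_le[OF a(2) order_refl order_refl order_refl, of x _ z \<zeta>]
      by (intro suminf_le summable_eval_series[OF a(1)] summable_mult sh) auto
    also have "\<dots> = B * suminf ?h" by (rule suminf_mult[OF sh])
    finally show ?thesis .
  qed
  then show ?thesis by (intro exI[of _ "suminf ?h"] allI impI) (subst mult.commute, blast)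
qed

lemma f_comb_off_cone:
  fixes z :: "'n::finite pt"
  assumes "z \<notin> cone"
  shows "f_comb h c z = 0"
proof -
  have "f_comb h c z = infsum (\<lambda>_. 0) (triples :: 'n triple set)"
    unfolding f_comb_def by (rule infsum_cong) (use assms in \<open>auto simp: triples_def\<close>)
  then show ?thesis by simp
qed

lemma dpow_scale: "dpow (r *s z) K = r ^ mdeg K * dpow z K"
  by (simp add: dpow_def power_mult_distrib prod.distrib[symmetric] mdeg_def power_sum)

lemma hpart_scale: "hpart g a (r *s z) (s *s \<zeta>) = (r * s) ^ g * hpart g a z \<zeta>"
  by (simp add: hpart_def dpow_scale graded_def sum_distrib_left power_mult_distrib mult_ac)

text \<open>The unordered sum over the triples converges absolutely, so it can be grouped by the degree into
  finite inner sums.\<close>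
lemma f_comb_series:
  assumes "c \<in> hat_coeffs" "z \<in> cone"
  shows "f_comb h c z = eval_series (of_real (yfun z / (2 * h))) (arr c) z ((1 / of_real (yfun z)) *s cnjv z)"
proof -
  let ?y = "yfun z" and ?x = "yfun z / (2 * h)"
  let ?\<zeta> = "(1 / of_real ?y) *s cnjv z"
  let ?a = "arr c"
  have a: "?a \<in> hat" using arr_hat assms(1) by blast
  obtain B where B: "bnd (1/2) B ?a" using hatD(2)[OF a, of "1/2"] by auto
  define G where "G = (\<lambda>(K, L). ?a K L * f_mon h (tri K L) z)"
  have GKL: "G (K, L) = pochhammer (of_real ?x) (mdeg K) * (?a K L * dpow z K * dpow ?\<zeta> L)" 
    if "mdeg K = mdeg L" for K L
  proof -
    have "dpow ?\<zeta> L = (1 / of_real ?y) ^ mdeg L * dpow (cnjv z) L" by (rule dpow_scale)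
    moreover have "pochhammer (complex_of_real ?x) (mdeg K) = of_real (pochhammer ?x (mdeg K))"
      by (rule pochhammer_of_real)
    ultimately show ?thesis
      unfolding G_def prod.case f_mon_tri[OF that assms(2)] using that
      by (simp add: power_divide)
  qed
  let ?S = "Sigma UNIV (\<lambda>g. graded g \<times> graded g) :: (nat \<times> ('a option \<Rightarrow> nat) \<times> ('a option \<Rightarrow> nat)) set"
  have bij: "bij_betw snd ?S eqpairs"
    by (rule bij_betw_byWitness[where f' = "\<lambda>(K, L). (mdeg K, K, L)"]) (auto simp: graded_def)
  have inner: "(\<Sum>KL\<in>graded g \<times> graded g. G KL) = pochhammer (of_real ?x) g * hpart g ?a z ?\<zeta>" for g
  proof -
    have "(\<Sum>KL\<in>graded g \<times> graded g. G KL) = (\<Sum>(K, L)\<in>graded g \<times> graded g. pochhammer (of_real ?x) g * (?a K L * dpow z K * dpow ?\<zeta> L))"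
      by (intro sum.cong refl) (auto simp: GKL graded_def)
    then show ?thesis by (simp add: hpart_def sum.cartesian_product sum_distrib_left case_prod_unfold)
  qed
  have sumnorm: "(\<Sum>KL\<in>graded g \<times> graded g. norm (G KL)) \<le>
     B * ((1 + norm ?x) * (facbase TYPE('a option) ^ 4 * norm z * norm ?\<zeta>)) ^ g / fact g powr (1/2)" for g
  proof -
    have poch: "norm (pochhammer (complex_of_real ?x) g) \<le> fact g * (1 + norm ?x) ^ g"
      using norm_pochhammer_le[of "complex_of_real ?x" g] by (simp only: norm_of_real real_norm_def)
    have "(\<Sum>KL\<in>graded g \<times> graded g. norm (G KL)) = (\<Sum>(K, L)\<in>graded g \<times> graded g. norm (pochhammer (complex_of_real ?x) g) * norm (?a K L * dpow z K * dpow ?\<zeta> L))"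
      by (intro sum.cong refl) (auto simp: GKL graded_def norm_mult)
    also have "\<dots> = norm (pochhammer (complex_of_real ?x) g) * (\<Sum>(K, L)\<in>graded g \<times> graded g. norm (?a K L * dpow z K * dpow ?\<zeta> L))"
      by (simp add: sum_distrib_left case_prod_unfold)
    also have "\<dots> \<le> (fact g * (1 + norm ?x) ^ g) * (B * (facbase TYPE('a option) ^ 4 * norm z * norm ?\<zeta>) ^ g * fact g powr (1/2) / (fact g)\<^sup>2)"
      using poch by (intro mult_mono sum_norm_hpart_le[OF B]) (auto simp: case_prod_unfold intro!: sum_nonneg)
    also have "\<dots> = B * ((1 + norm ?x) * (facbase TYPE('a option) ^ 4 * norm z * norm ?\<zeta>)) ^ g * (fact g powr (1/2) / (fact g)\<^sup>2 * fact g)"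
      by (simp add: power_mult_distrib mult_ac)
    finally show ?thesis unfolding half_powr by simp
  qed
  have "summable (\<lambda>g. norm (\<Sum>KL\<in>graded g \<times> graded g. norm (G KL)))"
  proof (rule summable_comparison_test'[OF summable_majorant])
    show "norm (norm (\<Sum>KL\<in>graded g \<times> graded g. norm (G KL))) \<le> B * ((1 + norm ?x) * (facbase TYPE('a option) ^ 4 * norm z * norm ?\<zeta>)) ^ g / fact g powr (1/2)" for g
      using sumnorm[of g] by (simp add: sum_nonneg)
  qed (use facbase_ge_1[where ?'i="'a option"] in auto)
  then have "(\<lambda>g. norm (\<Sum>KL\<in>graded g \<times> graded g. norm (G KL))) summable_on UNIV"
    by (intro norm_summable_imp_summable_on) simp
  then have "(\<lambda>x. norm (G (snd x))) summable_on ?S"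
    by (subst Infinite_Sum.abs_summable_on_Sigma_iff) simp
  then have S: "(\<lambda>x. G (snd x)) summable_on ?S" by (rule Infinite_Sum.abs_summable_summable)
  have "f_comb h c z = (\<Sum>\<^sub>\<infinity>KL\<in>eqpairs. G KL)"
    unfolding f_comb_def infsum_reindex_bij_betw[OF bij_tri, symmetric]
    by (rule infsum_cong) (auto simp: G_def arr_def)
  also have "\<dots> = (\<Sum>\<^sub>\<infinity>x\<in>?S. G (snd x))"
    by (rule infsum_reindex_bij_betw[OF bij, symmetric])
  also have "\<dots> = (\<Sum>\<^sub>\<infinity>g. \<Sum>\<^sub>\<infinity>y\<in>graded g \<times> graded g. G y)"
    using infsum_Sigma'_banach[of "\<lambda>g y. G y" UNIV "\<lambda>g. graded g \<times> graded g"] S by (simp add: case_prod_unfold)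
  also have "\<dots> = (\<Sum>\<^sub>\<infinity>g. pochhammer (of_real ?x) g * hpart g ?a z ?\<zeta>)" by (simp add: inner)
  also have "\<dots> = eval_series (of_real ?x) ?a z ?\<zeta>"
    by (intro infsumI norm_summable_imp_has_sum summable_eval_series[OF a] eval_series_sums[OF a])
  finally show ?thesis .
qed

section \<open>Linear independence in the completion\<close>

text \<open>The homogeneous parts are polynomials, and their sum converges locally uniformly by the bounds above.\<close>
lemma holomorphic_eval_series:
  assumes a: "a \<in> hat" and S: "open S" and x: "x holomorphic_on S"
    and p: "\<And>i. (\<lambda>t. p t $ i) holomorphic_on S" and q: "\<And>i. (\<lambda>t. q t $ i) holomorphic_on S"
  shows "(\<lambda>t. eval_series (x t) a (p t) (q t)) holomorphic_on S"
proof -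
  obtain B where B: "bnd (1/2) B a" using hatD(2)[OF a, of "1/2"] by auto
  let ?f = "\<lambda>g t. pochhammer (x t) g * hpart g a (p t) (q t)"
  have hol: "?f g holomorphic_on S" for g
    unfolding hpart_def dpow_def pochhammer_prod
    by (intro holomorphic_intros x p q) auto
  have "\<exists>g g'. \<forall>t\<in>S. ((\<lambda>n. ?f n t) sums g t) \<and> ((\<lambda>n. deriv (?f n) t) sums g' t) \<and> (g has_field_derivative g' t) (at t)"
  proof (rule series_and_derivative_comparison_local[OF S])
    show "(?f n has_field_derivative deriv (?f n) t) (at t)" if "t \<in> S" for n t
      by (rule holomorphic_derivI[OF hol S that])
    fix t assume t: "t \<in> S"
    then obtain d where d: "d > 0" "cball t d \<subseteq> S" using S open_contains_cball by metis
    have cont: "continuous_on (cball t d) x" "continuous_on (cball t d) p" "continuous_on (cball t d) q"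
    proof -
      have "continuous_on (cball t d) (\<lambda>t. \<chi> i. p t $ i)" "continuous_on (cball t d) (\<lambda>t. \<chi> i. q t $ i)"
        using p q d by (intro continuous_on_vec_lambda holomorphic_on_imp_continuous_on; blast intro: holomorphic_on_subset)+
      then show "continuous_on (cball t d) p" "continuous_on (cball t d) q" by simp_all
      show "continuous_on (cball t d) x" 
        using x d holomorphic_on_imp_continuous_on holomorphic_on_subset by blast
    qed
    have bdd: "\<exists>D. \<forall>s\<in>cball t d. norm (f s) \<le> D" if "continuous_on (cball t d) f" for f :: "complex \<Rightarrow> complex"
      using compact_imp_bounded[OF compact_continuous_image[OF that compact_cball]] by (auto simp: bounded_iff)
    have bdd_vec: "\<exists>D. \<forall>s\<in>cball t d. norm (f s) \<le> D" if "continuous_on (cball t d) f" for f :: "complex \<Rightarrow> complex ^ 'a"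
      using compact_imp_bounded[OF compact_continuous_image[OF that compact_cball]] by (auto simp: bounded_iff)
    obtain D R R' where DR: "\<And>s. s \<in> cball t d \<Longrightarrow> norm (x s) \<le> D" "\<And>s. s \<in> cball t d \<Longrightarrow> norm (p s) \<le> R"
       "\<And>s. s \<in> cball t d \<Longrightarrow> norm (q s) \<le> R'"
      using bdd[OF cont(1)] bdd_vec[OF cont(2)] bdd_vec[OF cont(3)] by blast
    have nn: "D \<ge> 0" "R \<ge> 0" "R' \<ge> 0"
      using DR[of t] d norm_ge_zero order_trans by (auto, blast+)
    let ?h = "\<lambda>g. B * ((1 + D) * (facbase TYPE('a) ^ 4 * R * R')) ^ g / fact g powr (1/2)"
    show "\<exists>d h. 0 < d \<and> summable h \<and> (\<forall>\<^sub>F n in sequentially. \<forall>y\<in>ball t d \<inter> S. norm (?f n y) \<le> h n)"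
    proof (intro exI[of _ d] exI[of _ ?h] conjI always_eventually allI ballI)
      show "summable ?h" using nn facbase_ge_1[where ?'i='a] by (intro summable_majorant) auto
      show "norm (?f n y) \<le> ?h n" if "y \<in> ball t d \<inter> S" for n y
        using that DR by (intro norm_hpart_pochhammer_le[OF B]) auto
    qed (use d in auto)
  qed
  then obtain g g' where g: "\<And>t. t \<in> S \<Longrightarrow> ((\<lambda>n. ?f n t) sums g t)" "\<And>t. t \<in> S \<Longrightarrow> (g has_field_derivative g' t) (at t)"
    by blast
  have "g holomorphic_on S" using g(2) by (auto simp: holomorphic_on_open[OF S])
  moreover have "eval_series (x t) a (p t) (q t) = g t" if "t \<in> S" for t
    using g(1)[OF that] by (simp add: eval_series_def sums_iff)
  ultimately show ?thesis by (simp cong: holomorphic_cong)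
qed

lemma islimpt_of_real_interval:
  assumes "0 < \<delta>"
  shows "complex_of_real c islimpt of_real ` {c<..<c + \<delta>}"
proof (rule islimptI)
  fix T assume "complex_of_real c \<in> T" "open T"
  then obtain e where e: "e > 0" "ball (of_real c) e \<subseteq> T" using open_contains_ball by metis
  define y where "y = min e \<delta> / 2"
  have y: "0 < y" "y < e" "y < \<delta>" using e assms by (auto simp: y_def)
  then have "complex_of_real (c + y) \<in> T" using e by (auto simp: dist_norm)
  moreover have "complex_of_real (c + y) \<in> of_real ` {c<..<c + \<delta>}" using y by (intro imageI) simp
  ultimately show "\<exists>y\<in>of_real ` {c<..<c + \<delta>}. y \<in> T \<and> y \<noteq> complex_of_real c"
    using y by (intro bexI[of _ "complex_of_real (c + y)"]) auto
qed

text \<open>A homogeneous part of bidegree \<open>(g, g)\<close> only depends on the products of coordinates of \<open>z\<close> with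
  coordinates of \<open>\<zeta>\<close>.\<close>
lemma eval_series_scale:
  "r * s = 1 \<Longrightarrow> eval_series x a (r *s z) (s *s \<zeta>) = eval_series x a z \<zeta>"
  by (simp add: eval_series_def hpart_scale)

lemma yfun_scale: "yfun (r *s z) = (cmod r)\<^sup>2 * yfun z"
  by (simp add: yfun_def norm_mult power_mult_distrib sum_distrib_left algebra_simps)

lemma cnjv_scale: "cnjv (r *s z) = cnj r *s cnjv z"
  by (simp add: cnjv_def vec_eq_iff)

lemma open_cone: "open (cone :: 'n::finite pt set)"
proof -
  have "continuous_on UNIV (yfun :: 'n pt \<Rightarrow> real)"
    unfolding yfun_def[abs_def] by (intro continuous_intros)
  then show ?thesis unfolding cone_def by (intro open_Collect_less) auto
qed

lemma axis_in_cone: "axis None 1 \<in> (cone :: 'n::finite pt set)"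
  by (simp add: cone_def yfun_def axis_def)

text \<open>For a fixed direction \<open>z\<close> the values along the ray through \<open>z\<close> are a series in the rising
  factorials of \<open>t = y / (2 h)\<close>. It is entire in \<open>t\<close> and vanishes for positive \<open>t\<close>, hence
  everywhere; at \<open>t = 0, -1, -2, \<dots>\<close> it is a finite triangular system for the homogeneous parts.\<close>
lemma eval_series_eq_0_imp:
  fixes a :: "'n::finite option arr"
  assumes a: "a \<in> hat" and h: "h > 0"
    and zero: "\<And>z. z \<in> cone \<Longrightarrow> eval_series (of_real (yfun z / (2 * h))) a z ((1 / of_real (yfun z)) *s cnjv z) = 0"
  shows "a K L = 0"
proof -
  have part: "hpart m a z (cnjv z) = 0" if z: "z \<in> cone" for m z
  proof -
    let ?y = "yfun z" and ?\<zeta> = "(1 / of_real (yfun z)) *s cnjv z"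
    have y: "?y > 0" using z by (simp add: cone_def)
    let ?F = "\<lambda>t. eval_series t a z ?\<zeta>"
    have pos: "?F (of_real t) = 0" if t: "t > 0" for t
    proof -
      \<comment> \<open>Scaling \<open>z\<close> by \<open>r\<close> turns \<open>y / (2 h)\<close> into \<open>t\<close>.\<close>
      define r where "r = sqrt (2 * h * t / ?y)"
      have r: "r > 0" "r\<^sup>2 = 2 * h * t / ?y" using h t y by (auto simp: r_def)
      have yr: "yfun (of_real r *s z) = 2 * h * t" using r y by (simp add: yfun_scale)
      then have "of_real r *s z \<in> cone" using h t by (simp add: cone_def)
      from zero[OF this] have "eval_series (of_real t) a (of_real r *s z) ((1 / of_real (2 * h * t)) *s (of_real r *s cnjv z)) = 0"
        using yr h by (simp add: cnjv_scale)
      also have "(1 / of_real (2 * h * t)) *s (of_real r *s cnjv z) = (1 / complex_of_real r) *s ?\<zeta>"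
      proof -
        have "complex_of_real (2 * h * t) = of_real (r\<^sup>2 * ?y)" using r y by simp
        then show ?thesis using r y by (simp add: vec_eq_iff power2_eq_square)
      qed
      finally show ?thesis using r by (subst (asm) eval_series_scale) auto
    qed
    have F0: "?F w = 0" for w
    proof (rule analytic_continuation[of ?F UNIV "of_real ` {1<..<2}" 1])
      show "?F holomorphic_on UNIV" by (intro holomorphic_eval_series[OF a] holomorphic_intros) auto
      show "(1::complex) islimpt of_real ` {1<..<2}" using islimpt_of_real_interval[of 1 1] by simp
    qed (use pos in auto)
    have "hpart m a z ?\<zeta> = 0"
    proof (induction m rule: less_induct)
      case (less m)
      have "(\<lambda>g. pochhammer (- of_nat m) g * hpart g a z ?\<zeta>) sums (pochhammer (- of_nat m) m * hpart m a z ?\<zeta>)"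
      proof -
        have "pochhammer (- of_nat m) g * hpart g a z ?\<zeta> = 0" if "g \<noteq> m" for g
          using that less.IH[of g] by (cases "g < m") (auto simp: pochhammer_of_nat_eq_0_iff)
        from sums_If_finite_set[of "{m}" "\<lambda>g. pochhammer (- of_nat m) g * hpart g a z ?\<zeta>"] this
        show ?thesis by (auto elim!: back_subst[of "\<lambda>f. f sums _"])
      qed
      moreover have "(\<lambda>g. pochhammer (- of_nat m) g * hpart g a z ?\<zeta>) sums 0"
        using eval_series_sums[OF a, of "- of_nat m" z ?\<zeta>] F0 by simp
      ultimately have "pochhammer (- of_nat m) m * hpart m a z ?\<zeta> = 0" using sums_unique2 by blast
      then show ?case by (simp add: pochhammer_of_nat_eq_0_iff)
    qed
    moreover have "hpart m a z ?\<zeta> = (1 / of_real ?y) ^ m * hpart m a z (cnjv z)"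
      using hpart_scale[of m a 1 z "1 / of_real ?y" "cnjv z"] by simp
    ultimately show ?thesis using y by simp
  qed
  show ?thesis
  proof (cases "mdeg K = mdeg L")
    case True
    let ?c = "\<lambda>K' L'. if mdeg K' = mdeg K \<and> mdeg L' = mdeg K then a K' L' else 0"
    have "?c K L = 0"
      by (rule poly_of_eq_0_imp[OF open_cone axis_in_cone, of "2 * mdeg K" ?c "2 * mdeg K"])
         (use part[of _ "mdeg K"] in \<open>auto simp: hpart_poly_of poly_of_mono_box[of "mdeg K" ?c "2 * mdeg K"] supp_box_def\<close>)
    then show ?thesis using True by simp
  qed (use hatD(1)[OF a] in \<open>auto simp: eqdeg_def\<close>)
qed

lemma eval_series_diff:
  assumes "a \<in> hat" "b \<in> hat"
  shows "eval_series x (\<lambda>K L. a K L - b K L) z \<zeta> = eval_series x a z \<zeta> - eval_series x b z \<zeta>"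
proof -
  have "hpart g (\<lambda>K L. a K L - b K L) z \<zeta> = hpart g a z \<zeta> - hpart g b z \<zeta>" for g
    by (simp add: hpart_def left_diff_distrib sum_subtractf)
  moreover have "(\<lambda>g. pochhammer x g * hpart g a z \<zeta> - pochhammer x g * hpart g b z \<zeta>) sums (eval_series x a z \<zeta> - eval_series x b z \<zeta>)"
    by (intro sums_diff eval_series_sums assms)
  ultimately show ?thesis unfolding eval_series_def by (simp add: sums_iff right_diff_distrib)
qed

text \<open>The function on the cone with the given array of coefficients.\<close>
definition fA :: "real \<Rightarrow> 'n::finite option arr \<Rightarrow> 'n fn" where
  "fA h a = f_comb h (unarr a)"

lemma fA_off_cone: "z \<notin> cone \<Longrightarrow> fA h a z = 0"
  by (simp add: fA_def f_comb_off_cone)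

lemma fA_series:
  "a \<in> hat \<Longrightarrow> z \<in> cone \<Longrightarrow>
    fA h a z = eval_series (of_real (yfun z / (2 * h))) a z ((1 / of_real (yfun z)) *s cnjv z)"
  unfolding fA_def by (simp add: f_comb_series unarr_hat arr_unarr hatD(1))

lemma fA_diff:
  assumes "a \<in> hat" "b \<in> hat"
  shows "fA h (\<lambda>K L. a K L - b K L) = (\<lambda>z. fA h a z - fA h b z)"
proof
  fix z show "fA h (\<lambda>K L. a K L - b K L) z = fA h a z - fA h b z"
    using assms by (cases "z \<in> cone") (simp_all add: fA_series hat_diff eval_series_diff fA_off_cone)
qed

lemma fA_inject:
  assumes "h > 0" "a \<in> hat" "b \<in> hat" "fA h a = fA h b"
  shows "a = b"
proof (intro ext)
  fix K L
  have "a K L - b K L = 0"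
  proof (rule eval_series_eq_0_imp[OF hat_diff[OF assms(2,3)] assms(1)])
    fix z :: "'a pt" assume z: "z \<in> cone"
    then show "eval_series (of_real (yfun z / (2 * h))) (\<lambda>K L. a K L - b K L) z ((1 / of_real (yfun z)) *s cnjv z) = 0"
      unfolding fA_series[OF hat_diff[OF assms(2,3)] z, symmetric] fA_diff[OF assms(2,3)] using assms(4) by simp
  qed
  then show "a K L = b K L" by simp
qed

lemma hat_coeffs_conv: "c \<in> hat_coeffs \<Longrightarrow> unarr (arr c) = c"
  by (rule unarr_arr) (auto simp: hat_coeffs_def)

lemma f_coeffs_fA:
  assumes "h > 0" "a \<in> hat"
  shows "f_coeffs h (fA h a) = unarr a"
  unfolding f_coeffs_def
proof (rule the_equality)
  show "unarr a \<in> hat_coeffs \<and> fA h a = f_comb h (unarr a)" using assms by (simp add: unarr_hat fA_def)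
  fix c assume c: "c \<in> hat_coeffs \<and> fA h a = f_comb h c"
  then have "fA h a = fA h (arr c)" by (simp add: fA_def[of h "arr c"] hat_coeffs_conv)
  then have "a = arr c" using c assms arr_hat fA_inject by metis
  then show "c = unarr a" using c by (simp add: hat_coeffs_conv)
qed

section \<open>The product of polynomials\<close>

text \<open>The inverse image under \<open>S_map\<close> of the function with coefficients \<open>a\<close>. The powers of \<open>2 h\<close> are the
  ones that remove the parameter from the Wick product.\<close>
definition ppoly :: "real \<Rightarrow> nat \<Rightarrow> 'n::finite option arr \<Rightarrow> 'n fn" where
  "ppoly h N a = poly_of N (\<lambda>K L. a K L / of_real ((2 * h) ^ mdeg L))"

lemma sum_metric:
  assumes "length is = r" "length js = r"
  shows "(\<Prod>k<r. metric (is ! k) (js ! k)) = (if is = js then sgnl is else 0)"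
proof (cases "is = js")
  case True
  then show ?thesis using assms
    by (simp add: sgnl_def prod.list_conv_set_nth atLeast0LessThan)
next
  case False
  then obtain k where "k < r" "is ! k \<noteq> js ! k" using assms nth_equalityI by metis
  then have "(\<Prod>k<r. metric (is ! k) (js ! k)) = 0"
    by (intro prod_zero bexI[of _ k]) (auto simp: metric_def)
  then show ?thesis using False by simp
qed

lemma supp_box_bconv:
  assumes "supp_box N c" "supp_box N d"
  shows "supp_box (2 * N) (bconv c d)"
  unfolding supp_box_def bconv_def
proof (intro allI impI sum.neutral ballI)
  fix K L R Q :: "'a \<Rightarrow> nat" assume *: "2 * N < mdeg K \<or> 2 * N < mdeg L" "R \<in> below K" "Q \<in> below L"
  have "mdeg K = mdeg (K - R) + mdeg R" "mdeg L = mdeg (L - Q) + mdeg Q"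
    using *(2,3) mdeg_mono[of R K] mdeg_mono[of Q L] by (simp_all add: mdeg_diff)
  then have "mdeg (K - R) > N \<or> mdeg R > N \<or> mdeg Q > N \<or> mdeg (L - Q) > N" using *(1) by linarith
  then have "c (K - R) Q = 0 \<or> d R (L - Q) = 0" using assms unfolding supp_box_def by metis
  then show "of_nat (mbinom K R) * of_nat (mbinom L Q) * (c (K - R) Q * d R (L - Q)) = 0" by auto
qed

lemma supp_box_star:
  assumes "supp_box N c" "supp_box N d"
  shows "supp_box (2 * N) (star c d)"
  using supp_box_bconv[OF supp_box_shl[OF assms(1)] supp_box_shr[OF assms(2)]]
  by (auto simp: supp_box_def star_def)

text \<open>Each contraction lowers the degree in the conjugate variable of the right factor by one, which
  releases a factor \<open>2 h\<close> in the denominator; it cancels the factor \<open>2 h\<close> that comes with the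
  contraction in the Wick product.\<close>
lemma wick_ppoly:
  assumes h: "h > 0" and c: "eqdeg c" "supp_box N c" and d: "eqdeg d" "supp_box N d"
  shows "wick h (ppoly h N c) (ppoly h N d) = ppoly h (2 * N) (star c d)"
proof
  fix z
  let ?q = "\<lambda>k. complex_of_real ((2 * h) ^ k)" and ?M = "2 * N"
  let ?c = "\<lambda>K L. c K L / ?q (mdeg L)" and ?d = "\<lambda>K L. d K L / ?q (mdeg L)"
  let ?B = "\<lambda>is. bconv (shl is c) (shr is d)" and ?B' = "\<lambda>is. bconv (shl is ?c) (shr is ?d)"
  have s: "supp_box N ?c" "supp_box N ?d" using c d by (auto simp: supp_box_def)
  define T where "T = (\<lambda>r K L. (1 / fact r * (\<Sum>is | length is = r. sgnl is * ?B is K L)) / ?q (mdeg L))"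
  have conv: "?B' is K L = ?B is K L / (?q (mdeg L) * ?q (length is))" for "is" K L
    unfolding bconv_def sum_divide_distrib
  proof (intro sum.cong refl)
    fix R Q assume Q: "Q \<in> below L"
    have "mdeg (addl (L - Q) is) + mdeg Q = mdeg L + length is"
      using mdeg_addl[of "L - Q" "is"] mdeg_diff[OF Q] mdeg_mono[OF Q] by simp
    then have "?q (mdeg Q) * ?q (mdeg (addl (L - Q) is)) = ?q (mdeg L) * ?q (length is)"
      by (metis add.commute power_add of_real_mult)
    then show "of_nat (mbinom K R) * of_nat (mbinom L Q) * (shl is ?c (K - R) Q * shr is ?d R (L - Q)) =
      of_nat (mbinom K R) * of_nat (mbinom L Q) * (shl is c (K - R) Q * shr is d R (L - Q)) / (?q (mdeg L) * ?q (length is))"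
      unfolding shl_def shr_def by (metis (no_types, lifting) times_divide_eq_right times_divide_times_eq)
  qed
  have inner: "of_real ((2 * h) ^ r / fact r) * (\<Sum>is | length is = r. \<Sum>js | length js = r.
        (\<Prod>k<r. metric (is ! k) (js ! k)) * foldr d_z is (ppoly h N c) z * foldr d_zbar js (ppoly h N d) z)
     = poly_of ?M (T r) z" (is "_ * ?S = _") for r
  proof -
    have "?S = (\<Sum>is | length is = r. \<Sum>js | length js = r. if js = is then
         sgnl is * (foldr d_z is (ppoly h N c) z * foldr d_zbar is (ppoly h N d) z) else 0)"
      by (intro sum.cong refl) (auto simp: sum_metric)
    also have "\<dots> = (\<Sum>is | length is = r. sgnl is * (foldr d_z is (ppoly h N c) z * foldr d_zbar is (ppoly h N d) z))"
      by (intro sum.cong refl) (subst sum.delta, auto)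
    also have "\<dots> = (\<Sum>is | length is = r. poly_of ?M (\<lambda>K L. sgnl is * ?B' is K L) z)"
      unfolding ppoly_def foldr_d_z_poly_of[OF s(1)] foldr_d_zbar_poly_of[OF s(2)]
      using poly_of_mult[OF supp_box_shl[OF s(1)] supp_box_shr[OF s(2)] order_refl]
      by (simp add: poly_of_mult_const)
    finally have "of_real ((2 * h) ^ r / fact r) * ?S =
        poly_of ?M (\<lambda>K L. of_real ((2 * h) ^ r / fact r) * (\<Sum>is | length is = r. sgnl is * ?B' is K L)) z"
      by (simp only: poly_of_sum poly_of_mult_const)
    also have "(\<lambda>K L. of_real ((2 * h) ^ r / fact r) * (\<Sum>is | length is = r. sgnl is * ?B' is K L)) = T r"
    proof (intro ext)
      fix K L
      have "(\<Sum>is | length is = r. sgnl is * ?B' is K L) = (\<Sum>is | length is = r. sgnl is * ?B is K L) / (?q (mdeg L) * ?q r)"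
        unfolding sum_divide_distrib
      proof (intro sum.cong refl)
        fix "is" :: "'a option list" assume "is \<in> {is. length is = r}"
        then have "length is = r" by simp
        then show "sgnl is * ?B' is K L = sgnl is * ?B is K L / (?q (mdeg L) * ?q r)"
          by (simp only: conv times_divide_eq_right)
      qed
      then show "of_real ((2 * h) ^ r / fact r) * (\<Sum>is | length is = r. sgnl is * ?B' is K L) = T r K L"
        using h by (simp add: T_def)
    qed
    finally show ?thesis .
  qed
  have T0: "T r K L = 0" if "r > N" for r K L
  proof -
    have "?B is K L = 0" if "length is = r" for "is"
    proof -
      have "shl is c K L = 0" for K L
        using c(2) mdeg_addl[of K "is"] \<open>r > N\<close> that unfolding supp_box_def shl_def by simp
      then show ?thesis by (simp add: bconv_def)
    qed
    then show ?thesis by (simp add: T_def)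
  qed
  have "wick h (ppoly h N c) (ppoly h N d) z = (\<Sum>r. poly_of ?M (T r) z)"
    unfolding wick_def inner ..
  also have "\<dots> = (\<Sum>r\<le>?M. poly_of ?M (T r) z)"
    by (rule suminf_finite) (auto simp: poly_of_def T0)
  also have "\<dots> = poly_of ?M (\<lambda>K L. \<Sum>r\<le>?M. T r K L) z" by (simp add: poly_of_sum)
  also have "\<dots> = ppoly h ?M (star c d) z"
    unfolding ppoly_def poly_of_def
  proof (intro sum.cong refl arg_cong2[where f = "(*)"])
    fix K L :: "'a option \<Rightarrow> nat" assume "L \<in> degbox ?M"
    then show "(\<Sum>r\<le>?M. T r K L) = star c d K L / ?q (mdeg L)"
      unfolding T_def sum_divide_distrib[symmetric]
      using star_eq_sum_upto[OF c(1) d(1), of L ?M K] by (simp add: degbox_def)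
  qed
  finally show "wick h (ppoly h N c) (ppoly h N d) z = ppoly h ?M (star c d) z" .
qed

lemma f_comb_fin:
  assumes "c \<in> fin_coeffs"
  shows "f_comb h c z = (\<Sum>T | c T \<noteq> 0. c T * f_mon h T z)"
proof -
  have "f_comb h c z = infsum (\<lambda>T. c T * f_mon h T z) {T. c T \<noteq> 0}"
    unfolding f_comb_def using assms by (intro infsum_cong_neutral) (auto simp: fin_coeffs_def)
  then show ?thesis using assms by (simp add: fin_coeffs_def)
qed

lemma ppoly_e_comb:
  assumes h: "h > 0" and a: "eqdeg a" "supp_box N a"
  obtains c where "c \<in> fin_coeffs" "e_comb c = ppoly h N a" "supp_box N (arr c)"
    "arr c = (\<lambda>K L. a K L / (of_real ((2 * h) ^ mdeg L) * of_nat (mfact K) * of_nat (mfact L)))"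
proof -
  define b where "b = (\<lambda>K L. a K L / (of_real ((2 * h) ^ mdeg L) * of_nat (mfact K) * of_nat (mfact L)))"
  have b: "eqdeg b" "supp_box N b" using a by (auto simp: b_def eqdeg_def supp_box_def)
  have ab: "arr (unarr b) = b" by (rule arr_unarr[OF b(1)])
  have "b K L * of_nat (mfact K) * of_nat (mfact L) = a K L / of_real ((2 * h) ^ mdeg L)" for K L
    using mfact_pos[of K] mfact_pos[of L] by (simp add: b_def)
  then have "e_comb (unarr b) = ppoly h N a"
    using e_comb_poly_of[OF fin_coeffs_unarr[OF b(2)], of N] b(2) by (simp add: ab ppoly_def)
  then show ?thesis
    using that[of "unarr b"] fin_coeffs_unarr[OF b(2)] b(2) unfolding ab by (simp only: b_def)
qed

lemma ppoly_in_U1_polys: "h > 0 \<Longrightarrow> eqdeg a \<Longrightarrow> supp_box N a \<Longrightarrow> ppoly h N a \<in> U1_polys"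
  by (metis U1_polys_def image_eqI ppoly_e_comb)

lemma S_map_ppoly:
  assumes h: "h > 0" and a: "eqdeg a" "supp_box N a"
  shows "S_map h (ppoly h N a) = fA h a"
proof
  fix z
  obtain c where c: "c \<in> fin_coeffs" "e_comb c = ppoly h N a" "supp_box N (arr c)"
    "arr c = (\<lambda>K L. a K L / (of_real ((2 * h) ^ mdeg L) * of_nat (mfact K) * of_nat (mfact L)))"
    using ppoly_e_comb[OF assms] by blast
  have "S_map h (ppoly h N a) z = (\<Sum>T | c T \<noteq> 0. c T * S_mon h T z)"
    unfolding S_map_def c(2)[symmetric] e_coeffs_e_comb[OF c(1)] ..
  also have "\<dots> = (\<Sum>K\<in>degbox N. \<Sum>L\<in>degbox N. arr c K L * S_mon h (tri K L) z)"
    by (rule sum_triples[OF c(1,3)])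
  also have "\<dots> = (\<Sum>K\<in>degbox N. \<Sum>L\<in>degbox N. arr (unarr a) K L * f_mon h (tri K L) z)"
  proof (intro sum.cong refl)
    fix K L show "arr c K L * S_mon h (tri K L) z = arr (unarr a) K L * f_mon h (tri K L) z"
    proof (cases "mdeg K = mdeg L")
      case True
      then show ?thesis
        unfolding c(4) arr_unarr[OF a(1)] S_mon_tri[OF True] using h mfact_pos[of K] mfact_pos[of L] by simp
    next
      case False
      then show ?thesis by (simp add: arr_def)
    qed
  qed
  also have "\<dots> = (\<Sum>T | unarr a T \<noteq> 0. unarr a T * f_mon h T z)"
    by (rule sum_triples[symmetric]) (use a in \<open>auto simp: arr_unarr fin_coeffs_unarr\<close>)
  finally show "S_map h (ppoly h N a) z = fA h a z"
    by (simp add: fA_def f_comb_fin[OF fin_coeffs_unarr[OF a(2)]])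
qed

lemma supp_box_hat:
  assumes "eqdeg a" "supp_box N a"
  shows "a \<in> hat"
proof -
  define B where "B = (\<Sum>K\<in>degbox N. \<Sum>L\<in>degbox N. norm (a K L))"
  have B: "B \<ge> 0" by (simp add: B_def sum_nonneg)
  have "bnd e B a" if "e > 0" for e
    unfolding bnd_def
  proof (intro allI)
    fix K L :: "'a \<Rightarrow> nat"
    have one: "1 \<le> (fact (mdeg K) :: real) powr e" using that by (simp add: ge_one_powr_ge_zero fact_ge_1)
    have "norm (a K L) \<le> B"
    proof (cases "K \<in> degbox N \<and> L \<in> degbox N")
      case True
      then have "norm (a K L) \<le> (\<Sum>L\<in>degbox N. norm (a K L))" by (intro member_le_sum) auto
      also have "\<dots> \<le> B" unfolding B_def using True by (intro member_le_sum) (auto intro: sum_nonneg)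
      finally show ?thesis .
    next
      case False
      then show ?thesis using assms(2) B by (auto simp: supp_box_def degbox_def not_le)
    qed
    also have "B \<le> B * fact (mdeg K) powr e" using mult_left_mono[OF one B] by simp
    finally show "norm (a K L) \<le> B * fact (mdeg K) powr e" .
  qed
  then show ?thesis using assms by (auto simp: hat_def)
qed

lemma U1_polys_ppoly:
  assumes "h > 0" "p \<in> U1_polys"
  obtains N a where "eqdeg a" "supp_box N a" "p = ppoly h N a"
proof -
  obtain c where c: "c \<in> fin_coeffs" "p = e_comb c" using assms by (auto simp: U1_polys_def)
  obtain N where N: "supp_box N (arr c)" using fin_coeffs_supp[OF c(1)] ..
  define a where "a = (\<lambda>K L. arr c K L * of_nat (mfact K) * of_nat (mfact L) * of_real ((2 * h) ^ mdeg L))"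
  have "eqdeg a" "supp_box N a" using N eqdeg_arr[of c] by (auto simp: a_def eqdeg_def supp_box_def)
  moreover have "p = ppoly h N a"
    unfolding c(2) e_comb_poly_of[OF c(1) N] ppoly_def a_def using assms by simp
  ultimately show ?thesis using that by blast
qed

text \<open>Every invariant polynomial is \<open>ppoly\<close> of an array, and the array is determined by the image of the
  polynomial, a function on the cone.\<close>
lemma inj_S_map:
  assumes h: "h > 0"
  shows "inj_on (S_map h) (U1_polys :: 'n::finite fn set)"
proof (rule inj_onI)
  fix p q :: "'n fn" assume p: "p \<in> U1_polys" and q: "q \<in> U1_polys" and eq: "S_map h p = S_map h q"
  obtain N a where a: "eqdeg a" "supp_box N a" "p = ppoly h N a" using U1_polys_ppoly[OF h p] .
  obtain M b where b: "eqdeg b" "supp_box M b" "q = ppoly h M b" using U1_polys_ppoly[OF h q] .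
  have "fA h a = fA h b" using eq a b h by (simp add: S_map_ppoly)
  then have ab: "a = b" using fA_inject[OF h] supp_box_hat a b by blast
  have mono: "ppoly h N' c = ppoly h (max N M) c" if "supp_box N' c" "N' \<le> max N M" for N' c
    using that unfolding ppoly_def by (intro ext poly_of_mono_box[symmetric]) (auto simp: supp_box_def)
  show "p = q" using a b ab mono[of N a] mono[of M a] by simp
qed

lemma prod_C_fA:
  assumes h: "h > 0" and a: "eqdeg a" "supp_box N a" and b: "eqdeg b" "supp_box N b"
  shows "prod_C h (fA h a) (fA h b) = fA h (star a b)"
proof -
  have inv: "the_inv_into U1_polys (S_map h) (fA h c) = ppoly h N c" if "eqdeg c" "supp_box N c" for c
    by (rule the_inv_into_f_eq[OF inj_S_map[OF h]]) (use that h in \<open>auto simp: S_map_ppoly ppoly_in_U1_polys\<close>)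
  show ?thesis
    unfolding prod_C_def inv[OF a] inv[OF b] wick_ppoly[OF h a b]
    by (rule S_map_ppoly[OF h star_eqdeg[OF a(1) b(1)] supp_box_star[OF a(2) b(2)]])
qed

section \<open>The product of the completion\<close>

lemma seminorm_le_iff:
  assumes "h > 0" "a \<in> hat" "0 < e" "e < 1" "\<delta> \<ge> 0"
  shows "seminorm_C h e (fA h a) \<le> \<delta> \<longleftrightarrow> bnd e \<delta> a"
proof -
  have "arr (unarr a) = a" using assms by (simp add: arr_unarr hatD(1))
  moreover have bdd: "bdd_above (weighted e (unarr a) ` triples)"
    using unarr_hat[OF assms(2)] assms by (auto simp: hat_coeffs_def)
  moreover have "(triples :: 'a triple set) \<noteq> {}"
    using tri_in_triples[of "\<lambda>_. 0" "\<lambda>_. 0"] by blast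
  ultimately show ?thesis
    unfolding seminorm_C_def f_coeffs_fA[OF assms(1,2)]
    using weighted_le_iff_bnd[of "unarr a" \<delta> e, OF unarr_off] assms(5) by (simp add: cSUP_le_iff)
qed

lemma seminorm_nonneg:
  assumes "h > 0" "a \<in> hat" "0 < e" "e < 1"
  shows "seminorm_C h e (fA h a) \<ge> 0"
proof (rule ccontr)
  assume *: "\<not> ?thesis"
  have bdd: "bdd_above (weighted e (unarr a) ` triples)"
    using unarr_hat[OF assms(2)] assms by (auto simp: hat_coeffs_def)
  have "weighted e (unarr a) (tri (\<lambda>_. 0) (\<lambda>_. 0)) \<le> seminorm_C h e (fA h a)"
    unfolding seminorm_C_def f_coeffs_fA[OF assms(1,2)]
    using tri_in_triples by (intro cSUP_upper bdd) auto
  moreover have "0 \<le> weighted e (unarr a) (tri (\<lambda>_. 0) (\<lambda>_. 0))" by (simp add: weighted_tri)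
  ultimately show False using * by linarith
qed

text \<open>Convergence of the functions is convergence of their coefficients, because a
  function determines its coefficients.\<close>
lemma tendsto_C_iff:
  assumes h: "h > 0" and X: "\<And>k. X k \<in> hat" and a: "a \<in> hat"
  shows "tendsto_C h (\<lambda>k. fA h (X k)) (fA h a) \<longleftrightarrow> aconv X a"
proof -
  let ?d = "\<lambda>k K L. X k K L - a K L"
  have d: "?d k \<in> hat" for k by (rule hat_diff[OF X a])
  have "(\<lambda>k. seminorm_C h e (\<lambda>z. fA h (X k) z - fA h a z)) \<longlonglongrightarrow> 0 \<longleftrightarrow>
     (\<forall>\<delta>>0. \<forall>\<^sub>F k in sequentially. bnd e \<delta> (?d k))" if e: "0 < e" "e < 1" for e
  proof -
    let ?s = "\<lambda>k. seminorm_C h e (fA h (?d k))"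
    have s0: "?s k \<ge> 0" for k by (rule seminorm_nonneg[OF h d e])
    have iff: "?s k \<le> \<delta> \<longleftrightarrow> bnd e \<delta> (?d k)" if "\<delta> > 0" for k \<delta>
      using seminorm_le_iff[OF h d e] that by simp
    have "?s \<longlonglongrightarrow> 0 \<longleftrightarrow> (\<forall>\<delta>>0. \<forall>\<^sub>F k in sequentially. ?s k < \<delta>)"
      using s0 by (simp add: tendsto_iff dist_norm)
    also have "\<dots> \<longleftrightarrow> (\<forall>\<delta>>0. \<forall>\<^sub>F k in sequentially. ?s k \<le> \<delta>)"
    proof (intro iffI allI impI)
      fix \<delta> :: real assume *: "\<forall>\<delta>>0. \<forall>\<^sub>F k in sequentially. ?s k \<le> \<delta>" and "\<delta> > 0"
      from *[rule_format, of "\<delta> / 2"] \<open>\<delta> > 0\<close>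
      have "\<forall>\<^sub>F k in sequentially. ?s k \<le> \<delta> / 2" by (simp only: half_gt_zero)
      then show "\<forall>\<^sub>F k in sequentially. ?s k < \<delta>" by eventually_elim (use \<open>\<delta> > 0\<close> in simp)
    next
      fix \<delta> :: real assume "\<forall>\<delta>>0. \<forall>\<^sub>F k in sequentially. ?s k < \<delta>" "\<delta> > 0"
      then have "\<forall>\<^sub>F k in sequentially. ?s k < \<delta>" by simp
      then show "\<forall>\<^sub>F k in sequentially. ?s k \<le> \<delta>" by eventually_elim simp
    qed
    also have "\<dots> \<longleftrightarrow> (\<forall>\<delta>>0. \<forall>\<^sub>F k in sequentially. bnd e \<delta> (?d k))" using iff by simp
    finally show ?thesis by (simp only: fA_diff[OF X a])
  qed
  then show ?thesis unfolding tendsto_C_def aconv_def by blast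
qed

text \<open>Truncations converge to the given array, so the polynomial elements are dense.\<close>
definition trunc :: "nat \<Rightarrow> 'i::finite arr \<Rightarrow> 'i arr" where
  "trunc N a K L = (if mdeg K \<le> N \<and> mdeg L \<le> N then a K L else 0)"

lemma supp_box_trunc: "supp_box N (trunc N a)"
  by (auto simp: supp_box_def trunc_def)

lemma eqdeg_trunc: "eqdeg a \<Longrightarrow> eqdeg (trunc N a)"
  by (auto simp: eqdeg_def trunc_def)

lemma trunc_hat: "a \<in> hat \<Longrightarrow> trunc N a \<in> hat"
  by (rule supp_box_hat[OF eqdeg_trunc[OF hatD(1)] supp_box_trunc])

lemma aconv_trunc:
  assumes a: "a \<in> hat"
  shows "aconv (\<lambda>N. trunc N a) a"
  unfolding aconv_def
proof (intro allI impI)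
  fix e \<delta> :: real assume e: "0 < e \<and> e < 1" and \<delta>: "\<delta> > 0"
  obtain B where B: "bnd (e/2) B a" using hatD(2)[OF a, of "e/2"] e by auto
  have B0: "B \<ge> 0" by (rule bnd_nonneg[OF B])
  obtain C where C: "C > 0" "\<And>g. 2 ^ g \<le> C * fact g powr (e/2)"
    using power_le_fact_powr[of "e/2" 2] e by auto
  obtain n where n: "B * C / \<delta> < 2 ^ n" using real_arch_pow[of 2 "B * C / \<delta>"] by auto
  show "\<forall>\<^sub>F N in sequentially. bnd e \<delta> (\<lambda>K L. trunc N a K L - a K L)"
    using eventually_ge_at_top[of n]
  proof eventually_elim
    case (elim N)
    have "norm (trunc N a K L - a K L) \<le> \<delta> * fact (mdeg K) powr e" for K L
    proof (cases "mdeg K \<le> N \<or> mdeg K \<noteq> mdeg L")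
      case True
      then have "trunc N a K L - a K L = 0"
        using hatD(1)[OF a] by (auto simp: trunc_def eqdeg_def)
      then show ?thesis using \<delta> by simp
    next
      case False
      let ?g = "mdeg K"
      have "B * C \<le> \<delta> * 2 ^ ?g"
      proof -
        have "(2::real) ^ n \<le> 2 ^ ?g" using False elim by (intro power_increasing) auto
        then have "B * C / \<delta> \<le> 2 ^ ?g" using n by linarith
        then show ?thesis using \<delta> by (simp add: divide_le_eq mult.commute)
      qed
      also have "\<dots> \<le> \<delta> * (C * fact ?g powr (e/2))" using C(2) \<delta> by (intro mult_left_mono) auto
      finally have "B \<le> \<delta> * fact ?g powr (e/2)" using C(1) by simp
      then have "B * fact ?g powr (e/2) \<le> \<delta> * fact ?g powr (e/2) * fact ?g powr (e/2)"
        by (intro mult_right_mono) auto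
      also have "\<dots> = \<delta> * fact ?g powr e" by (simp add: powr_add[symmetric])
      finally have "B * fact ?g powr (e/2) \<le> \<delta> * fact ?g powr e" .
      moreover have "norm (trunc N a K L - a K L) \<le> B * fact ?g powr (e/2)"
        using B[unfolded bnd_def, rule_format, of K L] False by (auto simp: trunc_def)
      ultimately show ?thesis by linarith
    qed
    then show ?case by (simp add: bnd_def)
  qed
qed

lemma aconv_unique:
  assumes "aconv X a" "aconv X b"
  shows "a = b"
proof (intro ext)
  fix K L
  have "norm (a K L - b K L) \<le> 0 + \<eta>" if \<eta>: "\<eta> > 0" for \<eta> :: real
  proof -
    define \<delta> where "\<delta> = \<eta> / (2 * fact (mdeg K) powr (1/2))"
    have \<delta>: "\<delta> > 0" using \<eta> by (simp add: \<delta>_def)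
    have "\<forall>\<^sub>F k in sequentially. bnd (1/2) \<delta> (\<lambda>K L. X k K L - a K L)"
      "\<forall>\<^sub>F k in sequentially. bnd (1/2) \<delta> (\<lambda>K L. X k K L - b K L)"
      using assms \<delta> by (auto simp: aconv_def)
    then have "\<forall>\<^sub>F k in sequentially. norm (a K L - b K L) \<le> \<eta>"
    proof eventually_elim
      case (elim k)
      have "norm (a K L - b K L) \<le> norm (X k K L - a K L) + norm (X k K L - b K L)"
        using norm_triangle_ineq4[of "X k K L - b K L" "X k K L - a K L"] by simp
      also have "\<dots> \<le> \<delta> * fact (mdeg K) powr (1/2) + \<delta> * fact (mdeg K) powr (1/2)"
        using elim unfolding bnd_def by (intro add_mono) blast+
      also have "\<dots> = \<eta>" by (simp add: \<delta>_def)
      finally show ?case .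
    qed
    then show ?thesis by simp
  qed
  then have "norm (a K L - b K L) \<le> 0" by (rule field_le_epsilon)
  then show "a K L = b K L" by simp
qed

lemma alg_C_iff: "f \<in> alg_C h \<longleftrightarrow> (\<exists>N a. eqdeg a \<and> supp_box N a \<and> f = fA h a)"
proof
  assume "f \<in> alg_C h"
  then obtain c where c: "c \<in> fin_coeffs" "f = f_comb h c" by (auto simp: alg_C_def)
  moreover obtain N where "supp_box N (arr c)" using fin_coeffs_supp[OF c(1)] ..
  moreover have "unarr (arr c) = c" using c(1) by (intro unarr_arr) (auto simp: fin_coeffs_def)
  ultimately show "\<exists>N a. eqdeg a \<and> supp_box N a \<and> f = fA h a" using eqdeg_arr[of c] by (metis fA_def)
qed (auto simp: alg_C_def fA_def fin_coeffs_unarr)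

lemma hat_C_iff: "f \<in> hat_C h \<longleftrightarrow> (\<exists>a\<in>hat. f = fA h a)"
  unfolding hat_C_def fA_def by (auto simp: unarr_hat) (metis arr_hat hat_coeffs_conv)

text \<open>The formal product is the continuous extension by \<open>aconv_star\<close>; it is the only one, as the truncations of the
  factors converge and limits are unique.\<close>
lemma hat_prod_fA:
  fixes a b :: "'n::finite option arr"
  assumes h: "h > 0" and a: "a \<in> hat" and b: "b \<in> hat"
  shows "hat_prod h (fA h a) (fA h b) = fA h (star a b)"
  unfolding hat_prod_def
proof (rule the_equality)
  have lim: "tendsto_C h (\<lambda>k. prod_C h (X k) (Y k)) (fA h (star a b))"
    if XY: "\<And>k. X k \<in> alg_C h" "\<And>k. Y k \<in> alg_C h" "tendsto_C h X (fA h a)" "tendsto_C h Y (fA h b)" for X Y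
  proof -
    have "\<forall>k. \<exists>N u. eqdeg u \<and> supp_box N u \<and> X k = fA h u" "\<forall>k. \<exists>N u. eqdeg u \<and> supp_box N u \<and> Y k = fA h u"
      using XY(1,2) alg_C_iff by blast+
    then obtain M u N v where u: "\<And>k. eqdeg (u k)" "\<And>k. supp_box (M k) (u k)" "\<And>k. X k = fA h (u k)"
      and v: "\<And>k. eqdeg (v k)" "\<And>k. supp_box (N k) (v k)" "\<And>k. Y k = fA h (v k)" by metis
    have hat: "u k \<in> hat" "v k \<in> hat" for k using u v supp_box_hat by blast+
    have "X = (\<lambda>k. fA h (u k))" "Y = (\<lambda>k. fA h (v k))" using u v by auto
    then have "aconv u a" "aconv v b"
      using XY(3,4) tendsto_C_iff[OF h hat(1) a] tendsto_C_iff[OF h hat(2) b] by auto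
    then have ac: "aconv (\<lambda>k. star (u k) (v k)) (star a b)"
      by (intro aconv_star a b hat)
    have "prod_C h (X k) (Y k) = fA h (star (u k) (v k))" for k
      unfolding u(3) v(3)
      by (rule prod_C_fA[OF h u(1) supp_box_mono[OF u(2) max.cobounded1] v(1) supp_box_mono[OF v(2) max.cobounded2]])
    then show ?thesis
      using tendsto_C_iff[of h "\<lambda>k. star (u k) (v k)" "star a b", OF h star_hat[OF hat] star_hat[OF a b]] ac by simp
  qed
  then show "fA h (star a b) \<in> hat_C h \<and> (\<forall>X Y. (\<forall>k. X k \<in> alg_C h) \<and> (\<forall>k. Y k \<in> alg_C h) \<and>
     tendsto_C h X (fA h a) \<and> tendsto_C h Y (fA h b) \<longrightarrow> tendsto_C h (\<lambda>k. prod_C h (X k) (Y k)) (fA h (star a b)))"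
    using star_hat[OF a b] hat_C_iff by blast
  fix c assume c: "c \<in> hat_C h \<and> (\<forall>X Y. (\<forall>k. X k \<in> alg_C h) \<and> (\<forall>k. Y k \<in> alg_C h) \<and>
     tendsto_C h X (fA h a) \<and> tendsto_C h Y (fA h b) \<longrightarrow> tendsto_C h (\<lambda>k. prod_C h (X k) (Y k)) c)"
  then obtain e where e: "e \<in> hat" "c = fA h e" using hat_C_iff by blast
  let ?a = "\<lambda>k. trunc k a" and ?b = "\<lambda>k. trunc k b"
  note t = trunc_hat[OF a] trunc_hat[OF b]
  have "fA h (?a k) \<in> alg_C h" "fA h (?b k) \<in> alg_C h" for k
    using alg_C_iff supp_box_trunc eqdeg_trunc hatD(1) a b by blast+
  moreover have "tendsto_C h (\<lambda>k. fA h (?a k)) (fA h a)" "tendsto_C h (\<lambda>k. fA h (?b k)) (fA h b)"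
    using aconv_trunc a b t by (simp_all add: tendsto_C_iff[OF h])
  ultimately have "tendsto_C h (\<lambda>k. prod_C h (fA h (?a k)) (fA h (?b k))) c"
    using c[THEN conjunct2, rule_format, of "\<lambda>k. fA h (?a k)" "\<lambda>k. fA h (?b k)"] by simp
  moreover have "prod_C h (fA h (?a k)) (fA h (?b k)) = fA h (star (?a k) (?b k))" for k
    by (intro prod_C_fA[OF h, of _ k] eqdeg_trunc supp_box_trunc hatD(1) a b)
  ultimately have "aconv (\<lambda>k. star (?a k) (?b k)) e"
    unfolding e(2) using tendsto_C_iff[of h "\<lambda>k. star (?a k) (?b k)" e, OF h star_hat[OF t] e(1)] by simp
  moreover have "aconv (\<lambda>k. star (?a k) (?b k)) (star a b)"
    by (intro aconv_star a b t aconv_trunc)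
  ultimately have "e = star a b" by (rule aconv_unique)
  then show "c = fA h (star a b)" using e by simp
qed

section \<open>Contractions in a pseudo-orthonormal frame\<close>

text \<open>Once the conjugate variable is fixed, a polynomial is described by a one-index array, and the derivative
  in the direction \<open>u\<close> acts on it by shifts; \<open>Dus\<close> iterates this along a word of directions.\<close>
definition Du :: "complex ^ 'i::finite \<Rightarrow> (('i \<Rightarrow> nat) \<Rightarrow> complex) \<Rightarrow> ('i \<Rightarrow> nat) \<Rightarrow> complex" where
  "Du u \<alpha> K = (\<Sum>i\<in>UNIV. u $ i * \<alpha> (inc K i))"

definition Dus :: "('k \<Rightarrow> complex ^ 'i::finite) \<Rightarrow> 'k list \<Rightarrow> (('i \<Rightarrow> nat) \<Rightarrow> complex) \<Rightarrow> ('i \<Rightarrow> nat) \<Rightarrow> complex" where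
  "Dus U ks = fold (\<lambda>k. Du (U k)) ks"

definition pval :: "nat \<Rightarrow> complex ^ 'i::finite \<Rightarrow> (('i \<Rightarrow> nat) \<Rightarrow> complex) \<Rightarrow> complex" where
  "pval N w \<alpha> = (\<Sum>K\<in>degbox N. \<alpha> K * dpow w K)"

text \<open>The one-index array in \<open>z\<close> that remains when the conjugate variable is set to \<open>\<zeta>\<close>.\<close>
definition rowsum :: "complex ^ 'i::finite \<Rightarrow> 'i arr \<Rightarrow> ('i \<Rightarrow> nat) \<Rightarrow> complex" where
  "rowsum \<zeta> c K = (\<Sum>L\<in>graded (mdeg K). c K L * dpow \<zeta> L)"

text \<open>The involution: pointwise complex conjugation on the level of coefficients.\<close>
definition dag :: "'i::finite arr \<Rightarrow> 'i arr" where
  "dag d K L = cnj (d L K)"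

definition piece :: "nat \<Rightarrow> 'i::finite arr \<Rightarrow> 'i arr" where
  "piece g a K L = (if mdeg K = g \<and> mdeg L = g then a K L else 0)"

definition hdeg :: "nat \<Rightarrow> (('i::finite \<Rightarrow> nat) \<Rightarrow> complex) \<Rightarrow> bool" where
  "hdeg m \<alpha> \<longleftrightarrow> (\<forall>K. mdeg K \<noteq> m \<longrightarrow> \<alpha> K = 0)"

definition frame :: "('n::finite option \<Rightarrow> 'n pt) \<Rightarrow> bool" where
  "frame U \<longleftrightarrow> (\<forall>i j. (\<Sum>k\<in>UNIV. metric k k * (U k $ i * cnj (U k $ j))) = metric i j)"

lemma Dus_Nil [simp]: "Dus U [] \<alpha> = \<alpha>"
  by (simp add: Dus_def)

lemma Dus_Cons [simp]: "Dus U (k # ks) \<alpha> = Dus U ks (Du (U k) \<alpha>)"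
  by (simp add: Dus_def)

lemma Dus_append: "Dus U (ks @ js) \<alpha> = Dus U js (Dus U ks \<alpha>)"
  by (simp add: Dus_def)

lemma Dus_map: "Dus U (map g ks) \<alpha> = Dus (\<lambda>k. U (g k)) ks \<alpha>"
  by (simp add: Dus_def fold_map comp_def)

lemma inc_commute: "inc (inc K i) j = inc (inc K j) i"
  by (auto simp: fun_eq_iff)

lemma Du_commute: "Du u (Du v \<alpha>) = Du v (Du u \<alpha>)"
proof
  fix K
  have "Du u (Du v \<alpha>) K = (\<Sum>i\<in>UNIV. \<Sum>j\<in>UNIV. u $ i * (v $ j * \<alpha> (inc (inc K i) j)))"
    unfolding Du_def sum_distrib_left ..
  also have "\<dots> = (\<Sum>j\<in>UNIV. \<Sum>i\<in>UNIV. v $ j * (u $ i * \<alpha> (inc (inc K j) i)))"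
    by (subst sum.swap, intro sum.cong refl) (simp only: inc_commute mult.left_commute)
  also have "\<dots> = Du v (Du u \<alpha>) K"
    unfolding Du_def sum_distrib_left ..
  finally show "Du u (Du v \<alpha>) K = Du v (Du u \<alpha>) K" .
qed

lemma Dus_mset: "mset ks = mset js \<Longrightarrow> Dus U ks = Dus U js"
proof -
  assume "mset ks = mset js"
  moreover have "Du (U x) \<circ> Du (U y) = Du (U y) \<circ> Du (U x)" for x y
    unfolding comp_def by (rule ext) (rule Du_commute)
  ultimately show "Dus U ks = Dus U js" unfolding Dus_def by (intro fold_multiset_equiv)
qed

lemma Du_axis: "Du (axis i 1) \<alpha> K = \<alpha> (inc K i)"
proof -
  have "Du (axis i 1) \<alpha> K = (\<Sum>j\<in>UNIV. if j = i then \<alpha> (inc K i) else 0)"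
    unfolding Du_def by (rule sum.cong) (auto simp: axis_def)
  then show ?thesis by simp
qed

lemma Dus_axis: "Dus (\<lambda>i. axis i 1) is \<alpha> K = \<alpha> (addl K is)"
proof (induction "is" arbitrary: \<alpha> K)
  case (Cons i "is")
  have "inc (addl K is) i = addl K (i # is)" by (auto simp: fun_eq_iff)
  then show ?case by (simp add: Cons Du_axis del: count_list.simps)
qed simp

lemma pval_lin: "pval N w (\<lambda>K. \<Sum>i\<in>S. c i * a i K) = (\<Sum>i\<in>S. c i * pval N w (a i))"
  unfolding pval_def sum_distrib_right sum_distrib_left
  by (subst sum.swap) (simp add: mult_ac)

text \<open>The contraction of order \<open>r\<close> with the inverse metric, written in the frame \<open>U\<close> and evaluated at \<open>w\<close>.
  The second factor enters through its conjugate, so that only derivatives in \<open>z\<close> occur.\<close>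
definition contraction :: "nat \<Rightarrow> 'n::finite pt \<Rightarrow> ('n option \<Rightarrow> 'n pt) \<Rightarrow> nat \<Rightarrow> (('n option \<Rightarrow> nat) \<Rightarrow> complex) \<Rightarrow> (('n option \<Rightarrow> nat) \<Rightarrow> complex) \<Rightarrow> complex" where
  "contraction N w U r \<alpha> \<beta> = (\<Sum>ks | length ks = r. sgnl ks * (pval N w (Dus U ks \<alpha>) * cnj (pval N w (Dus U ks \<beta>))))"

lemma sgnl_Cons: "sgnl (k # ks) = metric k k * sgnl ks"
  by (simp add: sgnl_def)

lemma contraction_Suc:
  "contraction N w U (Suc r) \<alpha> \<beta> = (\<Sum>k\<in>UNIV. metric k k * contraction N w U r (Du (U k) \<alpha>) (Du (U k) \<beta>))"
  unfolding contraction_def sum_lists_Suc by (simp add: sgnl_Cons sum_distrib_left mult_ac)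

lemma contraction_axis_Du:
  "contraction N w (\<lambda>i. axis i 1) r (Du u \<alpha>) (Du u \<beta>) =
    (\<Sum>i\<in>UNIV. \<Sum>j\<in>UNIV. u $ i * cnj (u $ j) *
      contraction N w (\<lambda>i. axis i 1) r (Du (axis i 1) \<alpha>) (Du (axis j 1) \<beta>))"
proof -
  let ?e = "\<lambda>i :: 'a option. axis i (1::complex)"
  let ?v = "\<lambda>ks i \<alpha>. pval N w (Dus ?e ks (Du (?e i) \<alpha>))"
  have lin: "pval N w (Dus ?e ks (Du u \<alpha>)) = (\<Sum>i\<in>UNIV. u $ i * ?v ks i \<alpha>)" for ks \<alpha>
  proof -
    have "Dus ?e ks (Du u \<alpha>) = (\<lambda>K. \<Sum>i\<in>UNIV. u $ i * Dus ?e ks (Du (?e i) \<alpha>) K)"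
      by (simp add: fun_eq_iff Dus_axis Du_axis) (simp add: Du_def)
    then show ?thesis by (simp add: pval_lin)
  qed
  have "contraction N w ?e r (Du u \<alpha>) (Du u \<beta>) =
     (\<Sum>ks | length ks = r. \<Sum>i\<in>UNIV. \<Sum>j\<in>UNIV. sgnl ks * ((u $ i * ?v ks i \<alpha>) * cnj (u $ j * ?v ks j \<beta>)))"
    unfolding contraction_def lin cnj_sum unfolding sum_product unfolding sum_distrib_left ..
  also have "\<dots> = (\<Sum>i\<in>UNIV. \<Sum>j\<in>UNIV. \<Sum>ks | length ks = r. sgnl ks * ((u $ i * ?v ks i \<alpha>) * cnj (u $ j * ?v ks j \<beta>)))"
    by (rule sum_rotate[symmetric])
  finally show ?thesis unfolding contraction_def sum_distrib_left by (simp add: mult_ac)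
qed

text \<open>The contraction only depends on the inverse metric, not on the frame in which it is
  written.\<close>
lemma contraction_frame:
  assumes "frame U"
  shows "contraction N w U r \<alpha> \<beta> = contraction N w (\<lambda>i. axis i 1) r \<alpha> \<beta>"
proof (induction r arbitrary: \<alpha> \<beta>)
  case (Suc r)
  let ?C = "\<lambda>i j. contraction N w (\<lambda>i. axis i 1) r (Du (axis i 1) \<alpha>) (Du (axis j 1) \<beta>)"
  have "contraction N w U (Suc r) \<alpha> \<beta> =
      (\<Sum>k\<in>UNIV. \<Sum>i\<in>UNIV. \<Sum>j\<in>UNIV. metric k k * (U k $ i * cnj (U k $ j)) * ?C i j)"
    by (simp add: contraction_Suc Suc contraction_axis_Du sum_distrib_left mult_ac)
  also have "\<dots> = (\<Sum>i\<in>UNIV. \<Sum>j\<in>UNIV. \<Sum>k\<in>UNIV. metric k k * (U k $ i * cnj (U k $ j)) * ?C i j)"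
    by (rule sum_rotate[symmetric])
  also have "\<dots> = (\<Sum>i\<in>UNIV. \<Sum>j\<in>UNIV. metric i j * ?C i j)"
    using assms unfolding frame_def by (simp flip: sum_distrib_right)
  also have "\<dots> = (\<Sum>i\<in>UNIV. \<Sum>j\<in>UNIV. if j = i then metric i i * ?C i i else 0)"
    by (intro sum.cong refl) (auto simp: metric_def)
  also have "\<dots> = (\<Sum>i\<in>UNIV. metric i i * ?C i i)" by simp
  finally show ?case by (simp add: contraction_Suc)
qed (simp add: contraction_def)

text \<open>A summand that is invariant under permutations only sees which letters of the word are
  \<open>None\<close> by their number; the binomial coefficient counts their positions.\<close>
lemma sum_option_lists:
  fixes f :: "'n::finite option list \<Rightarrow> complex"
  assumes "\<And>xs ys. mset xs = mset ys \<Longrightarrow> f xs = f ys"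
  shows "(\<Sum>ks | length ks = r. f ks) =
    (\<Sum>s\<le>r. of_nat (r choose s) * (\<Sum>js | length js = s. f (map Some js @ replicate (r - s) None)))"
  using assms
proof (induction r arbitrary: f)
  case (Suc r)
  define T where "T s = (\<Sum>js | length js = s. f (map Some js @ replicate (Suc r - s) None))" for s
  have "(\<Sum>ks | length ks = r. f (None # ks)) = (\<Sum>s\<le>r. of_nat (r choose s) * T s)"
  proof -
    have "(\<Sum>ks | length ks = r. f (None # ks)) = (\<Sum>s\<le>r. of_nat (r choose s) * (\<Sum>js | length js = s. f (None # (map Some js @ replicate (r - s) None))))"
      by (rule Suc.IH) (auto intro: Suc.prems)
    also have "\<dots> = (\<Sum>s\<le>r. of_nat (r choose s) * T s)"
      unfolding T_def by (intro sum.cong refl arg_cong2[where f = "(*)"] Suc.prems) (simp add: Suc_diff_le)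
    finally show ?thesis .
  qed
  moreover have "(\<Sum>i\<in>UNIV. \<Sum>ks | length ks = r. f (Some i # ks)) = (\<Sum>s\<le>r. of_nat (r choose s) * T (Suc s))"
  proof -
    have "(\<Sum>i\<in>UNIV. \<Sum>ks | length ks = r. f (Some i # ks)) =
       (\<Sum>i\<in>UNIV. \<Sum>s\<le>r. of_nat (r choose s) * (\<Sum>js | length js = s. f (Some i # (map Some js @ replicate (r - s) None))))"
      by (intro sum.cong refl Suc.IH) (auto intro: Suc.prems)
    also have "\<dots> = (\<Sum>s\<le>r. \<Sum>i\<in>UNIV. of_nat (r choose s) * (\<Sum>js | length js = s. f (Some i # (map Some js @ replicate (r - s) None))))"
      by (rule sum.swap)
    also have "\<dots> = (\<Sum>s\<le>r. of_nat (r choose s) * T (Suc s))"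
      unfolding T_def sum_lists_Suc by (simp add: sum_distrib_left)
    finally show ?thesis .
  qed
  ultimately have "(\<Sum>ks | length ks = Suc r. f ks) = (\<Sum>s\<le>r. of_nat (r choose s) * T s) + (\<Sum>s\<le>r. of_nat (r choose s) * T (Suc s))"
    unfolding sum_lists_Suc sum_option by simp
  also have "(\<Sum>s\<le>r. of_nat (r choose s) * T s) = T 0 + (\<Sum>s\<le>r. of_nat (r choose Suc s) * T (Suc s))"
  proof -
    have "(\<Sum>s\<le>r. of_nat (r choose s) * T s) = (\<Sum>s\<le>Suc r. of_nat (r choose s) * T s)"
      unfolding sum.atMost_Suc by (simp add: binomial_eq_0)
    then show ?thesis unfolding sum.atMost_Suc_shift by simp
  qed
  also have "T 0 + (\<Sum>s\<le>r. of_nat (r choose Suc s) * T (Suc s)) + (\<Sum>s\<le>r. of_nat (r choose s) * T (Suc s)) =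
     T 0 + (\<Sum>s\<le>r. of_nat (Suc r choose Suc s) * T (Suc s))"
    by (simp add: sum.distrib[symmetric] algebra_simps)
  also have "\<dots> = (\<Sum>s\<le>Suc r. of_nat (Suc r choose s) * T s)"
    unfolding sum.atMost_Suc_shift by simp
  finally show ?case unfolding T_def .
next
  case 0
  show ?case by simp
qed

subsection \<open>Euler's identity\<close>

lemma Du_hdeg: "hdeg m \<alpha> \<Longrightarrow> hdeg (m - 1) (Du u \<alpha>)"
  by (auto simp: hdeg_def Du_def intro!: sum.neutral)

lemma Du_hdeg_0: "hdeg 0 \<alpha> \<Longrightarrow> Du u \<alpha> = (\<lambda>_. 0)"
  by (auto simp: hdeg_def Du_def intro!: sum.neutral)

lemma Du_zero: "Du u (\<lambda>_. 0) = (\<lambda>_. 0)"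
  by (simp add: Du_def fun_eq_iff)

lemma Dus_zero: "Dus U ks (\<lambda>_. 0) = (\<lambda>_. 0)"
  by (induction ks) (simp_all add: Du_zero)

lemma Dus_hdeg: "hdeg m \<alpha> \<Longrightarrow> hdeg (m - length ks) (Dus U ks \<alpha>)"
proof (induction ks arbitrary: m \<alpha>)
  case (Cons k ks)
  then show ?case using Cons.IH[OF Du_hdeg[OF Cons.prems]] by simp
qed simp

lemma Dus_hdeg_0: "hdeg m \<alpha> \<Longrightarrow> length ks > m \<Longrightarrow> Dus U ks \<alpha> = (\<lambda>_. 0)"
proof (induction ks arbitrary: m \<alpha>)
  case (Cons k ks)
  show ?case
  proof (cases m)
    case 0
    then show ?thesis using Cons.prems by (simp add: Du_hdeg_0 Dus_zero)
  next
    case (Suc m')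
    then show ?thesis using Cons.IH[of m' "Du (U k) \<alpha>"] Cons.prems Du_hdeg[of m \<alpha> "U k"] by simp
  qed
qed simp

text \<open>Euler's identity: the derivative of a homogeneous polynomial in the direction of the point itself.\<close>
lemma pval_Du_self:
  assumes "hdeg m \<alpha>" "m \<le> N"
  shows "pval N w (Du w \<alpha>) = of_nat m * pval N w \<alpha>"
proof -
  have vanish: "\<alpha> K = 0" if "mdeg K > N" for K using assms that by (auto simp: hdeg_def)
  have self: "w $ i * dpow' w K i = of_nat (K i) * dpow w K" for K i
    by (cases "K i") (simp_all add: dpow'_eq dpow_split[of w K i])
  have "pval N w (Du w \<alpha>) = (\<Sum>i\<in>UNIV. w $ i * (\<Sum>K\<in>degbox N. \<alpha> (inc K i) * dpow w K))"
    unfolding pval_def Du_def sum_distrib_left sum_distrib_right by (subst sum.swap) (simp add: mult_ac)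
  also have "\<dots> = (\<Sum>i\<in>UNIV. w $ i * (\<Sum>K\<in>degbox N. \<alpha> K * dpow' w K i))"
    by (simp add: sum_dpow'_shift[OF vanish])
  also have "\<dots> = (\<Sum>K\<in>degbox N. \<Sum>i\<in>UNIV. \<alpha> K * (w $ i * dpow' w K i))"
    unfolding sum_distrib_left by (subst sum.swap) (simp add: mult_ac)
  also have "\<dots> = (\<Sum>K\<in>degbox N. of_nat m * (\<alpha> K * dpow w K))"
  proof (intro sum.cong refl)
    fix K
    have "(\<Sum>i\<in>UNIV. \<alpha> K * (w $ i * dpow' w K i)) = \<alpha> K * of_nat (mdeg K) * dpow w K"
      unfolding self by (simp add: mdeg_def sum_distrib_left sum_distrib_right mult_ac)
    then show "(\<Sum>i\<in>UNIV. \<alpha> K * (w $ i * dpow' w K i)) = of_nat m * (\<alpha> K * dpow w K)"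
      using assms(1) by (cases "mdeg K = m") (auto simp: hdeg_def)
  qed
  finally show ?thesis by (simp add: pval_def sum_distrib_left)
qed

lemma pval_Dus_replicate:
  assumes "hdeg m \<alpha>" "m \<le> N" "U k = w"
  shows "pval N w (Dus U (replicate j k) \<alpha>) = of_nat (fact j * (m choose j)) * pval N w \<alpha>"
  using assms(1,2)
proof (induction j arbitrary: m \<alpha>)
  case (Suc j)
  show ?case
  proof (cases m)
    case 0
    then show ?thesis using Suc.prems assms(3) by (simp add: Du_hdeg_0 Dus_zero pval_def)
  next
    case (Suc m')
    have "pval N w (Dus U (replicate (Suc j) k) \<alpha>) = of_nat (fact j * (m' choose j)) * pval N w (Du w \<alpha>)"
      using Suc.IH[of m' "Du w \<alpha>"] Suc.prems Du_hdeg[of m \<alpha> w] Suc assms(3) by simp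
    also have "\<dots> = of_nat (fact j * (m' choose j) * m) * pval N w \<alpha>"
      by (simp add: pval_Du_self[OF Suc.prems])
    also have "fact j * (m' choose j) * m = fact (Suc j) * (m choose Suc j)"
      using Suc_times_binomial_eq[of m' j] Suc by (simp add: algebra_simps)
    finally show ?thesis .
  qed
qed simp

lemma sgnl_split: "sgnl (map Some js @ replicate j None) = (-1) ^ j"
  by (induction js) (simp_all add: sgnl_def metric_def)

text \<open>The frame vector with index \<open>None\<close> is \<open>w\<close>. By Euler's identity \<open>r - s\<close> derivatives along \<open>w\<close> give a
  falling factorial in each factor, with the sign of the negative direction.\<close>
lemma contraction_split:
  fixes U :: "'n::finite option \<Rightarrow> 'n pt"
  assumes U: "U None = w" and \<alpha>: "hdeg m \<alpha>" "m \<le> N" and \<beta>: "hdeg n \<beta>" "n \<le> N"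
  shows "contraction N w U r \<alpha> \<beta> = (\<Sum>s\<le>r. of_nat (r choose s) * ((-1) ^ (r - s) *
     of_nat (fact (r - s) * ((m - s) choose (r - s))) * of_nat (fact (r - s) * ((n - s) choose (r - s)))) *
     (\<Sum>js | length js = s. pval N w (Dus (\<lambda>k. U (Some k)) js \<alpha>) * cnj (pval N w (Dus (\<lambda>k. U (Some k)) js \<beta>))))"
proof -
  let ?V = "\<lambda>k. U (Some k)"
  let ?t = "\<lambda>ks. sgnl ks * (pval N w (Dus U ks \<alpha>) * cnj (pval N w (Dus U ks \<beta>)))"
  let ?e = "\<lambda>l s. of_nat (fact (r - s) * ((l - s) choose (r - s))) :: complex"
  have "contraction N w U r \<alpha> \<beta> = (\<Sum>s\<le>r. of_nat (r choose s) *
     (\<Sum>js | length js = s. ?t (map Some js @ replicate (r - s) None)))"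
    unfolding contraction_def
  proof (rule sum_option_lists)
    fix xs ys :: "'n option list" assume "mset xs = mset ys"
    then show "?t xs = ?t ys"
      unfolding sgnl_def using Dus_mset[of xs ys U] by (metis (mono_tags) mset_map prod_mset_prod_list)
  qed
  also have "\<dots> = (\<Sum>s\<le>r. of_nat (r choose s) * ((-1) ^ (r - s) * ?e m s * ?e n s) *
     (\<Sum>js | length js = s. pval N w (Dus ?V js \<alpha>) * cnj (pval N w (Dus ?V js \<beta>))))"
  proof (rule sum.cong[OF refl])
    fix s
    have *: "pval N w (Dus U (map Some js @ replicate (r - s) None) \<gamma>) = ?e l s * pval N w (Dus ?V js \<gamma>)"
      if "length js = s" "hdeg l \<gamma>" "l \<le> N" for js l \<gamma>
      unfolding Dus_append Dus_map
      by (rule pval_Dus_replicate[where U = U and k = None and w = w, OF _ _ U])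
         (use that Dus_hdeg[OF that(2), of js ?V] in auto)
    have "(\<Sum>js | length js = s. ?t (map Some js @ replicate (r - s) None)) = (\<Sum>js | length js = s.
       ((-1) ^ (r - s) * ?e m s * ?e n s) * (pval N w (Dus ?V js \<alpha>) * cnj (pval N w (Dus ?V js \<beta>))))"
    proof (rule sum.cong[OF refl])
      fix js :: "'n list" assume "js \<in> {js. length js = s}"
      then have l: "length js = s" by simp
      show "?t (map Some js @ replicate (r - s) None) =
         ((-1) ^ (r - s) * ?e m s * ?e n s) * (pval N w (Dus ?V js \<alpha>) * cnj (pval N w (Dus ?V js \<beta>)))"
        unfolding *[OF l \<alpha>] *[OF l \<beta>] sgnl_split by simp
    qed
    then show "of_nat (r choose s) * (\<Sum>js | length js = s. ?t (map Some js @ replicate (r - s) None)) =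
      of_nat (r choose s) * ((-1) ^ (r - s) * ?e m s * ?e n s) *
      (\<Sum>js | length js = s. pval N w (Dus ?V js \<alpha>) * cnj (pval N w (Dus ?V js \<beta>)))"
      by (simp only: sum_distrib_left mult.assoc)
  qed
  finally show ?thesis .
qed

text \<open>Induction on \<open>m\<close> by Pascal's rule for \<open>m choose j\<close>: both resulting sums have the same shape with \<open>y + 1\<close> in
  place of \<open>y\<close>, once with \<open>n\<close> and once with \<open>n - 1\<close>.\<close>
lemma pochhammer_vandermonde:
  assumes "m \<le> J"
  shows "(\<Sum>j\<le>J. (-1) ^ j * of_nat (fact j * (m choose j) * (n choose j)) * pochhammer (y::complex) (m + n - j)) =
    pochhammer y m * pochhammer y n"
proof -
  have "(\<Sum>j\<le>m. (-1) ^ j * of_nat (fact j * (m choose j) * (n choose j)) * pochhammer (y::complex) (m + n - j)) =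
    pochhammer y m * pochhammer y n" for m n y
  proof (induction m arbitrary: n y)
    case (Suc m)
    define S where "S m n y = (\<Sum>j\<le>m. (-1) ^ j * of_nat (fact j * (m choose j) * (n choose j)) * pochhammer (y::complex) (m + n - j))" for m n y
    have IH: "S m n y = pochhammer y m * pochhammer y n" for n y unfolding S_def by (rule Suc.IH)
    let ?t = "\<lambda>j. (-1) ^ j * of_nat (fact j * (m choose j) * (n choose j)) * pochhammer y (Suc m + n - j)"
    let ?u = "\<lambda>j. (-1) ^ Suc j * of_nat (fact (Suc j) * (m choose j) * (n choose Suc j)) * pochhammer y (m + n - j)"
    have "S (Suc m) n y = pochhammer y (Suc m + n) + (\<Sum>j\<le>m. (-1) ^ Suc j * of_nat (fact (Suc j) * (Suc m choose Suc j) * (n choose Suc j)) * pochhammer y (m + n - j))"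
      unfolding S_def by (subst sum.atMost_Suc_shift) simp
    also have "\<dots> = (pochhammer y (Suc m + n) + (\<Sum>j\<le>m. ?t (Suc j))) + (\<Sum>j\<le>m. ?u j)"
      by (simp add: sum.distrib[symmetric] algebra_simps del: fact_Suc pochhammer_Suc)
    also have "pochhammer y (Suc m + n) + (\<Sum>j\<le>m. ?t (Suc j)) = (\<Sum>j\<le>m. ?t j)"
    proof -
      have "(\<Sum>j\<le>m. ?t j) = (\<Sum>j\<le>Suc m. ?t j)"
        unfolding sum.atMost_Suc by (simp add: binomial_eq_0)
      then show ?thesis unfolding sum.atMost_Suc_shift by simp
    qed
    also have "(\<Sum>j\<le>m. ?t j) = y * S m n (y + 1)"
      unfolding S_def sum_distrib_left
      by (intro sum.cong refl) (simp add: pochhammer_rec Suc_diff_le)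
    also have "(\<Sum>j\<le>m. ?u j) = - (of_nat n * y * S m (n - 1) (y + 1))"
    proof (cases n)
      case (Suc n')
      have "?u j = - (of_nat n * y) * ((-1) ^ j * of_nat (fact j * (m choose j) * (n' choose j)) * pochhammer (y + 1) (m + n' - j))" if "j \<le> m" for j
      proof -
        have "fact (Suc j) * (m choose j) * (n choose Suc j) = n * (fact j * (m choose j) * (n' choose j))"
        proof -
          have "fact (Suc j) * (m choose j) * (n choose Suc j) = (fact j * (m choose j)) * ((n choose Suc j) * Suc j)"
            by (simp only: fact_Suc of_nat_id mult_ac)
          also have "(n choose Suc j) * Suc j = n * (n' choose j)"
            using Suc_times_binomial_eq[of n' j] Suc by simp
          finally show ?thesis by (simp only: mult_ac)
        qed
        then have e: "(of_nat (fact (Suc j) * (m choose j) * (n choose Suc j)) :: complex) = of_nat n * of_nat (fact j * (m choose j) * (n' choose j))"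
          by (metis of_nat_mult)
        have "pochhammer y (m + n - j) = y * pochhammer (y + 1) (m + n' - j)"
          using that Suc by (simp add: pochhammer_rec Suc_diff_le)
        then show ?thesis unfolding e by simp
      qed
      then have "(\<Sum>j\<le>m. ?u j) = (\<Sum>j\<le>m. - (of_nat n * y) * ((-1) ^ j * of_nat (fact j * (m choose j) * (n' choose j)) * pochhammer (y + 1) (m + n' - j)))"
        by (intro sum.cong refl) auto
      also have "\<dots> = - (of_nat n * y) * S m n' (y + 1)"
        unfolding S_def by (rule sum_distrib_left[symmetric])
      finally show ?thesis using Suc by simp
    qed simp
    also have "y * S m n (y + 1) + - (of_nat n * y * S m (n - 1) (y + 1)) = pochhammer y (Suc m) * pochhammer y n"
    proof (cases n)
      case (Suc n')
      have "y * S m n (y + 1) + - (of_nat n * y * S m n' (y + 1)) =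
        pochhammer y (Suc m) * (pochhammer (y + 1) n' * y)"
        unfolding IH Suc pochhammer_rec[of y m] pochhammer_Suc[of "y + 1" n'] by (simp add: algebra_simps)
      then show ?thesis using Suc by (simp add: pochhammer_rec[of y n'] mult.commute)
    qed (simp add: IH pochhammer_rec[of y])
    finally show ?case unfolding S_def .
  qed simp
  moreover have "(\<Sum>j\<le>J. (-1) ^ j * of_nat (fact j * (m choose j) * (n choose j)) * pochhammer (y::complex) (m + n - j)) =
     (\<Sum>j\<le>m. (-1) ^ j * of_nat (fact j * (m choose j) * (n choose j)) * pochhammer (y::complex) (m + n - j))"
    by (rule sum.mono_neutral_right) (use assms in auto)
  ultimately show ?thesis by simp
qed

section \<open>Evaluation of a product of polynomials\<close>

lemma sum_degbox_graded: "(\<Sum>K\<in>degbox M. F K) = (\<Sum>g\<le>M. \<Sum>K\<in>graded g. F K)"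
proof -
  have "(\<Sum>K\<in>degbox M. F K) = (\<Sum>g\<le>M. \<Sum>K\<in>{K \<in> degbox M. mdeg K = g}. F K)"
    by (rule sum.group[symmetric]) (auto simp: degbox_def)
  also have "\<dots> = (\<Sum>g\<le>M. \<Sum>K\<in>graded g. F K)"
    by (intro sum.cong refl) (auto simp: degbox_def graded_def)
  finally show ?thesis .
qed

lemma eval_series_poly:
  assumes "eqdeg e" "supp_box M e"
  shows "eval_series x e z (cnjv z) = poly_of M (\<lambda>K L. pochhammer x (mdeg K) * e K L) z"
proof -
  have "eval_series x e z (cnjv z) = (\<Sum>g\<le>M. pochhammer x g * hpart g e z (cnjv z))"
    unfolding eval_series_def
    by (rule suminf_finite) (use assms in \<open>auto simp: hpart_def graded_def supp_box_def\<close>)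
  also have "\<dots> = (\<Sum>g\<le>M. \<Sum>K\<in>graded g. \<Sum>L\<in>degbox M. pochhammer x (mdeg K) * e K L * dpow z K * dpow (cnjv z) L)"
  proof (intro sum.cong refl)
    fix g assume g: "g \<in> {..M}"
    have *: "(\<Sum>L\<in>graded g. e K L * dpow z K * dpow (cnjv z) L) = (\<Sum>L\<in>degbox M. e K L * dpow z K * dpow (cnjv z) L)"
      if "K \<in> graded g" for K
      by (rule sum.mono_neutral_left) (use assms(1) g that in \<open>auto simp: graded_def degbox_def eqdeg_def\<close>)
    have "hpart g e z (cnjv z) = (\<Sum>K\<in>graded g. \<Sum>L\<in>degbox M. e K L * dpow z K * dpow (cnjv z) L)"
      unfolding hpart_def by (rule sum.cong[OF refl *])
    then show "pochhammer x g * hpart g e z (cnjv z) = (\<Sum>K\<in>graded g. \<Sum>L\<in>degbox M. pochhammer x (mdeg K) * e K L * dpow z K * dpow (cnjv z) L)"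
      by (simp only: sum_distrib_left) (intro sum.cong refl, simp add: graded_def mult.assoc)
  qed
  also have "\<dots> = poly_of M (\<lambda>K L. pochhammer x (mdeg K) * e K L) z"
    by (simp add: poly_of_def sum_degbox_graded[of _ M])
  finally show ?thesis .
qed

definition bideg :: "nat \<Rightarrow> 'i::finite arr \<Rightarrow> bool" where
  "bideg g c \<longleftrightarrow> (\<forall>K L. mdeg K \<noteq> g \<or> mdeg L \<noteq> g \<longrightarrow> c K L = 0)"

lemma bideg_piece: "bideg g (piece g a)"
  by (simp add: bideg_def piece_def)

lemma bideg_eqdeg: "bideg g c \<Longrightarrow> eqdeg c"
  unfolding bideg_def eqdeg_def by metis

lemma bideg_supp_box: "bideg g c \<Longrightarrow> g \<le> N \<Longrightarrow> supp_box N c"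
  unfolding bideg_def supp_box_def by (metis not_le)

lemma bideg_dag: "bideg g c \<Longrightarrow> bideg g (dag c)"
  unfolding bideg_def dag_def by (metis complex_cnj_zero)

lemma hdeg_rowsum: "bideg g c \<Longrightarrow> hdeg g (rowsum \<zeta> c)"
  by (simp add: bideg_def hdeg_def rowsum_def)

lemma poly_of_shl:
  assumes "eqdeg c" "supp_box N c"
  shows "poly_of N (shl is c) w = pval N w (Dus (\<lambda>i. axis i 1) is (rowsum (cnjv w) c))"
proof -
  have "(\<Sum>L\<in>degbox N. c K L * dpow (cnjv w) L) = rowsum (cnjv w) c K" for K
  proof (cases "mdeg K \<le> N")
    case True
    then show ?thesis
      unfolding rowsum_def by (intro sum.mono_neutral_right) (use assms(1) in \<open>auto simp: degbox_def graded_def eqdeg_def\<close>)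
  next
    case False
    then have "c K L = 0" for L using assms(2) by (simp add: supp_box_def)
    then show ?thesis by (simp add: rowsum_def)
  qed
  note * = this[symmetric]
  show ?thesis
    unfolding poly_of_def pval_def Dus_axis shl_def *
    unfolding sum_distrib_right by (intro sum.cong refl) (simp only: mult_ac)
qed

lemma cnj_poly_of: "cnj (poly_of N c w) = poly_of N (dag c) w"
proof -
  have "cnj (poly_of N c w) = (\<Sum>K\<in>degbox N. \<Sum>L\<in>degbox N. dag c L K * dpow w L * dpow (cnjv w) K)"
    unfolding poly_of_def cnj_sum by (simp add: dag_def dpow_cnjv mult_ac)
  also have "\<dots> = poly_of N (dag c) w" unfolding poly_of_def by (rule sum.swap)
  finally show ?thesis .
qed

lemma poly_of_shr: "poly_of N (shr is d) w = cnj (poly_of N (shl is (dag d)) w)"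
proof -
  have "shr is d = dag (shl is (dag d))" by (simp add: fun_eq_iff shr_def shl_def dag_def)
  then show ?thesis by (simp only: cnj_poly_of)
qed

lemma bconv_bideg:
  assumes "bideg A c" "bideg B d" "mdeg K \<noteq> A + B - length is"
  shows "bconv (shl is c) (shr is d) K L = 0"
  unfolding bconv_def
proof (intro sum.neutral ballI)
  fix R Q assume RQ: "R \<in> below K" "Q \<in> below L"
  have "c (addl (K - R) is) Q * d R (addl (L - Q) is) = 0"
  proof (rule ccontr)
    assume nz: "\<not> ?thesis"
    note * = eqdeg_term_zero[OF bideg_eqdeg[OF assms(1)] bideg_eqdeg[OF assms(2)] RQ nz]
    have "mdeg Q = A" "mdeg R = B" using nz assms(1,2) unfolding bideg_def by (metis mult_eq_0_iff)+
    then show False using * assms(3) by simp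
  qed
  then show "of_nat (mbinom K R) * of_nat (mbinom L Q) * (shl is c (K - R) Q * shr is d R (L - Q)) = 0"
    by (simp add: shl_def shr_def)
qed

lemma eval_star_contraction:
  assumes c: "bideg A c" "A \<le> N" and d: "bideg B d" "B \<le> N"
  shows "eval_series x (star c d) w (cnjv w) = (\<Sum>r\<le>2 * N. pochhammer x (A + B - r) / fact r *
    contraction N w (\<lambda>i. axis i 1) r (rowsum (cnjv w) c) (rowsum (cnjv w) (dag d)))"
proof -
  let ?M = "2 * N" and ?p = "\<lambda>r. pochhammer x (A + B - r) / fact r"
  let ?b = "\<lambda>r K L. \<Sum>is | length is = r. sgnl is * bconv (shl is c) (shr is d) K L"
  note cs = bideg_eqdeg[OF c(1)] bideg_supp_box[OF c] and ds = bideg_eqdeg[OF d(1)] bideg_supp_box[OF d]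
  have "eval_series x (star c d) w (cnjv w) = poly_of ?M (\<lambda>K L. pochhammer x (mdeg K) * star c d K L) w"
    by (rule eval_series_poly[OF star_eqdeg[OF cs(1) ds(1)] supp_box_star[OF cs(2) ds(2)]])
  also have "\<dots> = poly_of ?M (\<lambda>K L. \<Sum>r\<le>?M. ?p r * ?b r K L) w"
    unfolding poly_of_def
  proof (intro sum.cong refl arg_cong2[where f = "(*)"])
    fix K L :: "'a option \<Rightarrow> nat" assume "L \<in> degbox ?M"
    then have "star c d K L = (\<Sum>r\<le>?M. 1 / fact r * ?b r K L)"
      using star_eq_sum_upto[OF cs(1) ds(1), of L ?M K] by (simp add: degbox_def)
    then have "pochhammer x (mdeg K) * star c d K L = (\<Sum>r\<le>?M. (pochhammer x (mdeg K) / fact r) * ?b r K L)"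
      by (simp add: sum_distrib_left)
    also have "\<dots> = (\<Sum>r\<le>?M. ?p r * ?b r K L)"
    proof (intro sum.cong refl)
      fix r
      show "(pochhammer x (mdeg K) / fact r) * ?b r K L = ?p r * ?b r K L"
      proof (cases "mdeg K = A + B - r")
        case False
        then have "?b r K L = 0" using bconv_bideg[OF c(1) d(1)] by (intro sum.neutral) auto
        then show ?thesis by simp
      qed simp
    qed
    finally show "pochhammer x (mdeg K) * star c d K L = \<dots>" .
  qed
  also have "\<dots> = (\<Sum>r\<le>?M. ?p r * (\<Sum>is | length is = r. sgnl is * poly_of ?M (bconv (shl is c) (shr is d)) w))"
    by (simp only: poly_of_sum poly_of_mult_const)
  also have "\<dots> = (\<Sum>r\<le>?M. ?p r * contraction N w (\<lambda>i. axis i 1) r (rowsum (cnjv w) c) (rowsum (cnjv w) (dag d)))"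
  proof -
    have "poly_of ?M (bconv (shl is c) (shr is d)) w =
      pval N w (Dus (\<lambda>i. axis i 1) is (rowsum (cnjv w) c)) * cnj (pval N w (Dus (\<lambda>i. axis i 1) is (rowsum (cnjv w) (dag d))))" for "is"
      unfolding poly_of_mult[OF supp_box_shl[OF cs(2)] supp_box_shr[OF ds(2)] order_refl, symmetric] poly_of_shr
      using bideg_dag[OF d(1)] by (simp add: poly_of_shl cs bideg_eqdeg bideg_supp_box d(2))
    then show ?thesis by (simp add: contraction_def)
  qed
  finally show ?thesis .
qed

lemma sum_triangle: 
  fixes M :: nat
  shows "(\<Sum>r\<le>M. \<Sum>s\<le>r. G s (r - s)) = (\<Sum>s\<le>M. \<Sum>j\<le>M - s. G s j :: complex)"
proof -
  have "(\<Sum>s\<le>M. \<Sum>j\<le>M - s. G s j) = (\<Sum>(s, j)\<in>Sigma {..M} (\<lambda>s. {..M - s}). G s j)"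
    by (subst sum.Sigma) auto
  also have "Sigma {..M} (\<lambda>s. {..M - s}) = {(s, j). s + j \<le> M}" by auto
  also have "(\<Sum>(s, j)\<in>{(s, j). s + j \<le> M}. G s j) = (\<Sum>r\<le>M. \<Sum>s\<le>r. G s (r - s))"
    by (rule sum.triangle_reindex_eq)
  finally show ?thesis by simp
qed

text \<open>The contractions along \<open>w\<close> act by Euler's identity as multiplication by numbers, and the
  alternating sum over their number turns the rising factorial of the total order into the product
  of the rising factorials of the two orders; the contractions along the tangential vectors remain.\<close>
lemma eval_star_bideg:
  fixes U :: "'n::finite option \<Rightarrow> 'n pt"
  assumes c: "bideg A c" "A \<le> N" and d: "bideg B d" "B \<le> N"
    and U: "frame U" "U None = w" and x: "\<And>s. pochhammer x s \<noteq> 0" and S: "A \<le> S \<or> B \<le> S"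
  shows "eval_series x (star c d) w (cnjv w) = (\<Sum>s\<le>S. 1 / (fact s * pochhammer x s) * (\<Sum>js | length js = s.
     (pochhammer x A * pval N w (Dus (\<lambda>k. U (Some k)) js (rowsum (cnjv w) c))) *
     (pochhammer x B * cnj (pval N w (Dus (\<lambda>k. U (Some k)) js (rowsum (cnjv w) (dag d)))))))"
proof -
  let ?\<alpha> = "rowsum (cnjv w) c" and ?\<beta> = "rowsum (cnjv w) (dag d)" and ?V = "\<lambda>k. U (Some k)"
  let ?M = "2 * N"
  have \<alpha>: "hdeg A ?\<alpha>" and \<beta>: "hdeg B ?\<beta>" using hdeg_rowsum c d bideg_dag by blast+
  define H where "H s = (\<Sum>js | length js = s. pval N w (Dus ?V js ?\<alpha>) * cnj (pval N w (Dus ?V js ?\<beta>)))" for s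
  have H0: "H s = 0" if "s > A \<or> s > B" for s
    unfolding H_def using that Dus_hdeg_0[OF \<alpha>, of _ ?V] Dus_hdeg_0[OF \<beta>, of _ ?V]
    by (intro sum.neutral) (auto simp: pval_def)
  define G where "G s j = pochhammer x (A + B - (s + j)) / fact (s + j) * (of_nat ((s + j) choose s) * ((-1) ^ j *
     of_nat (fact j * ((A - s) choose j)) * of_nat (fact j * ((B - s) choose j))) * H s)" for s j
  have "eval_series x (star c d) w (cnjv w) = (\<Sum>r\<le>?M. \<Sum>s\<le>r. G s (r - s))"
    unfolding eval_star_contraction[OF c d] contraction_frame[OF U(1), symmetric]
      contraction_split[where U = U and w = w, OF U(2) \<alpha> c(2) \<beta> d(2)] H_def[symmetric] sum_distrib_left
    by (intro sum.cong refl) (simp add: G_def)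
  also have "\<dots> = (\<Sum>s\<le>?M. \<Sum>j\<le>?M - s. G s j)" by (rule sum_triangle)
  also have "\<dots> = (\<Sum>s\<le>?M. pochhammer x A * pochhammer x B / (fact s * pochhammer x s) * H s)"
  proof (intro sum.cong refl)
    fix s assume s: "s \<in> {..?M}"
    show "(\<Sum>j\<le>?M - s. G s j) = pochhammer x A * pochhammer x B / (fact s * pochhammer x s) * H s"
    proof (cases "s \<le> A \<and> s \<le> B")
      case True
      let ?m = "A - s" and ?n = "B - s"
      have G: "G s j = (pochhammer x s * H s / fact s) * ((-1) ^ j * of_nat (fact j * (?m choose j) * (?n choose j)) * pochhammer (x + of_nat s) (?m + ?n - j))" for j
      proof (cases "j \<le> ?m")
        case j: True
        have "A + B - (s + j) = s + (?m + ?n - j)" using j True by linarith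
        then have p: "pochhammer x (A + B - (s + j)) = pochhammer x s * pochhammer (x + of_nat s) (?m + ?n - j)"
          by (simp only: pochhammer_product')
        have "(of_nat ((s + j) choose s) :: complex) = fact (s + j) / (fact s * fact j)"
          by (simp add: binomial_fact)
        then show ?thesis unfolding G_def p by (simp add: field_simps)
      next
        case False
        then have "(of_nat (?m choose j) :: complex) = 0" by simp
        then show ?thesis by (simp only: G_def of_nat_mult mult_zero_right mult_zero_left)
      qed
      have "(\<Sum>j\<le>?M - s. G s j) = (pochhammer x s * H s / fact s) * (pochhammer (x + of_nat s) ?m * pochhammer (x + of_nat s) ?n)"
        unfolding G sum_distrib_left[symmetric] using True c(2)
        by (subst pochhammer_vandermonde) auto
      moreover have "pochhammer x A = pochhammer x s * pochhammer (x + of_nat s) ?m"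
        "pochhammer x B = pochhammer x s * pochhammer (x + of_nat s) ?n"
        using True pochhammer_product'[of x s ?m] pochhammer_product'[of x s ?n] by simp_all
      ultimately show ?thesis using x[of s] by simp
    next
      case False
      then have "H s = 0" by (intro H0) auto
      then show ?thesis by (simp add: G_def)
    qed
  qed
  also have "\<dots> = (\<Sum>s\<le>S. pochhammer x A * pochhammer x B / (fact s * pochhammer x s) * H s)"
  proof -
    have "(\<Sum>s\<le>?M. pochhammer x A * pochhammer x B / (fact s * pochhammer x s) * H s) = 
      (\<Sum>s\<le>max ?M S. pochhammer x A * pochhammer x B / (fact s * pochhammer x s) * H s)"
      by (rule sum.mono_neutral_left) (use c d in \<open>auto intro!: H0\<close>)
    also have "\<dots> = (\<Sum>s\<le>S. pochhammer x A * pochhammer x B / (fact s * pochhammer x s) * H s)"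
      by (rule sum.mono_neutral_right) (use S in \<open>auto intro!: H0\<close>)
    finally show ?thesis .
  qed
  finally show ?thesis unfolding H_def by (simp add: sum_distrib_left mult_ac)
qed

abbreviation level_val :: "real \<Rightarrow> 'i::finite arr \<Rightarrow> complex ^ 'i \<Rightarrow> complex" where
  "level_val t a w \<equiv> eval_series (of_real t) a w (cnjv w)"

text \<open>The contribution of order \<open>g\<close> to the derivative along the word \<open>js\<close> of the holomorphic extension of the
  element with coefficients \<open>a\<close>.\<close>
definition amp :: "real \<Rightarrow> 'n::finite pt \<Rightarrow> ('n \<Rightarrow> 'n pt) \<Rightarrow> 'n list \<Rightarrow> nat \<Rightarrow> 'n option arr \<Rightarrow> complex" where
  "amp t w V js g a = pochhammer (of_real t) g * pval g w (Dus V js (rowsum (cnjv w) (piece g a)))"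

lemma pval_mono_box:
  assumes "\<And>K. mdeg K > g \<Longrightarrow> \<alpha> K = 0" "g \<le> N"
  shows "pval N w \<alpha> = pval g w \<alpha>"
  unfolding pval_def by (rule sum.mono_neutral_right) (use assms in \<open>auto simp: degbox_def not_le\<close>)

lemma pval_Dus_piece:
  assumes "g \<le> N"
  shows "pval N w (Dus V js (rowsum \<zeta> (piece g a))) = pval g w (Dus V js (rowsum \<zeta> (piece g a)))"
proof (rule pval_mono_box[OF _ assms])
  show "Dus V js (rowsum \<zeta> (piece g a)) K = 0" if "mdeg K > g" for K
    using Dus_hdeg[OF hdeg_rowsum[OF bideg_piece], of g js V \<zeta> a] that by (simp add: hdeg_def)
qed

lemma piece_hat: "piece g a \<in> hat"
  by (rule supp_box_hat[OF bideg_eqdeg[OF bideg_piece] bideg_supp_box[OF bideg_piece order_refl]])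

lemma dag_piece: "dag (piece g a) = piece g (dag a)"
  by (auto simp: dag_def piece_def fun_eq_iff)

lemma trunc_pieces: "eqdeg a \<Longrightarrow> trunc N a = (\<lambda>K L. \<Sum>g\<le>N. piece g a K L)"
proof (intro ext)
  fix K L assume a: "eqdeg a"
  have "(\<Sum>g\<le>N. piece g a K L) = (\<Sum>g\<le>N. if g = mdeg K then (if mdeg L = mdeg K then a K L else 0) else 0)"
    by (intro sum.cong refl) (auto simp: piece_def)
  also have "\<dots> = trunc N a K L" using a by (auto simp: trunc_def eqdeg_def)
  finally show "trunc N a K L = (\<Sum>g\<le>N. piece g a K L)" by simp
qed

lemma hpart_sum: "hpart g (\<lambda>K L. \<Sum>j\<in>S. a j K L) z \<zeta> = (\<Sum>j\<in>S. hpart g (a j) z \<zeta>)"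
  unfolding hpart_def sum_distrib_right by (rule sum_rotate)

lemma eval_series_sum:
  assumes "\<And>j. j \<in> S \<Longrightarrow> a j \<in> hat"
  shows "eval_series x (\<lambda>K L. \<Sum>j\<in>S. a j K L) z \<zeta> = (\<Sum>j\<in>S. eval_series x (a j) z \<zeta>)"
proof -
  have "(\<lambda>g. \<Sum>j\<in>S. pochhammer x g * hpart g (a j) z \<zeta>) sums (\<Sum>j\<in>S. eval_series x (a j) z \<zeta>)"
    by (intro sums_sum eval_series_sums assms)
  then show ?thesis unfolding eval_series_def[of x "\<lambda>K L. \<Sum>j\<in>S. a j K L"] hpart_sum sum_distrib_left
    by (rule sums_unique[symmetric])
qed

text \<open>The rising factorials of \<open>eval_star_bideg\<close> are separate factors for the two arguments, so the
  sums over the orders factorise.\<close>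
lemma eval_star_trunc:
  fixes U :: "'n::finite option \<Rightarrow> 'n pt"
  assumes c: "eqdeg c" and d: "eqdeg d" and U: "frame U" "U None = w" and t: "t > 0" and S: "N \<le> S \<or> M \<le> S"
  shows "level_val t (star (trunc N c) (trunc M d)) w =
    (\<Sum>s\<le>S. of_real (1 / (fact s * pochhammer t s)) * (\<Sum>js | length js = s.
      (\<Sum>A\<le>N. amp t w (\<lambda>k. U (Some k)) js A c) * cnj (\<Sum>B\<le>M. amp t w (\<lambda>k. U (Some k)) js B (dag d))))"
proof -
  let ?V = "\<lambda>k. U (Some k)" and ?x = "complex_of_real t"
  let ?a = "\<lambda>s A B. \<Sum>js | length js = s. amp t w ?V js A c * cnj (amp t w ?V js B (dag d))"
  let ?f = "\<lambda>s. 1 / (fact s * pochhammer ?x s)"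
  have x: "pochhammer ?x s \<noteq> 0" for s
    using pochhammer_pos[OF t, of s] by (simp add: pochhammer_of_real)
  let ?p = "\<lambda>A B K L. star (piece A c) (piece B d) K L"
  have hat: "?p A B \<in> hat" for A B by (intro star_hat piece_hat)
  have star: "star (trunc N c) (trunc M d) = (\<lambda>K L. \<Sum>X\<in>{..N} \<times> {..M}. ?p (fst X) (snd X) K L)"
    by (simp add: trunc_pieces c d fun_eq_iff star_sum_left star_sum_right sum.cartesian_product case_prod_unfold)
  have "eval_series ?x (star (trunc N c) (trunc M d)) w (cnjv w) = (\<Sum>A\<le>N. \<Sum>B\<le>M. eval_series ?x (?p A B) w (cnjv w))"
    unfolding star eval_series_sum[OF hat] by (simp add: sum.cartesian_product case_prod_unfold)
  also have "\<dots> = (\<Sum>A\<le>N. \<Sum>B\<le>M. \<Sum>s\<le>S. ?f s * ?a s A B)"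
  proof (intro sum.cong refl)
    fix A B assume AB: "A \<in> {..N}" "B \<in> {..M}"
    have cnj_poch: "cnj (pochhammer ?x B) = pochhammer ?x B" by (simp add: pochhammer_of_real)
    have le: "A \<le> max N M" "B \<le> max N M" using AB by auto
    have "A \<le> S \<or> B \<le> S" using S AB by auto
    from eval_star_bideg[OF bideg_piece[of A c] le(1) bideg_piece[of B d] le(2) U x this]
    show "eval_series ?x (?p A B) w (cnjv w) = (\<Sum>s\<le>S. ?f s * ?a s A B)"
      unfolding dag_piece pval_Dus_piece[OF le(1)] pval_Dus_piece[OF le(2)] amp_def complex_cnj_mult cnj_poch .
  qed
  also have "\<dots> = (\<Sum>s\<le>S. \<Sum>A\<le>N. \<Sum>B\<le>M. ?f s * ?a s A B)" by (rule sum_rotate)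
  also have "\<dots> = (\<Sum>s\<le>S. of_real (1 / (fact s * pochhammer t s)) * (\<Sum>js | length js = s.
      (\<Sum>A\<le>N. amp t w ?V js A c) * cnj (\<Sum>B\<le>M. amp t w ?V js B (dag d))))"
  proof (intro sum.cong refl)
    fix s
    have "(\<Sum>A\<le>N. \<Sum>B\<le>M. ?a s A B) =
      (\<Sum>js | length js = s. (\<Sum>A\<le>N. amp t w ?V js A c) * cnj (\<Sum>B\<le>M. amp t w ?V js B (dag d)))"
      by (subst sum_rotate) (simp add: sum_product)
    then show "(\<Sum>A\<le>N. \<Sum>B\<le>M. ?f s * ?a s A B) = of_real (1 / (fact s * pochhammer t s)) * (\<Sum>js | length js = s.
      (\<Sum>A\<le>N. amp t w ?V js A c) * cnj (\<Sum>B\<le>M. amp t w ?V js B (dag d)))"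
      unfolding sum_distrib_left[symmetric] by (simp add: pochhammer_of_real)
  qed
  finally show ?thesis .
qed

lemma dag_dag [simp]: "dag (dag a) = a"
  by (simp add: dag_def fun_eq_iff)

lemma dag_hat: "a \<in> hat \<Longrightarrow> dag a \<in> hat"
proof -
  assume a: "a \<in> hat"
  have "eqdeg (dag a)" using hatD(1)[OF a] unfolding eqdeg_def dag_def by (metis complex_cnj_zero)
  moreover have "bnd e B (dag a)" if B: "bnd e B a" for e B
    unfolding bnd_def
  proof (intro allI)
    fix K L show "norm (dag a K L) \<le> B * fact (mdeg K) powr e"
    proof (cases "mdeg K = mdeg L")
      case True
      then show ?thesis using B unfolding bnd_def dag_def by (metis complex_mod_cnj)
    next
      case False
      then have "dag a K L = 0" using \<open>eqdeg (dag a)\<close> by (simp add: eqdeg_def)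
      then show ?thesis using bnd_nonneg[OF B] by simp
    qed
  qed
  ultimately show "dag a \<in> hat" using a unfolding hat_def by blast
qed

lemma eval_series_continuous:
  assumes "aconv X a" "\<And>k. X k \<in> hat" "a \<in> hat"
  shows "(\<lambda>k. eval_series x (X k) z \<zeta>) \<longlonglongrightarrow> eval_series x a z \<zeta>"
proof (rule LIM_zero_cancel)
  obtain M where M: "\<And>B a. a \<in> hat \<Longrightarrow> bnd (1/2) B a \<Longrightarrow> norm (eval_series x a z \<zeta>) \<le> M * B"
    using norm_eval_series_le[of x z \<zeta>] by blast
  show "(\<lambda>k. eval_series x (X k) z \<zeta> - eval_series x a z \<zeta>) \<longlonglongrightarrow> 0"
    unfolding tendsto_iff dist_norm
  proof (intro allI impI)
    fix e :: real assume e: "e > 0"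
    define \<delta> where "\<delta> = e / (2 * (\<bar>M\<bar> + 1))"
    have \<delta>: "\<delta> > 0" using e by (simp add: \<delta>_def)
    have "M * \<delta> \<le> (\<bar>M\<bar> + 1) * \<delta>" using \<delta> by (intro mult_right_mono) auto
    also have "\<dots> = e / 2"
    proof -
      have "\<bar>M\<bar> + 1 \<noteq> 0" using abs_ge_zero[of M] by linarith
      then show ?thesis by (simp only: \<delta>_def) (simp add: divide_simps)
    qed
    finally have less: "M * \<delta> < e" using e by simp
    have "\<forall>\<^sub>F k in sequentially. bnd (1/2) \<delta> (\<lambda>K L. X k K L - a K L)"
      using assms(1) \<delta> by (simp add: aconv_def)
    then show "\<forall>\<^sub>F k in sequentially. norm (eval_series x (X k) z \<zeta> - eval_series x a z \<zeta> - 0) < e"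
    proof eventually_elim
      case (elim k)
      show ?case
        using M[OF hat_diff[OF assms(2,3)] elim] less by (simp add: eval_series_diff[OF assms(2,3)])
    qed
  qed
qed

lemma aconv_const: "aconv (\<lambda>_. a) a"
  by (auto simp: aconv_def bnd_def)

text \<open>For truncations the value is a combination of absolute squares with positive weights, since the left
  factor is the adjoint of the right one.\<close>
lemma eval_star_nonneg:
  assumes b: "b \<in> hat" and U: "frame U" "U None = w" and t: "t > 0"
  shows "level_val t (star (dag b) b) w \<in> \<real>\<^sub>\<ge>\<^sub>0"
proof (rule Lim_in_closed_set[OF closed_nonneg_Reals_complex _ sequentially_bot])
  show "(\<lambda>N. level_val t (star (trunc N (dag b)) (trunc N b)) w) \<longlonglongrightarrow> level_val t (star (dag b) b) w"
    by (intro eval_series_continuous aconv_star star_hat aconv_trunc trunc_hat dag_hat b)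
  have "level_val t (star (trunc N (dag b)) (trunc N b)) w \<in> \<real>\<^sub>\<ge>\<^sub>0" for N
    unfolding eval_star_trunc[OF hatD(1)[OF dag_hat[OF b]] hatD(1)[OF b] U t disjI1[OF order_refl]]
  proof -
    let ?z = "\<lambda>js. \<Sum>A\<le>N. amp t w (\<lambda>k. U (Some k)) js A (dag b)"
    have "(\<Sum>s\<le>N. of_real (1 / (fact s * pochhammer t s)) * (\<Sum>js | length js = s. ?z js * cnj (?z js))) =
      complex_of_real (\<Sum>s\<le>N. 1 / (fact s * pochhammer t s) * (\<Sum>js | length js = s. (cmod (?z js))\<^sup>2))"
      unfolding of_real_sum of_real_mult complex_norm_square ..
    moreover have "(\<Sum>s\<le>N. 1 / (fact s * pochhammer t s) * (\<Sum>js | length js = s. (cmod (?z js))\<^sup>2)) \<ge> 0"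
      using pochhammer_pos[OF t] by (intro sum_nonneg mult_nonneg_nonneg) (auto intro: less_imp_le)
    ultimately show "(\<Sum>s\<le>N. of_real (1 / (fact s * pochhammer t s)) * (\<Sum>js | length js = s. ?z js * cnj (?z js))) \<in> \<real>\<^sub>\<ge>\<^sub>0"
      by (simp only: nonneg_Reals_of_real_iff)
  qed
  then show "\<forall>\<^sub>F N in sequentially. level_val t (star (trunc N (dag b)) (trunc N b)) w \<in> \<real>\<^sub>\<ge>\<^sub>0"
    by simp
qed

lemma eval_star_hermitian:
  assumes c: "c \<in> hat" and d: "d \<in> hat" and U: "frame U" "U None = w" and t: "t > 0"
  shows "level_val t (star c d) w = cnj (level_val t (star (dag d) (dag c)) w)"
proof (rule LIMSEQ_unique)
  show "(\<lambda>N. level_val t (star (trunc N c) (trunc N d)) w) \<longlonglongrightarrow> level_val t (star c d) w"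
    by (intro eval_series_continuous aconv_star star_hat aconv_trunc trunc_hat c d)
  have "(\<lambda>N. cnj (level_val t (star (trunc N (dag d)) (trunc N (dag c))) w)) \<longlonglongrightarrow> cnj (level_val t (star (dag d) (dag c)) w)"
    by (intro tendsto_cnj eval_series_continuous aconv_star star_hat aconv_trunc trunc_hat dag_hat c d)
  moreover have "level_val t (star (trunc N c) (trunc N d)) w = 
    cnj (level_val t (star (trunc N (dag d)) (trunc N (dag c))) w)" for N
    unfolding eval_star_trunc[OF hatD(1)[OF c] hatD(1)[OF d] U t disjI1[OF order_refl]]
     eval_star_trunc[OF hatD(1)[OF dag_hat[OF d]] hatD(1)[OF dag_hat[OF c]] U t disjI1[OF order_refl]]
    by (simp add: mult.commute)
  ultimately show "(\<lambda>N. level_val t (star (trunc N c) (trunc N d)) w) \<longlonglongrightarrow> cnj (level_val t (star (dag d) (dag c)) w)"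
    by simp
qed

text \<open>Truncating the right factor makes the sum over the words finite, so that the limit in the left
  factor can be taken termwise.\<close>
lemma eval_star_eq_0:
  assumes a: "a \<in> hat" and d: "d \<in> hat" and U: "frame U" "U None = w" and t: "t > 0"
    and amp0: "\<And>js. (\<lambda>g. amp t w (\<lambda>k. U (Some k)) js g a) sums 0"
  shows "level_val t (star a d) w = 0"
proof -
  let ?V = "\<lambda>k. U (Some k)"
  have "level_val t (star a (trunc M d)) w = 0" for M
  proof (rule LIMSEQ_unique)
    have "(\<lambda>N. level_val t (star (trunc N a) (trunc M d)) w) \<longlonglongrightarrow> level_val t (star a (trunc M d)) w"
      by (intro eval_series_continuous aconv_star star_hat aconv_trunc trunc_hat aconv_const a d)
    then show "(\<lambda>N. \<Sum>s\<le>M. of_real (1 / (fact s * pochhammer t s)) * (\<Sum>js | length js = s.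
      (\<Sum>A\<le>N. amp t w ?V js A a) * cnj (\<Sum>B\<le>M. amp t w ?V js B (dag d)))) \<longlonglongrightarrow> level_val t (star a (trunc M d)) w"
      unfolding eval_star_trunc[OF hatD(1)[OF a] hatD(1)[OF d] U t disjI2[OF order_refl]] .
    have lim: "(\<lambda>N. \<Sum>A\<le>N. amp t w ?V js A a) \<longlonglongrightarrow> 0" for js
      using amp0[of js] by (simp add: sums_def_le)
    have "(\<lambda>N. \<Sum>s\<le>M. of_real (1 / (fact s * pochhammer t s)) * (\<Sum>js | length js = s.
      (\<Sum>A\<le>N. amp t w ?V js A a) * cnj (\<Sum>B\<le>M. amp t w ?V js B (dag d)))) \<longlonglongrightarrow> (\<Sum>s\<le>M. of_real (1 / (fact s * pochhammer t s)) * (\<Sum>js :: 'a list | length js = s.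
      0 * cnj (\<Sum>B\<le>M. amp t w ?V js B (dag d))))"
      by (intro tendsto_intros lim)
    then show "(\<lambda>N. \<Sum>s\<le>M. of_real (1 / (fact s * pochhammer t s)) * (\<Sum>js | length js = s.
      (\<Sum>A\<le>N. amp t w ?V js A a) * cnj (\<Sum>B\<le>M. amp t w ?V js B (dag d)))) \<longlonglongrightarrow> 0" by simp
  qed
  moreover have "(\<lambda>M. level_val t (star a (trunc M d)) w) \<longlonglongrightarrow> level_val t (star a d) w"
    by (intro eval_series_continuous aconv_star star_hat aconv_trunc trunc_hat aconv_const a d)
  ultimately show ?thesis by (simp add: LIMSEQ_const_iff)
qed

section \<open>Functions vanishing on the level set\<close>

text \<open>The Hermitian form whose value on the diagonal is \<open>y\<close>; the tangent vectors used below are those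
  orthogonal to \<open>w\<close>.\<close>
definition herm :: "'n::finite pt \<Rightarrow> 'n pt \<Rightarrow> complex" where
  "herm u v = u $ None * cnj (v $ None) - (\<Sum>i\<in>UNIV. u $ Some i * cnj (v $ Some i))"

lemma yfun_herm: "of_real (yfun v) = herm v v"
  by (simp add: yfun_def herm_def complex_norm_square del: of_real_power)

lemma yfun_tangent:
  assumes "herm u w = 0" "yfun w = 1"
  shows "yfun (w + s *s u) = 1 + (cmod s)\<^sup>2 * yfun u"
proof -
  have sym: "herm w u = 0"
  proof -
    have "herm w u = cnj (herm u w)" by (simp add: herm_def mult.commute)
    then show ?thesis using assms(1) by simp
  qed
  have "herm (w + s *s u) (w + s *s u) = herm w w + s * herm u w + cnj s * herm w u + s * cnj s * herm u u"
    by (simp add: herm_def algebra_simps sum.distrib sum_distrib_left)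
  then have "complex_of_real (yfun (w + s *s u)) = of_real (1 + (cmod s)\<^sup>2 * yfun u)"
    using assms sym unfolding of_real_add of_real_mult complex_norm_square by (simp flip: yfun_herm)
  then show ?thesis by (simp only: of_real_eq_iff)
qed

text \<open>Replacing the conjugate of the parameter \<open>s\<close> by \<open>\<rho> / s\<close> turns the vanishing on the circle
  \<open>|s|\<^sup>2 = \<rho>\<close> into the vanishing of a function that is holomorphic in \<open>s\<close>; then \<open>\<rho>\<close> can tend to 0.\<close>
lemma eval_series_tangent:
  fixes a :: "'n::finite option arr"
  assumes a: "a \<in> hat" and zero: "\<And>z. yfun z = 1 \<Longrightarrow> eval_series x a z (cnjv z) = 0"
    and w: "yfun w = 1" and u: "herm u w = 0"
  shows "eval_series x a (w + u) (cnjv w) = 0"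
proof -
  define q where "q = yfun u"
  \<comment> \<open>For \<open>|\<rho>| < \<delta>\<close> the normalising factor \<open>1 + \<rho> q\<close> stays away from 0, whatever the sign of \<open>q\<close>.\<close>
  define \<delta> where "\<delta> = 1 / (\<bar>q\<bar> + 1)"
  have \<delta>: "\<delta> > 0" "\<delta> * \<bar>q\<bar> < 1" by (simp_all add: \<delta>_def add_nonneg_pos divide_less_eq)
  have small: "r * \<bar>q\<bar> < 1" if "r < \<delta>" for r
    using mult_right_mono[of r \<delta> "\<bar>q\<bar>"] that \<delta>(2) by simp
  have ne: "1 + \<rho> * of_real q \<noteq> 0" if "cmod \<rho> < \<delta>" for \<rho> :: complex
  proof
    assume "1 + \<rho> * of_real q = 0"
    then have "\<rho> * of_real q = - 1" by (simp add: add_eq_0_iff)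
    then have "cmod \<rho> * \<bar>q\<bar> = 1" by (metis norm_minus_cancel norm_mult norm_of_real norm_one)
    then show False using small[OF that] by simp
  qed
  have circle: "eval_series x a ((1 / (1 + of_real \<rho> * of_real q)) *s (w + u)) (cnjv w + of_real \<rho> *s cnjv u) = 0"
    if \<rho>: "0 < \<rho>" "\<rho> < \<delta>" for \<rho>
  proof -
    have pos: "1 + \<rho> * q > 0"
    proof -
      have "- (\<rho> * \<bar>q\<bar>) \<le> \<rho> * q" using \<rho> by (cases "q \<ge> 0") (auto simp: mult_nonneg_nonneg)
      then show ?thesis using small[OF \<rho>(2)] by linarith
    qed
    let ?l = "\<lambda>s. cnjv w + (of_real \<rho> / s) *s cnjv u"
    let ?f = "\<lambda>s. eval_series x a ((1 / (1 + of_real \<rho> * of_real q)) *s (w + s *s u)) (?l s)"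
    have "?f 1 = 0"
    proof (rule analytic_continuation[of ?f "- {0}" "sphere 0 (sqrt \<rho>)" "of_real (sqrt \<rho>)"])
      show "?f holomorphic_on - {0}"
        by (rule holomorphic_eval_series[OF a]) (auto intro!: holomorphic_intros)
      show "connected (- {0} :: complex set)" by (rule connected_punctured_universe) simp
      show "sphere 0 (sqrt \<rho>) \<subseteq> - {0 :: complex}" using \<rho> by auto
      show "complex_of_real (sqrt \<rho>) islimpt sphere 0 (sqrt \<rho>)"
      proof (rule connected_imp_perfect)
        show "connected (sphere (0::complex) (sqrt \<rho>))" by (rule connected_sphere) simp
        show "complex_of_real (sqrt \<rho>) \<in> sphere 0 (sqrt \<rho>)" using \<rho> by simp
        show "sphere (0::complex) (sqrt \<rho>) \<noteq> {b}" for b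
        proof
          assume "sphere (0::complex) (sqrt \<rho>) = {b}"
          moreover have "complex_of_real (sqrt \<rho>) \<in> sphere 0 (sqrt \<rho>)" "- complex_of_real (sqrt \<rho>) \<in> sphere 0 (sqrt \<rho>)"
            using \<rho> by auto
          ultimately have "complex_of_real (sqrt \<rho>) = - complex_of_real (sqrt \<rho>)" by (metis singletonD)
          then show False using \<rho> by simp
        qed
      qed
      fix s :: complex assume "s \<in> sphere 0 (sqrt \<rho>)"
      then have s: "cmod s = sqrt \<rho>" by simp
      then have sq: "(cmod s)\<^sup>2 = \<rho>" "s \<noteq> 0" using \<rho> by auto
      have cs: "cnj s = of_real \<rho> / s"
        using sq complex_norm_square[of s] by (simp add: field_simps)
      \<comment> \<open>The factor that normalises \<open>w + s u\<close> to the level set.\<close>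
      define r where "r = 1 / sqrt (1 + \<rho> * q)"
      have r: "r > 0" "r\<^sup>2 * (1 + \<rho> * q) = 1" using pos by (simp_all add: r_def power_divide)
      let ?z = "of_real r *s (w + s *s u)"
      have "yfun ?z = 1"
        unfolding yfun_scale yfun_tangent[OF u w] sq(1) q_def[symmetric] using r by simp
      moreover have "cnjv ?z = of_real r *s ?l s"
        unfolding cs[symmetric] by (simp add: vec_eq_iff cnjv_def)
      ultimately have *: "eval_series x a ?z (of_real r *s ?l s) = 0" using zero by metis
      have "1 / (1 + complex_of_real \<rho> * of_real q) = of_real (r * r)"
      proof -
        have "r * r = 1 / (1 + \<rho> * q)" using r(2) pos by (simp add: power2_eq_square field_simps)
        then show ?thesis by simp
      qed
      then have fac: "(1 / (1 + of_real \<rho> * of_real q)) *s (w + s *s u) = of_real r *s ?z"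
        by (simp add: vec_eq_iff)
      have cancel: "?l s = (1 / of_real r) *s (of_real r *s ?l s)"
        using r(1) by (simp add: vec_eq_iff)
      have "?f s = eval_series x a (of_real r *s ?z) ((1 / of_real r) *s (of_real r *s ?l s))"
        unfolding fac cancel[symmetric] ..
      also have "\<dots> = eval_series x a ?z (of_real r *s ?l s)"
        by (rule eval_series_scale) (use r in simp)
      finally show "?f s = 0" using * by simp
    qed (use \<rho> in auto)
    then show ?thesis by simp
  qed
  \<comment> \<open>The vanishing for small positive \<open>\<rho>\<close> extends to \<open>\<rho> = 0\<close>, again by holomorphy.\<close>
  let ?F = "\<lambda>\<rho>. eval_series x a ((1 / (1 + \<rho> * of_real q)) *s (w + u)) (cnjv w + \<rho> *s cnjv u)"
  have "?F 0 = 0"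
  proof (rule analytic_continuation[of ?F "ball 0 \<delta>" "of_real ` {0<..<\<delta>}" 0])
    show "?F holomorphic_on ball 0 \<delta>"
      by (rule holomorphic_eval_series[OF a]) (use ne in \<open>auto intro!: holomorphic_intros\<close>)
    show "(0::complex) islimpt of_real ` {0<..<\<delta>}" using islimpt_of_real_interval[OF \<delta>(1), of 0] by simp
  qed (use \<delta> circle in auto)
  then show ?thesis by simp
qed

definition hval :: "nat \<Rightarrow> complex ^ 'i::finite \<Rightarrow> (('i \<Rightarrow> nat) \<Rightarrow> complex) \<Rightarrow> complex" where
  "hval j z \<beta> = (\<Sum>K\<in>graded j. \<beta> K * dpow z K)"

text \<open>The growth of the one-index arrays that arise from the completion; it makes the sum of the
  homogeneous values an entire function.\<close>
definition growth :: "(('i::finite \<Rightarrow> nat) \<Rightarrow> complex) \<Rightarrow> bool" where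
  "growth \<beta> \<longleftrightarrow> (\<exists>C\<ge>0. \<exists>M\<ge>0. \<forall>K. norm (\<beta> K) \<le> C * M ^ mdeg K * fact (mdeg K) powr (1/2))"

lemma growth_Du:
  assumes "growth \<beta>"
  shows "growth (Du u \<beta>)"
proof -
  obtain C M where CM: "C \<ge> 0" "M \<ge> 0" "\<And>K. norm (\<beta> K) \<le> C * M ^ mdeg K * fact (mdeg K) powr (1/2)"
    using assms by (auto simp: growth_def)
  define D where "D = (\<Sum>i\<in>UNIV. norm (u $ i)) * C * M"
  have D: "D \<ge> 0" using CM by (simp add: D_def sum_nonneg)
  have "norm (Du u \<beta> K) \<le> D * (2 * M) ^ mdeg K * fact (mdeg K) powr (1/2)" for K
  proof -
    let ?g = "mdeg K"
    have f: "fact (Suc ?g) powr (1/2) \<le> (2::real) ^ ?g * fact ?g powr (1/2)"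
    proof -
      have "real (Suc ?g) \<le> 2 ^ ?g" by (metis Suc_leI less_exp numeral_power_eq_of_nat_cancel_iff of_nat_le_iff)
      then have "real (Suc ?g) powr (1/2) \<le> (2 ^ ?g) powr (1/2)" by (intro powr_mono2) auto
      also have "\<dots> \<le> (2 ^ ?g) powr (1::real)" by (intro powr_mono) auto
      finally have "real (Suc ?g) powr (1/2) \<le> 2 ^ ?g" by simp
      then have "real (Suc ?g) powr (1/2) * fact ?g powr (1/2) \<le> 2 ^ ?g * fact ?g powr (1/2)"
        by (intro mult_right_mono) auto
      then show ?thesis by (simp add: powr_mult del: of_nat_Suc)
    qed
    have "norm (Du u \<beta> K) \<le> (\<Sum>i\<in>UNIV. norm (u $ i) * (C * M ^ Suc ?g * fact (Suc ?g) powr (1/2)))"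
      unfolding Du_def
    proof (intro sum_norm_le)
      fix i show "norm (u $ i * \<beta> (inc K i)) \<le> norm (u $ i) * (C * M ^ Suc ?g * fact (Suc ?g) powr (1/2))"
        unfolding norm_mult using CM(3)[of "inc K i"] unfolding mdeg_inc by (intro mult_left_mono) auto
    qed
    also have "\<dots> = D * M ^ ?g * fact (Suc ?g) powr (1/2)"
      unfolding D_def sum_distrib_right[symmetric] by simp
    also have "\<dots> \<le> D * M ^ ?g * (2 ^ ?g * fact ?g powr (1/2))"
      using D CM by (intro mult_left_mono f) auto
    finally show ?thesis by (simp add: power_mult_distrib mult_ac)
  qed
  then show ?thesis using D CM unfolding growth_def by (intro exI[of _ D] conjI exI[of _ "2 * M"]) auto
qed

lemma hval_majorant:
  assumes "growth \<beta>" 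
  shows "\<exists>h. summable h \<and> (\<forall>j z. norm z \<le> R \<longrightarrow> norm (hval j z \<beta>) \<le> h j)"
proof (cases "R \<ge> 0")
  case R: True
  obtain C M where CM: "C \<ge> 0" "M \<ge> 0" "\<And>K. norm (\<beta> K) \<le> C * M ^ mdeg K * fact (mdeg K) powr (1/2)"
    using assms by (auto simp: growth_def)
  let ?Q = "facbase TYPE('a)"
  have Q: "?Q \<ge> 0" using facbase_ge_1[where ?'i='a] by simp
  let ?h = "\<lambda>j. C * (?Q * M * (?Q * R)) ^ j / fact j powr (1/2)"
  have "norm (hval j z \<beta>) \<le> ?h j" if z: "norm z \<le> R" for j z
  proof -
    have "norm (z $ i) \<le> R" for i using z norm_component_le_norm order_trans by blast
    note d = norm_dpow_le[of z R, OF this]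
    have "norm (hval j z \<beta>) \<le> (\<Sum>K\<in>(graded j :: ('a \<Rightarrow> nat) set). (C * M ^ j * fact j powr (1/2)) * ((?Q * R) ^ j / fact j))"
      unfolding hval_def
    proof (intro sum_norm_le)
      fix K :: "'a \<Rightarrow> nat" assume "K \<in> graded j"
      then have j: "mdeg K = j" by (simp add: graded_def)
      show "norm (\<beta> K * dpow z K) \<le> (C * M ^ j * fact j powr (1/2)) * ((?Q * R) ^ j / fact j)"
        unfolding norm_mult using CM(1,2) CM(3)[of K] d[of K] unfolding j by (intro mult_mono) auto
    qed
    also have "\<dots> = real (card (graded j :: ('a \<Rightarrow> nat) set)) * ((C * M ^ j * fact j powr (1/2)) * ((?Q * R) ^ j / fact j))"
      by simp
    also have "\<dots> \<le> ?Q ^ j * ((C * M ^ j * fact j powr (1/2)) * ((?Q * R) ^ j / fact j))"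
      using CM Q R by (intro mult_right_mono card_graded_le) auto
    also have "\<dots> = C * (?Q * M * (?Q * R)) ^ j * (fact j powr (1/2) / fact j)"
      by (simp add: power_mult_distrib mult_ac)
    also have "(fact j :: real) powr (1/2) / fact j = 1 / fact j powr (1/2)"
      using half_powr[of j] by (simp add: field_simps power2_eq_square)
    finally show ?thesis by simp
  qed
  moreover have "summable ?h" using CM Q R by (intro summable_majorant) auto
  ultimately show ?thesis by blast
next
  case False
  then show ?thesis by (intro exI[of _ "\<lambda>_. 0"]) (auto dest: order_trans[OF norm_ge_zero])
qed

lemma DERIV_dpow_line:
  "((\<lambda>t. dpow (z + t *s u) K) has_field_derivative (\<Sum>i\<in>UNIV. u $ i * dpow' (z + t *s u) K i)) (at t)"
proof -
  have "((\<lambda>t. (z $ i + t * u $ i) ^ K i / fact (K i)) has_derivative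
     (\<lambda>s. s * (u $ i * (of_nat (K i) * (z $ i + t * u $ i) ^ (K i - 1) / fact (K i))))) (at t)" for i
    by (auto intro!: derivative_eq_intros simp: fun_eq_iff)
  from has_derivative_prod[where I = UNIV, OF this]
  have "((\<lambda>t. dpow (z + t *s u) K) has_derivative (\<lambda>s. \<Sum>i\<in>UNIV. s * (u $ i * dpow' (z + t *s u) K i))) (at t)"
    unfolding dpow_def dpow'_eq by (simp add: mult_ac)
  then show ?thesis
    unfolding has_field_derivative_def
    by (rule has_derivative_eq_rhs) (simp add: fun_eq_iff sum_distrib_left[symmetric] mult.commute)
qed

lemma DERIV_hval_line:
  "((\<lambda>t. hval j (z + t *s u) \<beta>) has_field_derivative (if j = 0 then 0 else hval (j - 1) (z + t *s u) (Du u \<beta>))) (at t)"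
proof -
  let ?z = "z + t *s u"
  let ?c = "\<lambda>K. if mdeg K = j then \<beta> K else 0"
  have "((\<lambda>t. hval j (z + t *s u) \<beta>) has_field_derivative (\<Sum>K\<in>graded j. \<beta> K * (\<Sum>i\<in>UNIV. u $ i * dpow' ?z K i))) (at t)"
    unfolding hval_def by (intro DERIV_sum DERIV_cmult DERIV_dpow_line)
  moreover have "(\<Sum>K\<in>graded j. \<beta> K * (\<Sum>i\<in>UNIV. u $ i * dpow' ?z K i)) = (if j = 0 then 0 else hval (j - 1) ?z (Du u \<beta>))"
  proof -
    have "(\<Sum>K\<in>graded j. \<beta> K * (\<Sum>i\<in>UNIV. u $ i * dpow' ?z K i)) = (\<Sum>i\<in>UNIV. u $ i * (\<Sum>K\<in>graded j. \<beta> K * dpow' ?z K i))"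
      unfolding sum_distrib_left by (subst sum.swap) (simp add: mult_ac)
    also have "\<dots> = (\<Sum>i\<in>UNIV. u $ i * (\<Sum>K\<in>degbox j. ?c K * dpow' ?z K i))"
      by (intro sum.cong refl arg_cong2[where f = "(*)"] sum.mono_neutral_cong_left) (auto simp: graded_def degbox_def)
    also have "\<dots> = (\<Sum>i\<in>UNIV. u $ i * (\<Sum>K\<in>degbox j. ?c (inc K i) * dpow ?z K))"
      by (intro sum.cong refl arg_cong2[where f = "(*)"] sum_dpow'_shift) auto
    also have "\<dots> = (if j = 0 then 0 else hval (j - 1) ?z (Du u \<beta>))"
    proof (cases j)
      case (Suc j')
      have "(\<Sum>i\<in>UNIV. u $ i * (\<Sum>K\<in>degbox j. ?c (inc K i) * dpow ?z K)) = (\<Sum>i\<in>UNIV. u $ i * (\<Sum>K\<in>graded j'. \<beta> (inc K i) * dpow ?z K))"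
        by (intro sum.cong refl arg_cong2[where f = "(*)"] sum.mono_neutral_cong_right) (auto simp: graded_def degbox_def Suc)
      also have "\<dots> = hval j' ?z (Du u \<beta>)"
        unfolding hval_def Du_def sum_distrib_left sum_distrib_right by (subst sum.swap) (simp add: mult_ac)
      finally show ?thesis using Suc by simp
    qed simp
    finally show ?thesis .
  qed
  ultimately show ?thesis by simp
qed

text \<open>The series can be differentiated termwise along a line, and the derivative of the zero function is zero.\<close>
lemma vanish_derivative:
  assumes \<beta>: "growth \<beta>" and zero: "\<And>t. (\<lambda>j. hval j (z + t *s u) \<beta>) sums 0"
  shows "(\<lambda>j. hval j z (Du u \<beta>)) sums 0"
proof -
  let ?f = "\<lambda>j t. hval j (z + t *s u) \<beta>"
  let ?f' = "\<lambda>j t. if j = 0 then 0 else hval (j - 1) (z + t *s u) (Du u \<beta>)"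
  have "\<exists>g g'. \<forall>t\<in>UNIV. ((\<lambda>n. ?f n t) sums g t) \<and> ((\<lambda>n. ?f' n t) sums g' t) \<and> (g has_field_derivative g' t) (at t)"
  proof (rule series_and_derivative_comparison_local[OF open_UNIV])
    show "(?f n has_field_derivative ?f' n t) (at t)" for n t by (rule DERIV_hval_line)
    fix t :: complex
    obtain h where h: "summable h" "\<And>j y. norm y \<le> norm z + (norm t + 1) * norm u \<Longrightarrow> norm (hval j y \<beta>) \<le> h j"
      using hval_majorant[OF \<beta>, of "norm z + (norm t + 1) * norm u"] by blast
    have "norm (?f n s) \<le> h n" if "s \<in> ball t 1" for n s
    proof (rule h(2))
      have "norm s \<le> norm t + 1"
        using that norm_triangle_ineq2[of s t] by (simp add: dist_norm norm_minus_commute)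
      have "norm (s *s u) = norm s * norm u"
      proof -
        have "norm (s *s u) = L2_set (\<lambda>i. norm s * norm (u $ i)) UNIV" by (simp add: norm_vec_def norm_mult)
        then show ?thesis by (simp add: norm_vec_def L2_set_right_distrib)
      qed
      moreover have "norm s * norm u \<le> (norm t + 1) * norm u"
        using \<open>norm s \<le> norm t + 1\<close> by (intro mult_right_mono) auto
      ultimately show "norm (z + s *s u) \<le> norm z + (norm t + 1) * norm u"
        by (metis add_left_mono norm_triangle_ineq order_trans)
    qed
    then show "\<exists>d h. 0 < d \<and> summable h \<and> (\<forall>\<^sub>F n in sequentially. \<forall>y\<in>ball t d \<inter> UNIV. norm (?f n y) \<le> h n)"
      using h(1) by (intro exI[of _ 1] exI[of _ h]) auto
  qed
  then obtain g g' where g: "\<And>t. (\<lambda>n. ?f n t) sums g t" "\<And>t. (\<lambda>n. ?f' n t) sums g' t" "\<And>t. (g has_field_derivative g' t) (at t)"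
    by blast
  have "g = (\<lambda>_. 0)" using g(1) zero sums_unique2 by blast
  then have "g' 0 = 0" using g(3)[of 0] DERIV_const[of 0 "at 0"] DERIV_unique by blast
  then have "(\<lambda>n. ?f' n 0) sums 0" using g(2)[of 0] by simp
  then have "(\<lambda>n. ?f' (Suc n) 0) sums (0 - ?f' 0 0)" by (subst sums_Suc_iff) simp
  then show ?thesis by simp
qed

text \<open>The set \<open>W\<close> of displacements is closed under steps in the directions \<open>V k\<close>, so vanishing on \<open>w + W\<close>
  is inherited by all derivatives along these directions.\<close>
lemma vanish_derivatives:
  fixes V :: "'k \<Rightarrow> complex ^ 'i::finite"
  assumes W: "\<And>u k t. u \<in> W \<Longrightarrow> u + t *s V k \<in> W"
  shows "growth \<beta> \<Longrightarrow> (\<And>u. u \<in> W \<Longrightarrow> (\<lambda>j. hval j (w + u) \<beta>) sums 0) \<Longrightarrow> u \<in> W \<Longrightarrow>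
    (\<lambda>j. hval j (w + u) (Dus V ks \<beta>)) sums 0"
proof (induction ks arbitrary: \<beta> u)
  case (Cons k ks)
  have "(\<lambda>j. hval j (w + u) (Du (V k) \<beta>)) sums 0" if "u \<in> W" for u
    by (rule vanish_derivative[OF Cons.prems(1)]) (use Cons.prems(2)[OF W[OF that]] in \<open>simp add: add.assoc\<close>)
  then show ?case using Cons.IH[of "Du (V k) \<beta>" u] growth_Du[OF Cons.prems(1)] Cons.prems(3) by simp
qed simp

lemma growth_amp:
  assumes "a \<in> hat"
  shows "growth (\<lambda>K. pochhammer x (mdeg K) * rowsum \<zeta> a K)"
proof -
  obtain B where B: "bnd (1/2) B a" using hatD(2)[OF assms, of "1/2"] by auto
  let ?Q = "facbase TYPE('a)"
  have Q: "?Q \<ge> 0" using facbase_ge_1[where ?'i='a] by simp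
  have B0: "B \<ge> 0" by (rule bnd_nonneg[OF B])
  have "norm (pochhammer x (mdeg K) * rowsum \<zeta> a K) \<le> B * ((1 + norm x) * ?Q * (?Q * norm \<zeta>)) ^ mdeg K * fact (mdeg K) powr (1/2)" for K
  proof -
    let ?g = "mdeg K"
    have "norm (rowsum \<zeta> a K) \<le> (\<Sum>L\<in>(graded ?g :: ('a \<Rightarrow> nat) set). (B * fact ?g powr (1/2)) * ((?Q * norm \<zeta>) ^ ?g / fact ?g))"
      unfolding rowsum_def
    proof (intro sum_norm_le)
      fix L :: "'a \<Rightarrow> nat" assume "L \<in> graded ?g"
      then have L: "mdeg L = ?g" by (simp add: graded_def)
      show "norm (a K L * dpow \<zeta> L) \<le> (B * fact ?g powr (1/2)) * ((?Q * norm \<zeta>) ^ ?g / fact ?g)"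
        unfolding norm_mult using B B0 norm_dpow_le[of \<zeta> "norm \<zeta>" L, OF norm_component_le_norm] L
        by (intro mult_mono) (auto simp: bnd_def)
    qed
    also have "\<dots> = real (card (graded ?g :: ('a \<Rightarrow> nat) set)) * ((B * fact ?g powr (1/2)) * ((?Q * norm \<zeta>) ^ ?g / fact ?g))"
      by simp
    also have "\<dots> \<le> ?Q ^ ?g * ((B * fact ?g powr (1/2)) * ((?Q * norm \<zeta>) ^ ?g / fact ?g))"
      using B0 Q by (intro mult_right_mono card_graded_le) auto
    finally have "norm (pochhammer x ?g * rowsum \<zeta> a K) \<le> (fact ?g * (1 + norm x) ^ ?g) * (?Q ^ ?g * ((B * fact ?g powr (1/2)) * ((?Q * norm \<zeta>) ^ ?g / fact ?g)))"
      unfolding norm_mult using norm_pochhammer_le[of x ?g] by (intro mult_mono) auto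
    also have "\<dots> = B * ((1 + norm x) * ?Q * (?Q * norm \<zeta>)) ^ ?g * fact ?g powr (1/2)"
      by (simp add: power_mult_distrib mult_ac)
    finally show ?thesis .
  qed
  then show ?thesis using B0 Q unfolding growth_def
    by (intro exI[of _ B] conjI exI[of _ "(1 + norm x) * ?Q * (?Q * norm \<zeta>)"]) auto
qed

lemma hval_hpart: "hval j z (\<lambda>K. pochhammer x (mdeg K) * rowsum \<zeta> a K) = pochhammer x j * hpart j a z \<zeta>"
  unfolding hval_def hpart_def rowsum_def sum_distrib_left sum_distrib_right
  by (intro sum.cong refl) (auto simp: graded_def mult_ac)

lemma Du_cmult: "Du u (\<lambda>K. c * \<alpha> K) = (\<lambda>K. c * Du u \<alpha> K)"
  by (simp add: Du_def sum_distrib_left mult_ac fun_eq_iff)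

lemma Dus_cmult: "Dus V ks (\<lambda>K. c * \<alpha> K) = (\<lambda>K. c * Dus V ks \<alpha> K)"
  by (induction ks arbitrary: \<alpha>) (simp_all add: Du_cmult)

lemma Dus_local:
  "(\<And>K. mdeg K = g \<Longrightarrow> \<alpha> K = \<beta> K) \<Longrightarrow> mdeg K + length ks = g \<Longrightarrow> Dus V ks \<alpha> K = Dus V ks \<beta> K"
proof (induction ks arbitrary: \<alpha> \<beta> g)
  case (Cons k ks)
  have "Du (V k) \<alpha> K = Du (V k) \<beta> K" if "mdeg K = g - 1" for K
    unfolding Du_def
  proof (intro sum.cong refl arg_cong2[where f = "(*)"] Cons.prems(1))
    have "g \<ge> 1" using Cons.prems(2) by simp
    then show "mdeg (inc K i) = g" for i unfolding mdeg_inc using that by simp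
  qed
  then show ?case using Cons.IH[of "g - 1" "Du (V k) \<alpha>" "Du (V k) \<beta>"] Cons.prems(2) by simp
qed simp

text \<open>A derivative along a word lowers the degree by its length; thus the \<open>amp\<close> are the homogeneous values
  of one fixed derived array, shifted in the order.\<close>
lemma amp_eq_hval:
  "amp t w V js g a = (if g < length js then 0 else
     hval (g - length js) w (Dus V js (\<lambda>K. pochhammer (of_real t) (mdeg K) * rowsum (cnjv w) a K)))"
proof (cases "g < length js")
  case True
  then show ?thesis
    using Dus_hdeg_0[OF hdeg_rowsum[OF bideg_piece[of g a]], of js V "cnjv w"] by (simp add: amp_def pval_def)
next
  case False
  let ?\<alpha> = "rowsum (cnjv w) (piece g a)" and ?\<beta> = "\<lambda>K. pochhammer (complex_of_real t) (mdeg K) * rowsum (cnjv w) a K"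
  have loc: "pochhammer (of_real t) g * ?\<alpha> K = ?\<beta> K" if "mdeg K = g" for K
    using that by (simp add: rowsum_def piece_def graded_def)
  have hd: "hdeg (g - length js) (Dus V js ?\<alpha>)"
    by (rule Dus_hdeg[OF hdeg_rowsum[OF bideg_piece]])
  have "amp t w V js g a = pval g w (Dus V js (\<lambda>K. pochhammer (of_real t) g * ?\<alpha> K))"
    unfolding amp_def Dus_cmult by (simp add: pval_def sum_distrib_left mult_ac)
  also have "\<dots> = (\<Sum>K\<in>graded (g - length js). Dus V js (\<lambda>K. pochhammer (of_real t) g * ?\<alpha> K) K * dpow w K)"
    unfolding pval_def by (rule sum.mono_neutral_right) (use hd in \<open>auto simp: Dus_cmult hdeg_def graded_def degbox_def\<close>)
  also have "\<dots> = hval (g - length js) w (Dus V js ?\<beta>)"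
    unfolding hval_def
    by (intro sum.cong refl arg_cong2[where f = "(*)"] Dus_local[of g, OF loc]) (use False in \<open>auto simp: graded_def\<close>)
  finally show ?thesis using False by simp
qed

lemma amp_sums_0:
  fixes a :: "'n::finite option arr"
  assumes a: "a \<in> hat" and zero: "\<And>z. yfun z = 1 \<Longrightarrow> eval_series (of_real t) a z (cnjv z) = 0"
    and w: "yfun w = 1" and V: "\<And>k. herm (V k) w = 0"
  shows "(\<lambda>g. amp t w V js g a) sums 0"
proof -
  let ?\<beta> = "\<lambda>K. pochhammer (complex_of_real t) (mdeg K) * rowsum (cnjv w) a K"
  have "(\<lambda>j. hval j (w + 0) (Dus V js ?\<beta>)) sums 0"
  proof (rule vanish_derivatives[where W = "{u. herm u w = 0}"])
    show "growth ?\<beta>" by (rule growth_amp[OF a])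
    show "(\<lambda>j. hval j (w + u) ?\<beta>) sums 0" if "u \<in> {u. herm u w = 0}" for u
      unfolding hval_hpart using eval_series_sums[OF a, of "of_real t" "w + u" "cnjv w"] eval_series_tangent[OF a zero w, of u] that by simp
    show "u + t *s V k \<in> {u. herm u w = 0}" if "u \<in> {u. herm u w = 0}" for u k t
    proof -
      have "herm (u + t *s V k) w = herm u w + t * herm (V k) w"
        by (simp add: herm_def algebra_simps sum.distrib sum_distrib_left)
      then show ?thesis using that V by simp
    qed
  qed (simp add: herm_def)
  then have "(\<lambda>i. amp t w V js (i + length js) a) sums 0" by (simp add: amp_eq_hval)
  then show ?thesis by (subst (asm) sums_zero_iff_shift) (simp_all add: amp_eq_hval)
qed

section \<open>A frame at a point of the level set\<close>

text \<open>The columns of a Lorentz boost that maps the first coordinate vector to \<open>w\<close>; the phase of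
  \<open>w $ None\<close> is multiplied into its first row.\<close>
definition boost :: "'n::finite pt \<Rightarrow> 'n option \<Rightarrow> 'n pt" where
  "boost w k = (case k of None \<Rightarrow> w | Some k \<Rightarrow> (\<chi> i. case i of
     None \<Rightarrow> w $ None / of_real (cmod (w $ None)) * cnj (w $ Some k)
   | Some j \<Rightarrow> (if j = k then 1 else 0) + w $ Some j * cnj (w $ Some k) / of_real (1 + cmod (w $ None))))"

lemma boost_simps:
  "boost w None = w"
  "boost w (Some k) $ None = w $ None / of_real (cmod (w $ None)) * cnj (w $ Some k)"
  "boost w (Some k) $ Some j = (if j = k then 1 else 0) + w $ Some j * cnj (w $ Some k) / of_real (1 + cmod (w $ None))"
  by (simp_all add: boost_def)

lemma
  fixes w :: "'n::finite pt"
  assumes w: "yfun w = 1"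
  shows frame_boost: "frame (boost w)" and herm_boost: "herm (boost w (Some k)) w = 0"
proof -
  define r where "r = cmod (w $ None)"
  define S where "S = (\<Sum>i\<in>(UNIV :: 'n set). w $ Some i * cnj (w $ Some i))"
  define c where "c = complex_of_real (1 / (1 + r))"
  define \<theta> where "\<theta> = w $ None / of_real r"
  have r0: "r \<ge> 0" by (simp add: r_def)
  have Sr: "S = of_real (r\<^sup>2 - 1)"
  proof -
    have "S = of_real (\<Sum>i\<in>(UNIV :: 'n set). (cmod (w $ Some i))\<^sup>2)" by (simp add: S_def complex_norm_square del: of_real_power)
    also have "(\<Sum>i\<in>(UNIV :: 'n set). (cmod (w $ Some i))\<^sup>2) = r\<^sup>2 - 1" using w by (simp add: yfun_def r_def)
    finally show ?thesis .
  qed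
  have r1: "r \<ge> 1"
  proof -
    have "r\<^sup>2 \<ge> 1" using w sum_nonneg[of "UNIV :: 'n set" "\<lambda>i. (cmod (w $ Some i))\<^sup>2"] by (simp add: yfun_def r_def)
    then show ?thesis using r0 by (intro power2_le_imp_le[of 1 r]) auto
  qed
  have cS: "c * S = of_real (r - 1)"
  proof -
    have "r\<^sup>2 - 1 = (1 + r) * (r - 1)" by (simp add: power2_eq_square algebra_simps)
    then have "(1 / (1 + r)) * (r\<^sup>2 - 1) = r - 1" using r1 by simp
    then show ?thesis unfolding c_def Sr by (metis of_real_mult)
  qed
  have cc: "2 * c + c * (c * S) = 1"
  proof -
    have "2 * (1 / (1 + r)) + (1 / (1 + r)) * (r - 1) = (1 / (1 + r)) * (1 + r)" by (simp only: algebra_simps)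
    also have "\<dots> = 1" using r1 by simp
    finally have "2 * (1 / (1 + r)) + (1 / (1 + r)) * (r - 1) = 1" .
    then show ?thesis unfolding cS unfolding c_def by (metis of_real_mult of_real_add of_real_1 of_real_numeral)
  qed
  have cnjc: "cnj c = c" by (simp add: c_def)
  have w0: "w $ None * cnj (w $ None) = of_real (r\<^sup>2)" unfolding r_def complex_norm_square ..
  have \<theta>w: "\<theta> * cnj (w $ None) = of_real r"
    using w0 r1 by (simp add: \<theta>_def field_simps power2_eq_square)
  have \<theta>w': "\<theta> * of_real r = w $ None" using r1 by (simp add: \<theta>_def)
  have \<theta>\<theta>: "\<theta> * cnj \<theta> = 1" using w0 r1 by (simp add: \<theta>_def power2_eq_square field_simps)
  have b: "boost w (Some k) $ None = \<theta> * cnj (w $ Some k)"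
    "boost w (Some k) $ Some j = (if j = k then 1 else 0) + c * w $ Some j * cnj (w $ Some k)" for j k
    by (simp_all add: boost_simps \<theta>_def c_def r_def)
  have delta: "(\<Sum>j\<in>UNIV. (if j = k then 1 else 0) * f j) = f k" "(\<Sum>j\<in>UNIV. (if k = j then 1 else 0) * f j) = f k"
    "(\<Sum>j\<in>UNIV. f j * (if j = k then 1 else 0)) = f k" "(\<Sum>j\<in>UNIV. f j * (if k = j then 1 else 0)) = f k" for k :: 'n and f :: "'n \<Rightarrow> complex"
    by (simp_all add: if_distrib[of "\<lambda>x. x * _"] if_distrib[of "\<lambda>x. _ * x"] cong: if_cong)
  show "herm (boost w (Some k)) w = 0"
  proof -
    have "(\<Sum>j\<in>UNIV. boost w (Some k) $ Some j * cnj (w $ Some j)) = (\<Sum>j\<in>UNIV. (if j = k then 1 else 0) * cnj (w $ Some j)) + c * cnj (w $ Some k) * S"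
      unfolding b S_def sum_distrib_left sum.distrib[symmetric] by (intro sum.cong refl) (simp add: algebra_simps)
    also have "\<dots> = cnj (w $ Some k) + cnj (w $ Some k) * (c * S)" unfolding delta by simp
    also have "\<dots> = cnj (w $ Some k) * of_real r" unfolding cS by (simp add: algebra_simps)
    finally show ?thesis
      unfolding herm_def b using \<theta>w by (simp add: mult_ac)
  qed
  show "frame (boost w)"
    unfolding frame_def
  proof (intro allI)
    fix i j :: "'n option"
    have expand: "(\<Sum>k\<in>UNIV. metric k k * (boost w k $ i * cnj (boost w k $ j))) =
      - (w $ i * cnj (w $ j)) + (\<Sum>k\<in>UNIV. boost w (Some k) $ i * cnj (boost w (Some k) $ j))"
      by (simp add: sum_option metric_def boost_simps(1))
    have NN: "(\<Sum>k\<in>UNIV. boost w (Some k) $ None * cnj (boost w (Some k) $ None)) = S"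
    proof -
      have "boost w (Some k) $ None * cnj (boost w (Some k) $ None) = (\<theta> * cnj \<theta>) * (w $ Some k * cnj (w $ Some k))" for k
        by (simp add: b)
      then show ?thesis by (simp add: \<theta>\<theta> S_def)
    qed
    have SN: "(\<Sum>k\<in>UNIV. boost w (Some k) $ Some j * cnj (boost w (Some k) $ None)) = w $ Some j * cnj (w $ None)" for j
    proof -
      have "(\<Sum>k\<in>UNIV. boost w (Some k) $ Some j * cnj (boost w (Some k) $ None)) =
        cnj \<theta> * ((\<Sum>k\<in>UNIV. (if j = k then 1 else 0) * w $ Some k) + w $ Some j * (c * S))"
        unfolding b S_def sum_distrib_left sum.distrib[symmetric] by (intro sum.cong refl) (simp add: algebra_simps)
      also have "\<dots> = w $ Some j * cnj (\<theta> * of_real r)" unfolding delta cS by (simp add: algebra_simps)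
      finally show ?thesis unfolding \<theta>w' .
    qed
    have NS: "(\<Sum>k\<in>UNIV. boost w (Some k) $ None * cnj (boost w (Some k) $ Some j)) = w $ None * cnj (w $ Some j)" for j
    proof -
      have "(\<Sum>k\<in>UNIV. boost w (Some k) $ None * cnj (boost w (Some k) $ Some j)) = cnj (\<Sum>k\<in>UNIV. boost w (Some k) $ Some j * cnj (boost w (Some k) $ None))"
        by (simp add: mult.commute)
      then show ?thesis unfolding SN by simp
    qed
    have SS: "(\<Sum>k\<in>UNIV. boost w (Some k) $ Some i * cnj (boost w (Some k) $ Some j)) = (if i = j then 1 else 0) + w $ Some i * cnj (w $ Some j)" for i j
    proof -
      have "(\<Sum>k\<in>UNIV. boost w (Some k) $ Some i * cnj (boost w (Some k) $ Some j)) =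
        (\<Sum>k\<in>UNIV. (if i = k then 1 else 0) * (if j = k then 1 else 0)) +
        (\<Sum>k\<in>UNIV. (if i = k then 1 else 0) * (c * cnj (w $ Some j) * w $ Some k)) +
        (\<Sum>k\<in>UNIV. (if j = k then 1 else 0) * (c * w $ Some i * cnj (w $ Some k))) +
        c * w $ Some i * (c * cnj (w $ Some j)) * S"
        unfolding b S_def sum_distrib_left sum.distrib[symmetric] by (intro sum.cong refl) (simp add: algebra_simps cnjc)
      also have "\<dots> = (if i = j then 1 else 0) + w $ Some i * cnj (w $ Some j) * (2 * c + c * (c * S))"
        unfolding delta by (simp add: algebra_simps eq_commute)
      finally show ?thesis unfolding cc by simp
    qed
    show "(\<Sum>k\<in>UNIV. metric k k * (boost w k $ i * cnj (boost w k $ j))) = metric i j"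
      unfolding expand
      by (cases i; cases j) (simp_all add: NN SN NS SS metric_def w0 Sr)
  qed
qed

section \<open>Positivity on the disc\<close>

lemma eval_series_add:
  assumes "a \<in> hat" "b \<in> hat"
  shows "eval_series x (\<lambda>K L. a K L + b K L) z \<zeta> = eval_series x a z \<zeta> + eval_series x b z \<zeta>"
  using eval_series_diff[OF hat_add[OF assms] assms(2), of x z \<zeta>] by simp

lemma fA_add:
  assumes "a \<in> hat" "b \<in> hat"
  shows "fA h (\<lambda>K L. a K L + b K L) = (\<lambda>z. fA h a z + fA h b z)"
proof
  fix z show "fA h (\<lambda>K L. a K L + b K L) z = fA h a z + fA h b z"
    using assms by (cases "z \<in> cone") (simp_all add: fA_series hat_add eval_series_add fA_off_cone)
qed

lemma cnj_eval_series:
  assumes "a \<in> hat"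
  shows "cnj (eval_series (of_real x) a z (of_real r *s cnjv z)) = eval_series (of_real x) (dag a) z (of_real r *s cnjv z)"
proof -
  have "cnj (hpart g a z (cnjv z)) = hpart g (dag a) z (cnjv z)" for g
  proof -
    have "cnj (hpart g a z (cnjv z)) = (\<Sum>K\<in>graded g. \<Sum>L\<in>graded g. dag a L K * dpow z L * dpow (cnjv z) K)"
      unfolding hpart_def cnj_sum by (simp add: dag_def dpow_cnjv mult_ac)
    also have "\<dots> = hpart g (dag a) z (cnjv z)" unfolding hpart_def by (rule sum.swap)
    finally show ?thesis .
  qed
  then have *: "cnj (hpart g a z (of_real r *s cnjv z)) = hpart g (dag a) z (of_real r *s cnjv z)" for g
    using hpart_scale[of g a 1 z "of_real r" "cnjv z"] hpart_scale[of g "dag a" 1 z "of_real r" "cnjv z"] by simp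
  have "(\<lambda>g. cnj (pochhammer (of_real x) g * hpart g a z (of_real r *s cnjv z))) sums cnj (eval_series (of_real x) a z (of_real r *s cnjv z))"
    unfolding sums_cnj by (rule eval_series_sums[OF assms])
  then have "(\<lambda>g. pochhammer (of_real x) g * hpart g (dag a) z (of_real r *s cnjv z)) sums cnj (eval_series (of_real x) a z (of_real r *s cnjv z))"
    by (simp add: * pochhammer_of_real)
  then show ?thesis using eval_series_sums[OF dag_hat[OF assms]] sums_unique2 by blast
qed

lemma cnj_fA: "a \<in> hat \<Longrightarrow> (\<lambda>z. cnj (fA h a z)) = fA h (dag a)"
proof
  fix z assume a: "a \<in> hat"
  show "cnj (fA h a z) = fA h (dag a) z"
  proof (cases "z \<in> cone")
    case True
    have "(1 / complex_of_real (yfun z)) = of_real (1 / yfun z)" by simp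
    then show ?thesis
      unfolding fA_series[OF a True] fA_series[OF dag_hat[OF a] True] by (simp only: cnj_eval_series[OF a])
  qed (simp add: fA_off_cone)
qed

lemma fA_level:
  assumes "a \<in> hat" "yfun w = 1"
  shows "fA h a w = level_val (1 / (2 * h)) a w"
  using fA_series[OF assms(1), of w h] assms(2) by (simp add: cone_def)

definition null :: "real \<Rightarrow> 'n::finite option arr \<Rightarrow> bool" where
  "null h a \<longleftrightarrow> a \<in> hat \<and> (\<forall>w. yfun w = 1 \<longrightarrow> level_val (1 / (2 * h)) a w = 0)"

lemma van_ideal_eq: "van_ideal h = fA h ` {i. null h i}"
  by (auto simp: van_ideal_def hat_C_iff null_def fA_level)

lemma null_dag: "null h a \<Longrightarrow> null h (dag a)"
proof -
  assume a: "null h a"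
  then have "cnj (level_val (1 / (2 * h)) a w) = level_val (1 / (2 * h)) (dag a) w" for w
    using cnj_eval_series[of a "1 / (2 * h)" w 1] by (simp add: null_def)
  with a show ?thesis unfolding null_def using dag_hat by (metis complex_cnj_zero)
qed

text \<open>For a null left factor all derivatives in the tangential directions of the boost frame vanish; a
  null right factor is reduced to this by Hermitian symmetry.\<close>
lemma null_star_eq_0:
  fixes w :: "'n::finite pt"
  assumes h: "h > 0" and i: "null h i" and d: "d \<in> hat" and w: "yfun w = 1"
  shows "level_val (1 / (2 * h)) (star i d) w = 0"
    "level_val (1 / (2 * h)) (star d i) w = 0"
proof -
  have t: "1 / (2 * h) > 0" using h by simp
  have left: "level_val (1 / (2 * h)) (star i d) w = 0" if "null h i" "d \<in> hat" for i d
  proof (rule eval_star_eq_0[OF _ that(2) frame_boost[OF w] boost_simps(1) t])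
    show "i \<in> hat" using that by (simp add: null_def)
    show "(\<lambda>g. amp (1 / (2 * h)) w (\<lambda>k. boost w (Some k)) js g i) sums 0" for js
      by (rule amp_sums_0[OF _ _ w herm_boost[OF w]]) (use that in \<open>auto simp: null_def\<close>)
  qed
  show "level_val (1 / (2 * h)) (star i d) w = 0" by (rule left[OF i d])
  have "i \<in> hat" using i by (simp add: null_def)
  then show "level_val (1 / (2 * h)) (star d i) w = 0"
    using eval_star_hermitian[OF d _ frame_boost[OF w] boost_simps(1) t, of i] left[OF null_dag[OF i] dag_hat[OF d]] by simp
qed

text \<open>Two points of the level set over the same point of the disc differ by a phase, which drops out of
  functions that are invariant under \<open>U(1)\<close>.\<close>
lemma eval_series_fibre:
  assumes "yfun w = 1" "yfun w' = 1" "proj w = proj w'"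
  shows "eval_series x a w (cnjv w) = eval_series x a w' (cnjv w')"
proof -
  have ne: "z $ None \<noteq> 0" if "yfun z = 1" for z :: "'a pt"
  proof
    assume "z $ None = 0"
    then have "yfun z \<le> 0" by (simp add: yfun_def sum_nonneg)
    then show False using that by simp
  qed
  define l where "l = w $ None / w' $ None"
  have "w = l *s w'"
  proof -
    have "w $ i = l * w' $ i" for i
    proof (cases i)
      case (Some j)
      have "w $ Some j / w $ None = w' $ Some j / w' $ None" using assms(3) by (simp add: proj_def vec_eq_iff)
      then show ?thesis using Some ne[OF assms(1)] ne[OF assms(2)] by (simp add: l_def field_simps)
    qed (use ne[OF assms(2)] in \<open>simp add: l_def\<close>)
    then show ?thesis by (simp add: vec_eq_iff)
  qed
  moreover from this have "(cmod l)\<^sup>2 = 1" using assms by (simp add: yfun_scale)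
  then have "l * cnj l = 1" by (metis complex_norm_square of_real_1)
  ultimately show ?thesis using eval_series_scale[of l "cnj l" x a w' "cnjv w'"] by (simp add: cnjv_scale)
qed

lemma disc_fibre:
  fixes v :: "complex ^ 'n::finite"
  assumes "v \<in> disc"
  obtains w where "yfun w = 1" "proj w = v"
proof -
  define N where "N = (norm v)\<^sup>2"
  have N: "N < 1" using assms by (simp add: disc_def N_def)
  have Nsum: "N = (\<Sum>i\<in>UNIV. (cmod (v $ i))\<^sup>2)"
    by (simp add: N_def norm_vec_def L2_set_def sum_nonneg)
  define u :: "'n pt" where "u = (\<chi> i. case i of None \<Rightarrow> 1 | Some j \<Rightarrow> v $ j)"
  define r where "r = 1 / sqrt (1 - N)"
  have r: "r > 0" "r\<^sup>2 * (1 - N) = 1" using N by (simp_all add: r_def power_divide)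
  have "yfun u = 1 - N" by (simp add: yfun_def u_def Nsum)
  then have "yfun (of_real r *s u) = 1" using r by (simp add: yfun_scale)
  moreover have "proj (of_real r *s u) = v" using r by (simp add: proj_def u_def vec_eq_iff)
  ultimately show ?thesis using that by blast
qed

theorem corollary5p22:
  fixes h :: real
  assumes "h > 0"
  shows "\<forall>v \<in> (disc :: (complex ^ 'n::finite) set). \<forall>a \<in> carrier (hat_D_ring h).
           eval_D v (conj_D a \<otimes>\<^bsub>hat_D_ring h\<^esub> a) \<in> \<real>\<^sub>\<ge>\<^sub>0"
proof (intro ballI)
  fix v :: "complex ^ 'n" and A :: "'n fn set"
  assume v: "v \<in> disc" and A: "A \<in> carrier (hat_D_ring h)"
  note h = assms
  let ?t = "1 / (2 * h)"
  have t: "?t > 0" using h by simp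
  \<comment> \<open>A coset is the translate of the null functions by one representative \<open>a0\<close>.\<close>
  obtain a0 where a0: "a0 \<in> hat" and A_eq: "A = (\<lambda>i. (\<lambda>z. fA h i z + fA h a0 z)) ` {i. null h i}"
  proof -
    from A obtain f where f: "f \<in> hat_C h" "A = (\<Union>i\<in>van_ideal h. {\<lambda>z. i z + f z})"
      by (auto simp: hat_D_ring_def FactRing_def A_RCOSETS_def' hat_C_ring_def a_r_coset_def')
    then obtain a0 where "a0 \<in> hat" "f = fA h a0" using hat_C_iff by blast
    with f(2) show ?thesis by (intro that[of a0]) (auto simp: van_ideal_eq)
  qed
  have mult: "conj_D A \<otimes>\<^bsub>hat_D_ring h\<^esub> A =
     (\<Union>p\<in>conj_D A. \<Union>q\<in>A. \<Union>i\<in>van_ideal h. {\<lambda>z. i z + hat_prod h p q z})"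
    by (simp add: hat_D_ring_def FactRing_def rcoset_mult_def a_r_coset_def' hat_C_ring_def)
  obtain w0 :: "'n pt" where w0: "yfun w0 = 1" "proj w0 = v" using disc_fibre[OF v] .
  define x0 where "x0 = level_val ?t (star (dag a0) a0) w0"
  \<comment> \<open>All functions in the product of cosets take the same value on the whole fibre over \<open>v\<close>.\<close>
  have rep: "f w = x0" if f: "f \<in> conj_D A \<otimes>\<^bsub>hat_D_ring h\<^esub> A" and w: "proj w = v" "yfun w = 1" for f w
  proof -
    obtain i i1 i2 where i: "null h i" "null h i1" "null h i2"
      and f_eq: "f = (\<lambda>z. fA h i z + hat_prod h (\<lambda>z. cnj (fA h i1 z + fA h a0 z)) (\<lambda>z. fA h i2 z + fA h a0 z) z)"
    proof -
      obtain p q j where pqj: "p \<in> conj_D A" "q \<in> A" "j \<in> van_ideal h" "f = (\<lambda>z. j z + hat_prod h p q z)"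
        using f unfolding mult by blast
      obtain i1 where "null h i1" "p = (\<lambda>z. cnj (fA h i1 z + fA h a0 z))"
        using pqj(1) unfolding conj_D_def A_eq by blast
      moreover obtain i2 where "null h i2" "q = (\<lambda>z. fA h i2 z + fA h a0 z)"
        using pqj(2) unfolding A_eq by blast
      moreover obtain i where "null h i" "j = fA h i" using pqj(3) unfolding van_ideal_eq by blast
      ultimately show ?thesis using that pqj(4) by simp
    qed
    have hat: "i \<in> hat" "i1 \<in> hat" "i2 \<in> hat" using i by (simp_all add: null_def)
    let ?p = "\<lambda>K L. dag i1 K L + dag a0 K L" and ?q = "\<lambda>K L. i2 K L + a0 K L"
    have pq: "?p \<in> hat" "?q \<in> hat" using hat a0 by (intro hat_add dag_hat; simp)+
    have "(\<lambda>z. cnj (fA h i1 z + fA h a0 z)) = fA h ?p"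
    proof -
      have "(\<lambda>z. cnj (fA h i1 z + fA h a0 z)) = (\<lambda>z. fA h (dag i1) z + fA h (dag a0) z)"
        using cnj_fA[OF hat(2), of h] cnj_fA[OF a0, of h] by (simp add: fun_eq_iff)
      then show ?thesis using fA_add[OF dag_hat[OF hat(2)] dag_hat[OF a0], of h] by simp
    qed
    moreover have "(\<lambda>z. fA h i2 z + fA h a0 z) = fA h ?q"
      using fA_add[OF hat(3) a0, of h] by simp
    ultimately have "f w = fA h i w + fA h (star ?p ?q) w"
      unfolding f_eq using hat_prod_fA[OF h pq] by simp
    also have "fA h i w = 0" using i(1) w(2) by (simp add: fA_level null_def)
    also have "fA h (star ?p ?q) w = level_val ?t (star ?p ?q) w"
      by (rule fA_level[OF star_hat[OF pq] w(2)])
    also have "star ?p ?q = (\<lambda>K L. star (dag i1) ?q K L + (star (dag a0) i2 K L + star (dag a0) a0 K L))"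
    proof (intro ext)
      fix K L
      show "star ?p ?q K L = star (dag i1) ?q K L + (star (dag a0) i2 K L + star (dag a0) a0 K L)"
        using star_lin_left[of "dag i1" 1 "dag a0" ?q K L] star_lin_right[of "dag a0" i2 1 a0 K L] by simp
    qed
    also have "level_val ?t \<dots> w =
       level_val ?t (star (dag i1) ?q) w +
       (level_val ?t (star (dag a0) i2) w + level_val ?t (star (dag a0) a0) w)"
    proof -
      have s: "star (dag i1) ?q \<in> hat" "star (dag a0) i2 \<in> hat" "star (dag a0) a0 \<in> hat"
        using hat a0 pq by (intro star_hat dag_hat; simp)+
      show ?thesis unfolding eval_series_add[OF s(1) hat_add[OF s(2,3)]] eval_series_add[OF s(2,3)] ..
    qed
    also have "level_val ?t (star (dag i1) ?q) w = 0"
      by (rule null_star_eq_0(1)[OF h null_dag[OF i(2)] pq(2) w(2)])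
    also have "level_val ?t (star (dag a0) i2) w = 0"
      by (rule null_star_eq_0(2)[OF h i(3) dag_hat[OF a0] w(2)])
    also have "level_val ?t (star (dag a0) a0) w = x0"
      unfolding x0_def by (rule eval_series_fibre) (use w w0 in auto)
    finally show ?thesis by simp
  qed
  \<comment> \<open>The product is nonempty, so that the common value is unique.\<close>
  have "\<exists>f. f \<in> conj_D A \<otimes>\<^bsub>hat_D_ring h\<^esub> A"
  proof -
    have "null h ((\<lambda>_ _. 0) :: 'n option arr)"
      using supp_box_hat[of "\<lambda>_ _. 0" 0] by (simp add: null_def eqdeg_def supp_box_def eval_series_def hpart_def)
    then have "van_ideal h \<noteq> ({} :: 'n fn set)" "A \<noteq> {}" unfolding van_ideal_eq A_eq by blast+
    moreover from this have "conj_D A \<noteq> {}" by (simp add: conj_D_def)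
    ultimately show ?thesis unfolding mult by blast
  qed
  then obtain f where f: "f \<in> conj_D A \<otimes>\<^bsub>hat_D_ring h\<^esub> A" ..
  have "eval_D v (conj_D A \<otimes>\<^bsub>hat_D_ring h\<^esub> A) = x0"
    unfolding eval_D_def
  proof (rule the_equality)
    show "\<forall>f\<in>conj_D A \<otimes>\<^bsub>hat_D_ring h\<^esub> A. \<forall>w. proj w = v \<and> yfun w = 1 \<longrightarrow> f w = x0" using rep by blast
    fix x assume "\<forall>f\<in>conj_D A \<otimes>\<^bsub>hat_D_ring h\<^esub> A. \<forall>w. proj w = v \<and> yfun w = 1 \<longrightarrow> f w = x"
    then have "f w0 = x" using f w0 by blast
    then show "x = x0" using rep[OF f w0(2,1)] by simp
  qed
  moreover have "x0 \<in> \<real>\<^sub>\<ge>\<^sub>0"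
    unfolding x0_def by (rule eval_star_nonneg[OF a0 frame_boost[OF w0(1)] boost_simps(1) t])
  ultimately show "eval_D v (conj_D A \<otimes>\<^bsub>hat_D_ring h\<^esub> A) \<in> \<real>\<^sub>\<ge>\<^sub>0" by simp
qed

end
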